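(* Let $\mathfrak g_n$ and $\mathfrak g_k$ be classical simple complex Lie algebras of ranks $n$ and $k$, respectively, and assume that $\mathfrak g_k$ propagates $\mathfrak g_n$, with Cartan subalgebras $\mathfrak h_n\subseteq\mathfrak h_k$ as in the context. (1) If $\mathfrak g_n\neq\mathfrak{so}(2n,\mathbb C)$ and $\mathfrak g_k\neq\mathfrak{so}(2k,\mathbb C)$ (that is, the common type is $A$, $B$ or $C$), then $$W(\mathfrak g_n,\mathfrak h_n)=W_{\mathfrak h_n}(\mathfrak g_k,\mathfrak h_k)|_{\mathfrak h_n}=\{w|_{\mathfrak h_n}\mid w\in W(\mathfrak g_k,\mathfrak h_k),\ w(\mathfrak h_n)=\mathfrak h_n\},$$ and the restriction map $\mathrm I_{W(\mathfrak g_k,\mathfrak h_k)}(\mathfrak h_{k,\mathbb R})\to \mathrm I_{W(\mathfrak g_n,\mathfrak h_n)}(\mathfrak h_{n,\mathbb R})$, $p\mapsto p|_{\mathfrak h_{n,\mathbb R}}$, is surjective. (2) If $\mathfrak g_n=\mathfrak{so}(2n,\mathbb C)\subset\mathfrak g_k=\mathfrak{so}(2k,\mathbb C)$ with $k>n$, then $$W_{\mathfrak h_n}(\mathfrak g_k,\mathfrak h_k)|_{\mathfrak h_n}=\{w|_{\mathfrak h_n}\mid w\in W(\mathfrak g_k,\mathfrak h_k),\ w(\mathfrak h_n)=\mathfrak h_n\}=\mathfrak S_n\rtimes\{1,-1\}^n$$ contains all sign changes, whereas the elements of $W(\mathfrak g_n,\mathfrak h_n)$ contain only even numbers of sign changes,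 so $W(\mathfrak g_n,\mathfrak h_n)\subsetneq W_{\mathfrak h_n}(\mathfrak g_k,\mathfrak h_k)|_{\mathfrak h_n}$. The elements of $\mathrm I_{W(\mathfrak g_k,\mathfrak h_k)}(\mathfrak h_{k,\mathbb R})|_{\mathfrak h_{n,\mathbb R}}$ are polynomials in the $x_j^2$, and the Pfaffian of $\mathfrak g_n$ (the square root of the determinant, i.e. up to a nonzero constant the polynomial $x_1x_2\cdots x_n$) is not in the image of the restriction map $\mathrm I_{W(\mathfrak g_k,\mathfrak h_k)}(\mathfrak h_{k,\mathbb R})\to\mathrm I_{W(\mathfrak g_n,\mathfrak h_n)}(\mathfrak h_{n,\mathbb R})$. (3) With the assumptions of (2), let $\widetilde W(\mathfrak g_k,\mathfrak h_k)=W(\mathfrak g_k,\mathfrak h_k)\rtimes\{1,\sigma_k\}$, and similarly for $n$. Then $\widetilde W(\mathfrak g_k,\mathfrak h_k)$ is a finite reflection group, and $$\widetilde W(\mathfrak g_n,\mathfrak h_n)=W_{\mathfrak h_n}(\mathfrak g_k,\mathfrak h_k)|_{\mathfrak h_{n,\mathbb R}}=\widetilde W_{\mathfrak h_n}(\mathfrak g_k,\mathfrak h_k)|_{\mathfrak h_n}.$$ (4) With the assumptions of (2), $$\mathrm I^{\mathrm{even}}_{W(\mathfrak g_k,\mathfrak h_k)}(\mathfrak h_{k,\mathbb R})=\mathrm I_{\widetilde W(\mathfrak g_k,\mathfrak h_k)}(\mathfrak h_{k,\mathbb R})$$ and $$\mathrm I_{W(\mathfrak g_k,\mathfrak h_k)}(\mathfrak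 h_{k,\mathbb R})|_{\mathfrak h_{n,\mathbb R}}=\mathrm I_{\widetilde W(\mathfrak g_k,\mathfrak h_k)}(\mathfrak h_{k,\mathbb R})|_{\mathfrak h_{n,\mathbb R}}=\mathrm I_{\widetilde W(\mathfrak g_n,\mathfrak h_n)}(\mathfrak h_{n,\mathbb R}).$$
   Context: **Propagation.** For a classical simple Lie algebra with Cartan subalgebra, number the simple roots of the Dynkin diagram so that $\alpha_1$ is the right endpoint: in types $B,C$ the node $\alpha_1$ is the one attached by the double bond, in type $D$ the nodes $\alpha_1,\alpha_2$ are the two endpoints of the fork. Let $\mathfrak g_n\subseteq\mathfrak g_k$ with Cartan subalgebras satisfying $\mathfrak h_n=\mathfrak g_n\cap\mathfrak h_k$. One says $\mathfrak g_k$ propagates $\mathfrak g_n$ if the simple root system $\Psi_k$ of $\mathfrak g_k$ is obtained from the simple root system $\Psi_n$ of $\mathfrak g_n$ by adding simple roots to the left end of the Dynkin diagram. Thus both have the same type, with ranks $k\ge n\ge1$ for $A$, $k\ge n\ge2$ for $B$, $k\ge n\ge3$ for $C$, $k\ge n\ge4$ for $D$. Concretely, these inclusions are realized as follows. **Realization.** $\mathfrak h_{k,\mathbb R}$ denotes the real subspace of $\mathfrak h_k$ on which all roots are real. Vectors are written $x=(x_s,\dots,x_1)$, with coordinate functionals $f_j(x)=x_j$. - Type $A_k$, $\mathfrak g_k=\mathfrak{sl}(k+1,\mathbb C)$: $\mathfrak h_{k,\mathbb R}=\{x\in\mathbb R^{k+1}\mid \sum x_j=0\}$ (diagonal matrices),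 roots $f_i-f_j$ ($i\ne j$), simple roots $f_j-f_{j-1}$, $2\le j\le k+1$; Weyl group $\mathfrak S_{k+1}$ permuting coordinates. - Type $B_k$, $\mathfrak g_k=\mathfrak{so}(2k+1,\mathbb C)$: $\mathfrak h_{k,\mathbb R}=\mathbb R^k$, roots $\pm f_i\pm f_j$ ($i\neq j$), $\pm f_i$, simple roots $\alpha_1=f_1$, $\alpha_j=f_j-f_{j-1}$; Weyl group $\mathfrak S_k\rtimes\{1,-1\}^k$ (permutations and all sign changes of coordinates). - Type $C_k$, $\mathfrak g_k=\mathfrak{sp}(k,\mathbb C)$ (rank $k$): $\mathfrak h_{k,\mathbb R}=\mathbb R^k$, roots $\pm f_i\pm f_j$ ($i\neq j$), $\pm2f_i$, simple roots $\alpha_1=2f_1$, $\alpha_j=f_j-f_{j-1}$; Weyl group $\mathfrak S_k\rtimes\{1,-1\}^k$. - Type $D_k$, $\mathfrak g_k=\mathfrak{so}(2k,\mathbb C)$: $\mathfrak h_{k,\mathbb R}=\mathbb R^k$, roots $\pm f_i\pm f_j$ ($i\ne j$), simple roots $\alpha_1=f_1+f_2$, $\alpha_j=f_j-f_{j-1}$ ($2\le j\le k$); Weyl group $\mathfrak S_k\rtimes\{\epsilon\in\{1,-1\}^k\mid \epsilon_1\cdots\epsilon_k=1\}$. In all cases $\mathfrak h_{n,\mathbb R}\subseteq\mathfrak h_{k,\mathbb R}$ via $x\mapsto(0,\dots,0,x)$ ($k-n$ zeros added on the left), corresponding to the block embedding of $\mathfrak g_n$ in $\mathfrak g_k$. **Notation.**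 $W(\mathfrak g_k,\mathfrak h_k)$ is the Weyl group; $W_{\mathfrak h_n}(\mathfrak g_k,\mathfrak h_k)=\{w\in W(\mathfrak g_k,\mathfrak h_k)\mid w(\mathfrak h_n)=\mathfrak h_n\}$; $\widetilde W_{\mathfrak h_n}(\mathfrak g_k,\mathfrak h_k)=\{w\in\widetilde W(\mathfrak g_k,\mathfrak h_k)\mid w(\mathfrak h_n)=\mathfrak h_n\}$. A bar $|_{\mathfrak h_n}$ after a set of maps or functions denotes the set of restrictions. For a group $W$ acting linearly on a vector space $V$, $\mathrm I_W(V)$ is the algebra of $W$-invariant polynomial functions on $V$. For type $D_k$, $\sigma_k$ is the involution of $\mathfrak h_k$ induced by the Dynkin diagram automorphism interchanging $\alpha_1$ and $\alpha_2$ and fixing $\alpha_j$ for $3\le j\le k$ (i.e. $x_1\mapsto -x_1$ and $x_j\mapsto x_j$ for $j\geq 2$). $\mathrm I^{\mathrm{even}}_{W(\mathfrak g_k,\mathfrak h_k)}(\mathfrak h_{k,\mathbb R})$ is the algebra of those elements of $\mathrm I_{W(\mathfrak g_k,\mathfrak h_k)}(\mathfrak h_{k,\mathbb R})$ that are even in each coordinate $x_j$ (polynomials in the $x_j^2$). *)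

theory Defs
  imports Complex_Main "HOL-Algebra.Bij" "HOL-Algebra.Coset" "HOL-Algebra.Generated_Groups"
    "HOL-Combinatorics.Permutations" "HOL-Library.Sublist"
begin

section \<open>The classical Lie algebras and their diagonal Cartan subalgebras\<close>

text \<open>
  A vector \<open>(x\<^sub>s, \<dots>, x\<^sub>1)\<close> is a function on \<^typ>\<open>nat\<close> that vanishes off \<open>{1..s}\<close>.  Adding zeros
  on the left does not change such a function, so \<open>cartan t n\<close> is literally a subset of
  \<open>cartan t k\<close>, and \<open>lie_algebra t n\<close> a subset of \<open>lie_algebra t k\<close> (block embedding).
\<close>

datatype lie_type = Type_A | Type_B | Type_C | Type_D

type_synonym vec = "nat \<Rightarrow> complex"

type_synonym matrix = "int \<Rightarrow> int \<Rightarrow> complex"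

definition admissible :: "lie_type \<Rightarrow> nat \<Rightarrow> bool" where
  "admissible t k \<longleftrightarrow>
     (case t of Type_A \<Rightarrow> 1 \<le> k | Type_B \<Rightarrow> 2 \<le> k | Type_C \<Rightarrow> 3 \<le> k | Type_D \<Rightarrow> 4 \<le> k)"

text \<open>Row and column indices.  In types B, C, D the basis vectors \<open>i\<close> and \<open>- i\<close> are dual for the
  invariant form, so that the diagonal entry at \<open>- i\<close> is minus the one at \<open>i\<close>.\<close>

definition indices :: "lie_type \<Rightarrow> nat \<Rightarrow> int set" where
  "indices t k =
     (case t of Type_A \<Rightarrow> {1..int k + 1} | Type_B \<Rightarrow> {- int k..int k}
      | Type_C \<Rightarrow> {- int k..int k} - {0} | Type_D \<Rightarrow> {- int k..int k} - {0})"

text \<open>\<open>sl(k+1)\<close>; \<open>so(2k+1)\<close> and \<open>so(2k)\<close> for the symmetric form \<open>(e\<^sub>i, e\<^sub>j) = \<delta>(i, - j)\<close>; \<open>sp(k)\<close> for the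
  alternating form \<open>(e\<^sub>i, e\<^sub>j) = sgn i \<delta>(i, - j)\<close>.\<close>

definition lie_algebra :: "lie_type \<Rightarrow> nat \<Rightarrow> matrix set" where
  "lie_algebra t k =
     {X. (\<forall>i j. i \<notin> indices t k \<or> j \<notin> indices t k \<longrightarrow> X i j = 0) \<and>
         (case t of
            Type_A \<Rightarrow> (\<Sum>i\<in>indices t k. X i i) = 0
          | Type_B \<Rightarrow> (\<forall>i j. X i j = - X (- j) (- i))
          | Type_C \<Rightarrow> (\<forall>i j. X i j = - (of_int (sgn i) * of_int (sgn j) * X (- j) (- i)))
          | Type_D \<Rightarrow> (\<forall>i j. X i j = - X (- j) (- i)))}"

definition lie_bracket :: "int set \<Rightarrow> matrix \<Rightarrow> matrix \<Rightarrow> matrix" where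
  "lie_bracket I X Y = (\<lambda>i j. (\<Sum>l\<in>I. X i l * Y l j) - (\<Sum>l\<in>I. Y i l * X l j))"

definition num_coords :: "lie_type \<Rightarrow> nat \<Rightarrow> nat" where
  "num_coords t k = (if t = Type_A then k + 1 else k)"

definition cartan :: "lie_type \<Rightarrow> nat \<Rightarrow> vec set" where
  "cartan t k =
     {x. (\<forall>j. j \<notin> {1..num_coords t k} \<longrightarrow> x j = 0) \<and>
         (t = Type_A \<longrightarrow> (\<Sum>j=1..num_coords t k. x j) = 0)}"

definition diag_entry :: "lie_type \<Rightarrow> vec \<Rightarrow> int \<Rightarrow> complex" where
  "diag_entry t x i = (if t = Type_A then x (nat i) else of_int (sgn i) * x (nat \<bar>i\<bar>))"

definition diag_matrix :: "lie_type \<Rightarrow> vec \<Rightarrow> matrix" where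
  "diag_matrix t x = (\<lambda>i j. if i = j then diag_entry t x i else 0)"


section \<open>Roots and Weyl groups\<close>

text \<open>Linear functionals on \<open>cartan t k\<close> are represented by coefficient vectors: \<open>a\<close> stands for
  \<open>\<Sum>j. a j * f\<^sub>j\<close>.  The vector is made unique by requiring it to lie in \<open>cartan t k\<close>, on which the
  pairing is nondegenerate.  The usual explicit lists of roots are \<open>roots_A\<close>, \<open>roots_B\<close>, \<open>roots_C\<close>,
  \<open>roots_D\<close> below.\<close>

definition pairing :: "vec \<Rightarrow> vec \<Rightarrow> complex" where
  "pairing a x = (\<Sum>j | a j \<noteq> 0. a j * x j)"

definition coord :: "nat \<Rightarrow> vec" where
  "coord i = (\<lambda>j. if j = i then 1 else 0)"

definition roots :: "lie_type \<Rightarrow> nat \<Rightarrow> vec set" where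
  "roots t k =
     {a \<in> cartan t k. a \<noteq> (\<lambda>_. 0) \<and>
        (\<exists>X\<in>lie_algebra t k. X \<noteq> (\<lambda>_ _. 0) \<and>
           (\<forall>x\<in>cartan t k.
              lie_bracket (indices t k) (diag_matrix t x) X = (\<lambda>i j. pairing a x * X i j)))}"

definition cartan_real :: "lie_type \<Rightarrow> nat \<Rightarrow> vec set" where
  "cartan_real t k = {x \<in> cartan t k. \<forall>a\<in>roots t k. pairing a x \<in> \<real>}"

text \<open>\<open>simple_root t j\<close> is the \<open>j\<close>-th simple root counted from the right end of the Dynkin diagram,
  and \<open>simple_root_system\<close> lists the simple roots from right to left.  Hence adding simple roots to
  the left end is list extension, and by \<open>propagates_iff\<close> below it forces equal types.\<close>

definition simple_root :: "lie_type \<Rightarrow> nat \<Rightarrow> vec" where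
  "simple_root t j =
     (case t of
        Type_A \<Rightarrow> (\<lambda>l. coord (j + 1) l - coord j l)
      | Type_B \<Rightarrow> (if j = 1 then coord 1 else (\<lambda>l. coord j l - coord (j - 1) l))
      | Type_C \<Rightarrow> (if j = 1 then (\<lambda>l. 2 * coord 1 l) else (\<lambda>l. coord j l - coord (j - 1) l))
      | Type_D \<Rightarrow> (if j = 1 then (\<lambda>l. coord 1 l + coord 2 l)
                   else (\<lambda>l. coord j l - coord (j - 1) l)))"

definition simple_root_system :: "lie_type \<Rightarrow> nat \<Rightarrow> vec list" where
  "simple_root_system t k = map (simple_root t) [1..<Suc k]"

definition propagates :: "lie_type \<Rightarrow> nat \<Rightarrow> lie_type \<Rightarrow> nat \<Rightarrow> bool" where
  "propagates t n t' k \<longleftrightarrow>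
     admissible t n \<and> admissible t' k \<and>
     prefix (simple_root_system t n) (simple_root_system t' k)"

text \<open>The standard bilinear form is, up to a factor, the restriction of the Killing form, so this is
  the root reflection \<open>x - a(x) H\<^sub>a\<close> when \<open>a\<close> is a root with coroot \<open>H\<^sub>a\<close>.\<close>

definition reflection :: "vec set \<Rightarrow> vec \<Rightarrow> (vec \<Rightarrow> vec)" where
  "reflection V a = (\<lambda>x\<in>V. \<lambda>j. x j - 2 * pairing a x / pairing a a * a j)"

definition weyl_group :: "lie_type \<Rightarrow> nat \<Rightarrow> (vec \<Rightarrow> vec) set" where
  "weyl_group t k = generate (BijGroup (cartan t k)) (reflection (cartan t k) ` roots t k)"

definition restrictions :: "(vec \<Rightarrow> 'b) set \<Rightarrow> vec set \<Rightarrow> (vec \<Rightarrow> 'b) set" where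
  "restrictions F U = (\<lambda>f. restrict f U) ` F"

definition stabilizer_of :: "vec set \<Rightarrow> (vec \<Rightarrow> vec) set \<Rightarrow> (vec \<Rightarrow> vec) set" where
  "stabilizer_of U W = {w \<in> W. w ` U = U}"

text \<open>The involution \<open>\<sigma>\<^sub>k\<close> of type D and the group \<open>W \<cdot> {1, \<sigma>\<^sub>k}\<close>.\<close>

definition sigma :: "nat \<Rightarrow> vec \<Rightarrow> vec" where
  "sigma k = (\<lambda>x\<in>cartan Type_D k. x(1 := - x 1))"

definition sigma_group :: "nat \<Rightarrow> (vec \<Rightarrow> vec) set" where
  "sigma_group k = {\<one>\<^bsub>BijGroup (cartan Type_D k)\<^esub>, sigma k}"

definition ext_weyl_group :: "nat \<Rightarrow> (vec \<Rightarrow> vec) set" where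
  "ext_weyl_group k =
     weyl_group Type_D k <#>\<^bsub>BijGroup (cartan Type_D k)\<^esub> sigma_group k"

text \<open>\<open>U\<close> is the internal semidirect product of the normal subgroup \<open>N\<close> and the complement \<open>Q\<close>.\<close>

definition is_semidirect_product :: "('a, 'b) monoid_scheme \<Rightarrow> 'a set \<Rightarrow> 'a set \<Rightarrow> 'a set \<Rightarrow> bool"
  where
  "is_semidirect_product G U N Q \<longleftrightarrow>
     subgroup U G \<and> N \<lhd> (G\<lparr>carrier := U\<rparr>) \<and> subgroup Q G \<and>
     N \<inter> Q = {\<one>\<^bsub>G\<^esub>} \<and> U = N <#>\<^bsub>G\<^esub> Q"

text \<open>Orthogonal reflections of \<open>cartan_real t k\<close>, extended complex linearly to \<open>cartan t k\<close>.\<close>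

definition finite_reflection_group :: "lie_type \<Rightarrow> nat \<Rightarrow> (vec \<Rightarrow> vec) set \<Rightarrow> bool" where
  "finite_reflection_group t k U \<longleftrightarrow>
     finite U \<and>
     (\<exists>R \<subseteq> cartan_real t k - {\<lambda>_. 0}.
        U = generate (BijGroup (cartan t k)) (reflection (cartan t k) ` R))"


section \<open>Permutations and sign changes of coordinates (types B, C, D)\<close>

definition signed_permutation :: "nat \<Rightarrow> (nat \<Rightarrow> nat) \<Rightarrow> (nat \<Rightarrow> int) \<Rightarrow> (vec \<Rightarrow> vec)" where
  "signed_permutation n \<pi> \<epsilon> = (\<lambda>x\<in>cartan Type_D n. \<lambda>j. of_int (\<epsilon> j) * x (\<pi> j))"

definition sign_vectors :: "nat \<Rightarrow> (nat \<Rightarrow> int) set" where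
  "sign_vectors n = {\<epsilon>. (\<forall>j\<in>{1..n}. \<epsilon> j \<in> {1, -1}) \<and> (\<forall>j. j \<notin> {1..n} \<longrightarrow> \<epsilon> j = 1)}"

definition coordinate_permutations :: "nat \<Rightarrow> (vec \<Rightarrow> vec) set" where
  "coordinate_permutations n = {signed_permutation n \<pi> (\<lambda>_. 1) | \<pi>. \<pi> permutes {1..n}}"

definition sign_changes :: "nat \<Rightarrow> (vec \<Rightarrow> vec) set" where
  "sign_changes n = signed_permutation n id ` sign_vectors n"


section \<open>Invariant polynomial functions\<close>

definition real_linear_functional :: "vec set \<Rightarrow> (vec \<Rightarrow> real) \<Rightarrow> bool" where
  "real_linear_functional V l \<longleftrightarrow>
     (\<forall>x\<in>V. \<forall>y\<in>V. l (\<lambda>j. x j + y j) = l x + l y) \<and>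
     (\<forall>c. \<forall>x\<in>V. l (\<lambda>j. complex_of_real c * x j) = c * l x)"

text \<open>For a real subspace \<open>V\<close>: the algebra of functions on \<open>V\<close> generated by its dual.  Functions on
  \<open>V\<close> are extensional, i.e. take the value \<^const>\<open>undefined\<close> off \<open>V\<close>.\<close>

inductive_set poly_functions :: "vec set \<Rightarrow> (vec \<Rightarrow> real) set" for V :: "vec set" where
  const: "(\<lambda>x\<in>V. c) \<in> poly_functions V"
| linear: "real_linear_functional V l \<Longrightarrow> restrict l V \<in> poly_functions V"
| add: "p \<in> poly_functions V \<Longrightarrow> q \<in> poly_functions V \<Longrightarrow> (\<lambda>x\<in>V. p x + q x) \<in> poly_functions V"
| mult: "p \<in> poly_functions V \<Longrightarrow> q \<in> poly_functions V \<Longrightarrow> (\<lambda>x\<in>V. p x * q x) \<in> poly_functions V"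

definition invariants :: "(vec \<Rightarrow> vec) set \<Rightarrow> vec set \<Rightarrow> (vec \<Rightarrow> real) set" where
  "invariants W V = {p \<in> poly_functions V. \<forall>w\<in>W. \<forall>x\<in>V. p (w x) = p x}"

definition even_invariants :: "nat \<Rightarrow> (vec \<Rightarrow> real) set" where
  "even_invariants k =
     {p \<in> invariants (weyl_group Type_D k) (cartan_real Type_D k).
        \<forall>j\<in>{1..k}. \<forall>x\<in>cartan_real Type_D k. p (x(j := - x j)) = p x}"

definition poly_in_squares :: "nat \<Rightarrow> (vec \<Rightarrow> real) \<Rightarrow> bool" where
  "poly_in_squares n p \<longleftrightarrow>
     (\<exists>q\<in>poly_functions (cartan_real Type_D n).
        \<forall>x\<in>cartan_real Type_D n. p x = q (\<lambda>j. (x j)\<^sup>2))"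

text \<open>The Pfaffian of \<open>so(2n)\<close> on \<open>cartan_real Type_D n\<close>, up to a nonzero constant (see
  \<open>pfaffian_square\<close> below); the coordinates are real there.\<close>

definition pfaffian :: "nat \<Rightarrow> vec \<Rightarrow> real" where
  "pfaffian n = (\<lambda>x\<in>cartan_real Type_D n. \<Prod>j=1..n. Re (x j))"


section \<open>Consistency of the definitions\<close>

lemma propagates_iff:
  "propagates t n t' k \<longleftrightarrow> t = t' \<and> n \<le> k \<and> admissible t n \<and> admissible t' k"
proof
  assume p: "propagates t n t' k"
  then have adm: "admissible t n" "admissible t' k"
    and pre: "prefix (simple_root_system t n) (simple_root_system t' k)"
    by (auto simp: propagates_def)
  have n: "1 \<le> n" using adm(1) by (auto simp: admissible_def split: lie_type.splits)
  have le: "n \<le> k" using prefix_length_le[OF pre] by (simp add: simple_root_system_def del: upt_Suc)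
  have "simple_root_system t n ! 0 = simple_root_system t' k ! 0"
    using pre n by (auto simp: prefix_def nth_append simple_root_system_def simp del: upt_Suc)
  then have eq: "simple_root t 1 = simple_root t' 1"
    using n le by (simp add: simple_root_system_def del: upt_Suc)
  have "t = t'"
    using fun_cong[OF eq, of 1] fun_cong[OF eq, of 2]
    by (cases t; cases t') (auto simp: simple_root_def coord_def)
  with le adm show "t = t' \<and> n \<le> k \<and> admissible t n \<and> admissible t' k" by simp
next
  assume a: "t = t' \<and> n \<le> k \<and> admissible t n \<and> admissible t' k"
  have "[1..<Suc k] = [1..<Suc n] @ [Suc n..<Suc k]"
    using a upt_add_eq_append[of 1 "Suc n" "k - n"] by simp
  then have "prefix (simple_root_system t n) (simple_root_system t k)"
    unfolding simple_root_system_def by (metis map_append prefixI)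
  with a show "propagates t n t' k" by (auto simp: propagates_def)
qed

lemma finite_indices: "finite (indices t k)"
  by (cases t) (auto simp: indices_def)

lemma indices_mono: "n \<le> k \<Longrightarrow> indices t n \<subseteq> indices t k"
  by (cases t) (auto simp: indices_def)

lemma lie_algebra_BD:
  assumes "X \<in> lie_algebra t k" "t \<in> {Type_B, Type_D}" shows "X i j = - X (- j) (- i)"
proof -
  consider "t = Type_B" | "t = Type_D" using assms(2) by auto
  then show ?thesis
  proof cases
    case 1
    show ?thesis
      by (rule conjunct2[OF assms(1)[unfolded 1 lie_algebra_def mem_Collect_eq lie_type.case], rule_format])
  next
    case 2
    show ?thesis
      by (rule conjunct2[OF assms(1)[unfolded 2 lie_algebra_def mem_Collect_eq lie_type.case], rule_format])
  qed
qed

lemma lie_algebra_C: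
  assumes "X \<in> lie_algebra Type_C k"
  shows "X i j = - (of_int (sgn i) * of_int (sgn j) * X (- j) (- i))"
  by (rule conjunct2[OF assms[unfolded lie_algebra_def mem_Collect_eq lie_type.case], rule_format])

lemma lie_algebraI:
  assumes supp: "\<And>i j. i \<notin> indices t k \<or> j \<notin> indices t k \<Longrightarrow> X i j = 0"
    and A: "t = Type_A \<Longrightarrow> (\<Sum>i\<in>indices t k. X i i) = 0"
    and BD: "\<And>i j. t \<noteq> Type_A \<Longrightarrow> t \<noteq> Type_C \<Longrightarrow> X i j = - X (- j) (- i)"
    and C: "\<And>i j. t = Type_C \<Longrightarrow> X i j = - (of_int (sgn i) * of_int (sgn j) * X (- j) (- i))"
  shows "X \<in> lie_algebra t k"
  unfolding lie_algebra_def
proof (intro CollectI conjI allI impI)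
  show "case t of
            Type_A \<Rightarrow> (\<Sum>i\<in>indices t k. X i i) = 0
          | Type_B \<Rightarrow> (\<forall>i j. X i j = - X (- j) (- i))
          | Type_C \<Rightarrow> (\<forall>i j. X i j = - (of_int (sgn i) * of_int (sgn j) * X (- j) (- i)))
          | Type_D \<Rightarrow> (\<forall>i j. X i j = - X (- j) (- i))"
  proof (cases t)
    case Type_A
    then show ?thesis using A by simp
  next
    case Type_B
    show ?thesis unfolding Type_B lie_type.case by (intro allI BD) (simp_all only: Type_B lie_type.distinct not_False_eq_True)
  next
    case Type_C
    show ?thesis unfolding Type_C lie_type.case by (intro allI C Type_C)
  next
    case Type_D
    show ?thesis unfolding Type_D lie_type.case by (intro allI BD) (simp_all only: Type_D lie_type.distinct not_False_eq_True)
  qed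
qed (rule supp)

lemma lie_algebra_mono:
  assumes "n \<le> k" shows "lie_algebra t n \<subseteq> lie_algebra t k"
proof
  fix X assume X: "X \<in> lie_algebra t n"
  have eq: "(\<Sum>i\<in>indices t k. X i i) = (\<Sum>i\<in>indices t n. X i i)"
    using X by (intro sum.mono_neutral_right)
      (use indices_mono[OF assms, of t] finite_indices in \<open>auto simp: lie_algebra_def\<close>)
  show "X \<in> lie_algebra t k"
    using X indices_mono[OF assms, of t] unfolding lie_algebra_def mem_Collect_eq eq by blast
qed

lemma sum_indices_A: "(\<Sum>i\<in>indices Type_A k. x (nat i)) = (\<Sum>j=1..k+1. x j)"
  by (rule sum.reindex_bij_witness[of _ int nat]) (auto simp: indices_def)

lemma diag_matrix_cartan:
  "diag_matrix t ` cartan t k = {X \<in> lie_algebra t k. \<forall>i j. i \<noteq> j \<longrightarrow> X i j = 0}"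
proof (intro equalityI subsetI)
  fix X assume "X \<in> diag_matrix t ` cartan t k"
  then obtain x where x: "x \<in> cartan t k" and X: "X = diag_matrix t x" by auto
  have tr: "(\<Sum>i\<in>indices t k. X i i) = 0" if "t = Type_A"
    using x that sum_indices_A[of x k]
    by (simp add: X diag_matrix_def diag_entry_def cartan_def num_coords_def)
  have out: "diag_entry t x i = 0" if "i \<notin> indices t k" for i
  proof (cases "t = Type_A")
    case True
    then have "nat i \<notin> {1..k+1}" using that by (auto simp: indices_def)
    then show ?thesis using x True by (auto simp: diag_entry_def cartan_def num_coords_def)
  next
    case False
    then have "i = 0 \<or> nat \<bar>i\<bar> \<notin> {1..k}"
      using that by (cases t) (auto simp: indices_def)
    then show ?thesis using x False by (auto simp: diag_entry_def cartan_def num_coords_def)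
  qed
  have anti: "diag_entry t x (- i) = - diag_entry t x i" if "t \<noteq> Type_A" for i
    using that by (simp add: diag_entry_def sgn_minus)
  have sg: "of_int (sgn i) * of_int (sgn i) * diag_entry t x i = diag_entry t x i" if "t \<noteq> Type_A" for i
    using that by (auto simp: diag_entry_def sgn_if)
  show "X \<in> {X \<in> lie_algebra t k. \<forall>i j. i \<noteq> j \<longrightarrow> X i j = 0}"
    using tr out anti sg
    by (auto simp: X diag_matrix_def lie_algebra_def split: lie_type.splits)
next
  fix X assume "X \<in> {X \<in> lie_algebra t k. \<forall>i j. i \<noteq> j \<longrightarrow> X i j = 0}"
  then have X: "X \<in> lie_algebra t k" and d: "\<And>i j. i \<noteq> j \<Longrightarrow> X i j = 0" by auto
  define x :: vec where "x = (\<lambda>j. if j = 0 then 0 else X (int j) (int j))"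
  have supp: "X i i = 0" if "i \<notin> indices t k" for i
    using X that by (auto simp: lie_algebra_def)
  have anti: "X i i = - X (- i) (- i)" if "t \<noteq> Type_A" for i
  proof (cases t)
    case Type_C
    then have *: "X i i = - (of_int (sgn i) * of_int (sgn i) * X (- i) (- i))"
      using X lie_algebra_C by blast
    show ?thesis
    proof (cases "i = 0")
      case True
      then show ?thesis using supp[of 0] Type_C by (simp add: indices_def)
    next
      case False
      then have sg: "of_int (sgn i) * of_int (sgn i) = (1::complex)" by (auto simp: sgn_if)
      show ?thesis using * unfolding sg by simp
    qed
  qed (use X that lie_algebra_BD[of X t k i i] in auto)
  have "x \<in> cartan t k"
  proof -
    have "x j = 0" if "j \<notin> {1..num_coords t k}" for j
    proof -
      have "j = 0 \<or> int j \<notin> indices t k" using that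
        by (cases t) (auto simp: num_coords_def indices_def)
      then show ?thesis using supp by (auto simp: x_def)
    qed
    moreover have "(\<Sum>j=1..num_coords t k. x j) = 0" if "t = Type_A"
    proof -
      have "(\<Sum>j=1..num_coords t k. x j) = (\<Sum>i\<in>indices Type_A k. x (nat i))"
        using that by (simp add: sum_indices_A num_coords_def)
      also have "\<dots> = (\<Sum>i\<in>indices Type_A k. X i i)"
        by (intro sum.cong) (auto simp: x_def indices_def)
      also have "\<dots> = 0" using X that by (simp add: lie_algebra_def)
      finally show ?thesis .
    qed
    ultimately show ?thesis by (auto simp: cartan_def)
  qed
  moreover have eq: "diag_matrix t x i j = X i j" for i j
  proof (cases "i = j")
    case False then show ?thesis by (simp add: diag_matrix_def d)
  next
    case True
    show ?thesis
    proof (cases "t = Type_A")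
      case A: True
      then have "X i i = 0" if "i \<le> 0" using supp[of i] that by (auto simp: indices_def)
      then show ?thesis using True A
        by (cases "i \<le> 0") (auto simp: diag_matrix_def diag_entry_def x_def)
    next
      case nA: False
      have "X 0 0 = 0" using anti[OF nA, of 0] by simp
      moreover have "X (- i) (- i) = - X i i" using anti[OF nA, of "- i"] by simp
      ultimately show ?thesis using True nA
        by (auto simp: diag_matrix_def diag_entry_def x_def sgn_if)
    qed
  qed
  ultimately show "X \<in> diag_matrix t ` cartan t k" 
    by (intro image_eqI[of _ _ x]; (intro ext)?) (simp_all only: eq)
qed

lemma cartan_Int:
  assumes "n \<le> k"
  shows "diag_matrix t ` cartan t n = lie_algebra t n \<inter> diag_matrix t ` cartan t k"
  unfolding diag_matrix_cartan using lie_algebra_mono[OF assms, of t] by blast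

lemma pairing_eq_sum:
  assumes "\<And>j. j \<notin> {1..m} \<Longrightarrow> a j = 0"
  shows "pairing a x = (\<Sum>j=1..m. a j * x j)"
proof -
  have "{j. a j \<noteq> 0} \<subseteq> {1..m}"
  proof
    fix j assume "j \<in> {j. a j \<noteq> 0}"
    then show "j \<in> {1..m}" using assms[of j] by (cases "j \<in> {1..m}") auto
  qed
  then show ?thesis unfolding pairing_def by (intro sum.mono_neutral_left) auto
qed

lemma lie_bracket_diag:
  assumes supp: "\<And>i j. i \<notin> indices t k \<or> j \<notin> indices t k \<Longrightarrow> X i j = 0"
  shows "lie_bracket (indices t k) (diag_matrix t x) X =
    (\<lambda>i j. (diag_entry t x i - diag_entry t x j) * X i j)"
proof (intro ext)
  fix i j
  have "(\<Sum>l\<in>indices t k. diag_matrix t x i l * X l j) = (if i \<in> indices t k then diag_entry t x i * X i j else 0)"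
    using finite_indices by (simp add: diag_matrix_def if_distrib[of "\<lambda>a. a * _"] sum.delta cong: if_cong)
  moreover have "(\<Sum>l\<in>indices t k. X i l * diag_matrix t x l j) = (if j \<in> indices t k then X i j * diag_entry t x j else 0)"
    using finite_indices by (simp add: diag_matrix_def if_distrib[of "\<lambda>a. _ * a"] sum.delta' cong: if_cong)
  ultimately show "lie_bracket (indices t k) (diag_matrix t x) X i j = (diag_entry t x i - diag_entry t x j) * X i j"
    using supp[of i j] by (auto simp: lie_bracket_def algebra_simps)
qed

definition entry_vec :: "lie_type \<Rightarrow> int \<Rightarrow> vec" where
  "entry_vec t i = (if t = Type_A then coord (nat i) else (\<lambda>l. of_int (sgn i) * coord (nat \<bar>i\<bar>) l))"

lemma sum_coord: "(\<Sum>j=1..m. coord i j * x j) = (if i \<in> {1..m} then x i else 0)"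
  by (simp add: coord_def if_distrib[of "\<lambda>a. a * _"] sum.delta cong: if_cong)

lemma entry_vec_zero:
  "i \<in> indices t k \<Longrightarrow> l \<notin> {1..num_coords t k} \<Longrightarrow> entry_vec t i l = 0"
  by (cases t) (auto simp: entry_vec_def coord_def num_coords_def indices_def sgn_if)

lemma pairing_entry_vec:
  assumes "i \<in> indices t k" "j \<in> indices t k" "x \<in> cartan t k"
  shows "pairing (\<lambda>l. entry_vec t i l - entry_vec t j l) x = diag_entry t x i - diag_entry t x j"
proof -
  have one: "(\<Sum>l=1..num_coords t k. entry_vec t i l * x l) = diag_entry t x i"
    if "i \<in> indices t k" for i
  proof (cases "t = Type_A")
    case True
    then have "nat i \<in> {1..k+1}" using that by (auto simp: indices_def)
    then show ?thesis using True sum_coord[of "nat i" x "k+1"]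
      by (simp add: entry_vec_def diag_entry_def num_coords_def del: sum.cl_ivl_Suc)
  next
    case False
    have "(\<Sum>l=1..num_coords t k. entry_vec t i l * x l) =
        of_int (sgn i) * (\<Sum>l=1..k. coord (nat \<bar>i\<bar>) l * x l)"
      using False by (simp add: entry_vec_def num_coords_def sum_distrib_left mult.assoc)
    also have "\<dots> = diag_entry t x i"
      unfolding sum_coord using False that
      by (cases t) (auto simp: diag_entry_def indices_def sgn_if)
    finally show ?thesis .
  qed
  have "pairing (\<lambda>l. entry_vec t i l - entry_vec t j l) x =
      (\<Sum>l=1..num_coords t k. (entry_vec t i l - entry_vec t j l) * x l)"
    using entry_vec_zero assms by (intro pairing_eq_sum) auto
  also have "\<dots> = diag_entry t x i - diag_entry t x j"
    using one[OF assms(1)] one[OF assms(2)] by (simp add: algebra_simps sum_subtractf)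
  finally show ?thesis .
qed

lemma entry_vec_diff_cartan:
  assumes "i \<in> indices t k" "j \<in> indices t k"
  shows "(\<lambda>l. entry_vec t i l - entry_vec t j l) \<in> cartan t k"
proof -
  have "(\<Sum>l=1..k+1. coord (nat i) l) = 1" if "t = Type_A" "i \<in> indices t k" for i
    using that sum_coord[of "nat i" "\<lambda>_. 1" "k+1"] by (auto simp: indices_def)
  then show ?thesis using assms entry_vec_zero[of _ t k]
    by (auto simp: cartan_def sum_subtractf entry_vec_def num_coords_def simp del: sum.cl_ivl_Suc)
qed

lemma pairing_nondegenerate:
  assumes a: "a \<in> cartan t k" and b: "b \<in> cartan t k"
    and eq: "\<And>x. x \<in> cartan t k \<Longrightarrow> pairing a x = pairing b x"
  shows "a = b"
proof -
  let ?m = "num_coords t k"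
  define x where "x = (\<lambda>j. cnj (a j - b j))"
  have x: "x \<in> cartan t k"
    using a b by (auto simp: cartan_def x_def sum_subtractf simp flip: cnj_sum)
  have "0 = pairing a x - pairing b x" using eq[OF x] by simp
  also have "\<dots> = (\<Sum>j=1..?m. a j * x j) - (\<Sum>j=1..?m. b j * x j)"
    using a b pairing_eq_sum[of ?m a x] pairing_eq_sum[of ?m b x] by (auto simp: cartan_def)
  also have "\<dots> = (\<Sum>j=1..?m. (a j - b j) * cnj (a j - b j))"
    by (simp add: x_def left_diff_distrib flip: sum_subtractf)
  also have "\<dots> = of_real (\<Sum>j=1..?m. (cmod (a j - b j))\<^sup>2)"
    by (simp only: complex_norm_square of_real_sum)
  finally have "(\<Sum>j=1..?m. (cmod (a j - b j))\<^sup>2) = 0" by (metis of_real_eq_0_iff)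
  then have "\<forall>j\<in>{1..?m}. a j = b j"
    by (subst (asm) sum_nonneg_eq_0_iff) auto
  then show ?thesis using a b by (auto simp: cartan_def fun_eq_iff)
qed

lemma entry_vec_inj:
  assumes eq: "entry_vec t i = entry_vec t j" and I: "i \<in> indices t k" "j \<in> indices t k"
  shows "i = j"
proof (cases "t = Type_A")
  case True
  then have "nat i = nat j"
    using fun_cong[OF eq, of "nat i"] by (simp add: entry_vec_def coord_def split: if_splits)
  with I True show ?thesis by (auto simp: indices_def)
next
  case False
  have l: "of_int (sgn i) * coord (nat \<bar>i\<bar>) l = of_int (sgn j) * coord (nat \<bar>j\<bar>) l" for l
    using fun_cong[OF eq, of l] False by (simp add: entry_vec_def)
  show ?thesis
  proof (cases "\<bar>i\<bar> = \<bar>j\<bar>")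
    case True
    then have "complex_of_int (sgn i) = of_int (sgn j)" using l[of "nat \<bar>i\<bar>"] by (simp add: coord_def)
    then have "sgn i = sgn j" by (simp only: of_int_eq_iff)
    with True show ?thesis by (metis abs_sgn mult_sgn_abs)
  next
    case ne: False
    then have "nat \<bar>i\<bar> \<noteq> nat \<bar>j\<bar>" by simp
    then show ?thesis using l[of "nat \<bar>i\<bar>"] l[of "nat \<bar>j\<bar>"] by (simp add: coord_def sgn_0_0)
  qed
qed

lemma roots_eq:
  "roots t k = {(\<lambda>l. entry_vec t i l - entry_vec t j l) | i j.
     i \<in> indices t k \<and> j \<in> indices t k \<and> i \<noteq> j \<and> (t \<in> {Type_B, Type_D} \<longrightarrow> j \<noteq> - i)}"
  (is "_ = ?R")
proof (intro equalityI subsetI)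
  fix a assume "a \<in> roots t k"
  then obtain X where a: "a \<in> cartan t k" "a \<noteq> (\<lambda>_. 0)" and X: "X \<in> lie_algebra t k" "X \<noteq> (\<lambda>_ _. 0)"
    and br: "\<And>x. x \<in> cartan t k \<Longrightarrow>
      lie_bracket (indices t k) (diag_matrix t x) X = (\<lambda>i j. pairing a x * X i j)"
    unfolding roots_def by auto
  from X(2) obtain i j where ij: "X i j \<noteq> 0" by (auto simp: fun_eq_iff)
  have supp: "\<And>i j. i \<notin> indices t k \<or> j \<notin> indices t k \<Longrightarrow> X i j = 0"
    using X(1) by (auto simp: lie_algebra_def)
  have I: "i \<in> indices t k" "j \<in> indices t k" using supp ij by blast+
  have "pairing a x = pairing (\<lambda>l. entry_vec t i l - entry_vec t j l) x" if "x \<in> cartan t k" for x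
  proof -
    have "(diag_entry t x i - diag_entry t x j) * X i j = pairing a x * X i j"
      using fun_cong[OF fun_cong[OF br[OF that]], of i j]
        fun_cong[OF fun_cong[OF lie_bracket_diag[of t k X x]], of i j] supp by auto
    then show ?thesis using ij pairing_entry_vec[OF I that] by simp
  qed
  then have eq: "a = (\<lambda>l. entry_vec t i l - entry_vec t j l)"
    using a(1) entry_vec_diff_cartan[OF I] by (intro pairing_nondegenerate) auto
  have "j \<noteq> - i" if "t \<in> {Type_B, Type_D}"
  proof
    assume "j = - i"
    then have "X i j = - X i j"
        using lie_algebra_BD[OF X(1) that, of i j] by simp
    with ij show False by simp
  qed
  moreover have "i \<noteq> j" using a(2) eq by auto
  ultimately show "a \<in> ?R" using I eq by auto
next
  fix a assume "a \<in> ?R"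
  then obtain i j where a: "a = (\<lambda>l. entry_vec t i l - entry_vec t j l)"
    and I: "i \<in> indices t k" "j \<in> indices t k" and ne: "i \<noteq> j"
    and BD: "t \<in> {Type_B, Type_D} \<longrightarrow> j \<noteq> - i" by auto
  define E :: "int \<Rightarrow> int \<Rightarrow> matrix" where "E = (\<lambda>i j i' j'. if i' = i \<and> j' = j then 1 else 0)"
  define s :: complex where
    "s = (case t of Type_A \<Rightarrow> 0 | Type_C \<Rightarrow> of_int (sgn i) * of_int (sgn j) | _ \<Rightarrow> 1)"
  define X :: matrix where "X = (\<lambda>i' j'. E i j i' j' - s * E (- j) (- i) i' j')"
  have mI: "- i \<in> indices t k" "- j \<in> indices t k" if "t \<noteq> Type_A"
    using I that by (cases t; auto simp: indices_def)+
  have supp: "X i' j' = 0" if "i' \<notin> indices t k \<or> j' \<notin> indices t k" for i' j'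
  proof -
    have "E i j i' j' = 0" using that I by (auto simp: E_def)
    moreover have "s = 0 \<or> E (- j) (- i) i' j' = 0"
    proof (cases "t = Type_A")
      case False
      have "\<not> (i' = - j \<and> j' = - i)" using that mI[OF False] by metis
      then show ?thesis by (simp only: E_def if_False simp_thms)
    qed (simp add: s_def)
    ultimately show ?thesis by (auto simp: X_def)
  qed
  have E: "E i j (- j') (- i') = E (- j) (- i) i' j'" "E (- j) (- i) (- j') (- i') = E i j i' j'"
    for i' j'
  proof -
    have "(- j' = i \<and> - i' = j) \<longleftrightarrow> (i' = - j \<and> j' = - i)"
      "(- j' = - j \<and> - i' = - i) \<longleftrightarrow> (i' = i \<and> j' = j)" by linarith+
    then show "E i j (- j') (- i') = E (- j) (- i) i' j'" "E (- j) (- i) (- j') (- i') = E i j i' j'"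
      by (simp_all only: E_def)
  qed
  have "X \<in> lie_algebra t k"
  proof (cases "t = Type_A")
    case True
    then have "X l l = 0" for l using ne by (simp add: X_def E_def s_def)
    with supp True show ?thesis by (simp add: lie_algebra_def)
  next
    case False
    have "X i' j' = - X (- j') (- i')" if "t \<noteq> Type_C" for i' j'
    proof -
      have "s = 1" using that False by (cases t) (simp_all add: s_def)
      then show ?thesis by (simp add: X_def E)
    qed
    moreover have "X i' j' = - (of_int (sgn i') * of_int (sgn j') * X (- j') (- i'))"
      if "t = Type_C" for i' j'
    proof -
      define c :: complex where "c = of_int (sgn i') * of_int (sgn j')"
      have "i \<noteq> 0" "j \<noteq> 0" using I that by (simp_all add: indices_def)
      then have ss: "s * s = 1" by (simp add: s_def that sgn_if)
      have c1: "c * E i j i' j' = s * E i j i' j'"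
        by (simp add: E_def c_def s_def that)
      have c2: "c * E (- j) (- i) i' j' = s * E (- j) (- i) i' j'"
        by (simp add: E_def c_def s_def that sgn_minus)
      have "- (c * X (- j') (- i')) = s * (c * E i j i' j') - c * E (- j) (- i) i' j'"
        by (simp add: X_def E algebra_simps)
      also have "\<dots> = s * s * E i j i' j' - s * E (- j) (- i) i' j'"
        by (simp only: c1 c2 mult.assoc)
      finally have "X i' j' = - (c * X (- j') (- i'))" by (simp only: ss X_def mult_1)
      then show ?thesis by (simp only: c_def)
    qed
    ultimately show ?thesis using supp False by (intro lie_algebraI) blast+
  qed
  moreover have "X \<noteq> (\<lambda>_ _. 0)"
  proof -
    have "X i j \<noteq> 0"
    proof (cases "j = - i")
      case True
      then have "s = 0 \<or> s = - 1"
        using BD I by (cases t) (auto simp: s_def indices_def sgn_if)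
      with True show ?thesis by (auto simp: X_def E_def)
    next
      case False
      then show ?thesis by (auto simp: X_def E_def)
    qed
    then show ?thesis by (auto simp: fun_eq_iff)
  qed
  moreover have "a \<noteq> (\<lambda>_. 0)"
  proof -
    have "entry_vec t i \<noteq> entry_vec t j" using entry_vec_inj[OF _ I] ne by blast
    then show ?thesis by (auto simp: a fun_eq_iff)
  qed
  moreover have "lie_bracket (indices t k) (diag_matrix t x) X = (\<lambda>i j. pairing a x * X i j)"
    if "x \<in> cartan t k" for x
  proof -
    have "(diag_entry t x i' - diag_entry t x j') * E i j i' j' =
        (diag_entry t x i - diag_entry t x j) * E i j i' j'" for i' j'
      by (simp add: E_def)
    moreover have "(diag_entry t x i' - diag_entry t x j') * (s * E (- j) (- i) i' j') =
        (diag_entry t x i - diag_entry t x j) * (s * E (- j) (- i) i' j')" for i' j'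
      by (cases "t = Type_A") (simp_all add: E_def s_def diag_entry_def sgn_minus)
    ultimately have "(diag_entry t x i' - diag_entry t x j') * X i' j' = (diag_entry t x i - diag_entry t x j) * X i' j'"
      for i' j' by (simp only: X_def right_diff_distrib)
    moreover have "lie_bracket (indices t k) (diag_matrix t x) X =
        (\<lambda>i j. (diag_entry t x i - diag_entry t x j) * X i j)"
      by (rule lie_bracket_diag) (rule supp)
    ultimately show ?thesis by (simp only: a pairing_entry_vec[OF I that])
  qed
  ultimately show "a \<in> roots t k"
    using entry_vec_diff_cartan[OF I] by (auto simp: roots_def a)
qed

lemma roots_A:
  "roots Type_A k = {(\<lambda>l. coord i l - coord j l) | i j. i \<in> {1..k+1} \<and> j \<in> {1..k+1} \<and> i \<noteq> j}"
  (is "_ = ?R")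
proof (intro equalityI subsetI)
  fix a assume "a \<in> roots Type_A k"
  then obtain i j where a: "a = (\<lambda>l. entry_vec Type_A i l - entry_vec Type_A j l)"
    and ij: "i \<in> indices Type_A k" "j \<in> indices Type_A k" "i \<noteq> j"
    unfolding roots_eq by blast
  have "a = (\<lambda>l. coord (nat i) l - coord (nat j) l)" by (simp add: a entry_vec_def)
  moreover have "nat i \<in> {1..k+1}" "nat j \<in> {1..k+1}" "nat i \<noteq> nat j"
    using ij by (auto simp: indices_def)
  ultimately show "a \<in> ?R" by blast
next
  fix a assume "a \<in> ?R"
  then obtain i j where a: "a = (\<lambda>l. coord i l - coord j l)"
    and ij: "i \<in> {1..k+1}" "j \<in> {1..k+1}" "i \<noteq> j"
    by blast
  have "a = (\<lambda>l. entry_vec Type_A (int i) l - entry_vec Type_A (int j) l)"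
    by (simp add: a entry_vec_def)
  moreover have "int i \<in> indices Type_A k" "int j \<in> indices Type_A k" "int i \<noteq> int j"
    using ij by (simp_all add: indices_def)
  moreover have "Type_A \<notin> {Type_B, Type_D}" by simp
  ultimately show "a \<in> roots Type_A k" unfolding roots_eq by blast
qed

abbreviation pm_roots :: "nat \<Rightarrow> vec set" where
  "pm_roots k \<equiv> {(\<lambda>l. s * coord i l + s' * coord j l) | s s' i j.
     s \<in> {1, -1} \<and> s' \<in> {1, -1} \<and> i \<in> {1..k} \<and> j \<in> {1..k} \<and> i \<noteq> j}"

lemma indices_BCD: "t \<noteq> Type_A \<Longrightarrow> i \<noteq> 0 \<Longrightarrow> i \<in> indices t k \<longleftrightarrow> nat \<bar>i\<bar> \<in> {1..k}"
  by (cases t) (auto simp: indices_def)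

lemma entry_vec_BCD: "t \<noteq> Type_A \<Longrightarrow> entry_vec t i l = of_int (sgn i) * coord (nat \<bar>i\<bar>) l"
  by (simp add: entry_vec_def)

lemma signed_index:
  assumes "s \<in> {1, -1 :: complex}" "i \<in> {1..k}"
  obtains i' :: int where "i' \<noteq> 0" "nat \<bar>i'\<bar> = i" "of_int (sgn i') = s"
  using assms that[of "int i"] that[of "- int i"] by (auto simp: sgn_minus)

lemma pm_rootsI:
  assumes t: "t \<noteq> Type_A" and I: "i \<in> indices t k" "j \<in> indices t k" "i \<noteq> 0" "j \<noteq> 0" "\<bar>i\<bar> \<noteq> \<bar>j\<bar>"
  shows "(\<lambda>l. entry_vec t i l - entry_vec t j l) \<in> pm_roots k"
proof -
  have "nat \<bar>i\<bar> \<in> {1..k}" "nat \<bar>j\<bar> \<in> {1..k}" "nat \<bar>i\<bar> \<noteq> nat \<bar>j\<bar>"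
    using I indices_BCD[OF t] by simp_all
  moreover have "of_int (sgn i) \<in> {1, -1 :: complex}" "- of_int (sgn j) \<in> {1, -1 :: complex}"
    using I(3,4) by (simp_all add: sgn_if)
  moreover have "(\<lambda>l. entry_vec t i l - entry_vec t j l) =
      (\<lambda>l. of_int (sgn i) * coord (nat \<bar>i\<bar>) l + (- of_int (sgn j)) * coord (nat \<bar>j\<bar>) l)"
    by (simp add: entry_vec_BCD[OF t])
  ultimately show ?thesis by blast
qed

lemma pm_roots_subset:
  assumes t: "t \<noteq> Type_A" shows "pm_roots k \<subseteq> roots t k"
proof
  fix a assume "a \<in> pm_roots k"
  then obtain s s' i j where a: "a = (\<lambda>l. s * coord i l + s' * coord j l)"
    and s: "s \<in> {1, -1}" "s' \<in> {1, -1}" and ij: "i \<in> {1..k}" "j \<in> {1..k}" "i \<noteq> j" by blast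
  obtain i' where i': "i' \<noteq> 0" "nat \<bar>i'\<bar> = i" "of_int (sgn i') = s"
    using signed_index[OF s(1) ij(1)] by blast
  have "- s' \<in> {1, -1}" using s by auto
  then obtain j' where j': "j' \<noteq> 0" "nat \<bar>j'\<bar> = j" "of_int (sgn j') = - s'"
    using signed_index[OF _ ij(2)] by blast
  have "a = (\<lambda>l. entry_vec t i' l - entry_vec t j' l)"
    by (simp only: entry_vec_BCD[OF t] i' j' a) simp
  moreover have "i' \<in> indices t k" "j' \<in> indices t k"
    using indices_BCD[OF t] i' j' ij by simp_all
  moreover have "i' \<noteq> j'" "j' \<noteq> - i'" using ij i' j' by auto
  ultimately show "a \<in> roots t k" unfolding roots_eq by blast
qed

lemma roots_D: "roots Type_D k = pm_roots k"
proof
  show "roots Type_D k \<subseteq> pm_roots k"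
  proof
    fix a assume "a \<in> roots Type_D k"
    then obtain i j where a: "a = (\<lambda>l. entry_vec Type_D i l - entry_vec Type_D j l)"
      and ij: "i \<in> indices Type_D k" "j \<in> indices Type_D k" "i \<noteq> j" "j \<noteq> - i"
      unfolding roots_eq by blast
    have "i \<noteq> 0" "j \<noteq> 0" "\<bar>i\<bar> \<noteq> \<bar>j\<bar>" using ij by (auto simp: indices_def)
    then show "a \<in> pm_roots k" unfolding a by (intro pm_rootsI ij) simp_all
  qed
qed (rule pm_roots_subset, simp)

lemma roots_B: "roots Type_B k = pm_roots k \<union> {(\<lambda>l. s * coord i l) | s i. s \<in> {1, -1} \<and> i \<in> {1..k}}"
  (is "_ = _ \<union> ?S")
proof
  show "roots Type_B k \<subseteq> pm_roots k \<union> ?S"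
  proof
    fix a assume "a \<in> roots Type_B k"
    then obtain i j where a: "a = (\<lambda>l. entry_vec Type_B i l - entry_vec Type_B j l)"
      and ij: "i \<in> indices Type_B k" "j \<in> indices Type_B k" "i \<noteq> j" "j \<noteq> - i"
      unfolding roots_eq by blast
    consider "i = 0" | "j = 0" "i \<noteq> 0" | "i \<noteq> 0" "j \<noteq> 0" by blast
    then show "a \<in> pm_roots k \<union> ?S"
    proof cases
      case 1
      with ij have "j \<noteq> 0" by simp
      then have "nat \<bar>j\<bar> \<in> {1..k}" "- of_int (sgn j) \<in> {1, -1 :: complex}"
        using ij(2) indices_BCD[of Type_B j k] by (simp_all add: sgn_if)
      moreover have "a = (\<lambda>l. - of_int (sgn j) * coord (nat \<bar>j\<bar>) l)"
        by (simp add: a 1 entry_vec_BCD)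
      ultimately show ?thesis by blast
    next
      case 2
      then have "nat \<bar>i\<bar> \<in> {1..k}" "of_int (sgn i) \<in> {1, -1 :: complex}"
        using ij(1) indices_BCD[of Type_B i k] by (simp_all add: sgn_if)
      moreover have "a = (\<lambda>l. of_int (sgn i) * coord (nat \<bar>i\<bar>) l)"
        by (simp add: a 2 entry_vec_BCD)
      ultimately show ?thesis by blast
    next
      case 3
      have "\<bar>i\<bar> \<noteq> \<bar>j\<bar>" using ij by auto
      with 3 have "a \<in> pm_roots k" unfolding a by (intro pm_rootsI ij) simp_all
      then show ?thesis ..
    qed
  qed
  have "?S \<subseteq> roots Type_B k"
  proof
    fix a assume "a \<in> ?S"
    then obtain s i where a: "a = (\<lambda>l. s * coord i l)" and s: "s \<in> {1, -1}" and i: "i \<in> {1..k}"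
      by blast
    obtain i' where i': "i' \<noteq> 0" "nat \<bar>i'\<bar> = i" "of_int (sgn i') = s"
      using signed_index[OF s i] by blast
    have "a = (\<lambda>l. entry_vec Type_B i' l - entry_vec Type_B 0 l)"
      by (simp add: entry_vec_BCD i' a)
    moreover have "i' \<in> indices Type_B k" "0 \<in> indices Type_B k" "i' \<noteq> 0" "0 \<noteq> - i'"
      using indices_BCD[of Type_B i' k] i i' by (simp_all add: indices_def)
    ultimately show "a \<in> roots Type_B k" unfolding roots_eq by blast
  qed
  then show "pm_roots k \<union> ?S \<subseteq> roots Type_B k"
    by (intro Un_least pm_roots_subset) simp_all
qed

lemma roots_C: "roots Type_C k = pm_roots k \<union> {(\<lambda>l. s * (2 * coord i l)) | s i. s \<in> {1, -1} \<and> i \<in> {1..k}}"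
  (is "_ = _ \<union> ?S")
proof
  show "roots Type_C k \<subseteq> pm_roots k \<union> ?S"
  proof
    fix a assume "a \<in> roots Type_C k"
    then obtain i j where a: "a = (\<lambda>l. entry_vec Type_C i l - entry_vec Type_C j l)"
      and ij: "i \<in> indices Type_C k" "j \<in> indices Type_C k" "i \<noteq> j"
      unfolding roots_eq by blast
    have nz: "i \<noteq> 0" "j \<noteq> 0" using ij by (auto simp: indices_def)
    show "a \<in> pm_roots k \<union> ?S"
    proof (cases "j = - i")
      case True
      have "nat \<bar>i\<bar> \<in> {1..k}" "of_int (sgn i) \<in> {1, -1 :: complex}"
        using nz ij(1) indices_BCD[of Type_C i k] by (simp_all add: sgn_if)
      moreover have "a = (\<lambda>l. of_int (sgn i) * (2 * coord (nat \<bar>i\<bar>) l))"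
        by (simp add: a True entry_vec_BCD sgn_minus fun_eq_iff)
      ultimately show ?thesis by blast
    next
      case False
      with ij have "\<bar>i\<bar> \<noteq> \<bar>j\<bar>" by auto
      with nz have "a \<in> pm_roots k" unfolding a by (intro pm_rootsI ij) simp_all
      then show ?thesis ..
    qed
  qed
  have "?S \<subseteq> roots Type_C k"
  proof
    fix a assume "a \<in> ?S"
    then obtain s i where a: "a = (\<lambda>l. s * (2 * coord i l))" and s: "s \<in> {1, -1}" and i: "i \<in> {1..k}"
      by blast
    obtain i' where i': "i' \<noteq> 0" "nat \<bar>i'\<bar> = i" "of_int (sgn i') = s"
      using signed_index[OF s i] by blast
    have "a = (\<lambda>l. entry_vec Type_C i' l - entry_vec Type_C (- i') l)"
      by (simp add: entry_vec_BCD i' a sgn_minus fun_eq_iff)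
    moreover have "i' \<in> indices Type_C k" "- i' \<in> indices Type_C k" "i' \<noteq> - i'"
      using indices_BCD[of Type_C i' k] indices_BCD[of Type_C "- i'" k] i i' by simp_all
    moreover have "Type_C \<notin> {Type_B, Type_D}" by simp
    ultimately show "a \<in> roots Type_C k" unfolding roots_eq by blast
  qed
  then show "pm_roots k \<union> ?S \<subseteq> roots Type_C k"
    by (intro Un_least pm_roots_subset) simp_all
qed

lemma cartan_real_eq:
  assumes "admissible t k"
  shows "cartan_real t k = {x \<in> cartan t k. \<forall>j. x j \<in> \<real>}"
proof (intro equalityI subsetI)
  fix x assume x: "x \<in> {x \<in> cartan t k. \<forall>j. x j \<in> \<real>}"
  have "pairing a x \<in> \<real>" if "a \<in> roots t k" for a
  proof -
    from that obtain i j where a: "a = (\<lambda>l. entry_vec t i l - entry_vec t j l)"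
      unfolding roots_eq by blast
    have "entry_vec t i l \<in> \<real>" for i l
      by (simp add: entry_vec_def coord_def)
    then have "a l \<in> \<real>" for l unfolding a by (intro Reals_diff)
    with x show ?thesis unfolding pairing_def by (intro sum_in_Reals Reals_mult) simp_all
  qed
  with x show "x \<in> cartan_real t k" unfolding cartan_real_def by blast
next
  fix x assume x: "x \<in> cartan_real t k"
  then have xc: "x \<in> cartan t k" and re: "\<And>a. a \<in> roots t k \<Longrightarrow> pairing a x \<in> \<real>"
    unfolding cartan_real_def by blast+
  have re': "diag_entry t x i - diag_entry t x j \<in> \<real>"
    if "i \<in> indices t k" "j \<in> indices t k" "i \<noteq> j" "t \<in> {Type_B, Type_D} \<longrightarrow> j \<noteq> - i" for i j
  proof -
    have "(\<lambda>l. entry_vec t i l - entry_vec t j l) \<in> roots t k" unfolding roots_eq using that by blast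
    from re[OF this] show ?thesis using pairing_entry_vec[OF that(1,2) xc] by simp
  qed
  have "x j \<in> \<real>" if j: "j \<in> {1..num_coords t k}" for j
  proof (cases "t = Type_A")
    case True
    have *: "x j - x i \<in> \<real>" if i: "i \<in> {1..k+1}" for i
    proof (cases "i = j")
      case False
      have "int j \<in> indices t k" "int i \<in> indices t k"
        using i j True by (simp_all add: indices_def num_coords_def)
      from re'[OF this] False True show ?thesis by (simp add: diag_entry_def)
    qed simp
    have "(\<Sum>i=1..k+1. x j - x i) = of_nat (k+1) * x j"
      using xc True by (simp add: sum_subtractf cartan_def num_coords_def del: sum.cl_ivl_Suc)
    then have "x j = (\<Sum>i=1..k+1. x j - x i) / of_nat (k+1)"
      by (simp del: sum.cl_ivl_Suc of_nat_Suc)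
    also have "\<dots> \<in> \<real>" using * by (intro Reals_divide sum_in_Reals) auto
    finally show ?thesis .
  next
    case False
    have j': "j \<in> {1..k}" using j False by (simp add: num_coords_def)
    define l where "l = (if j = 1 then 2 else 1 :: nat)"
    have l: "l \<in> {1..k}" "l \<noteq> j" using assms False j' by (cases t; auto simp: l_def admissible_def)+
    have I: "int j \<in> indices t k" "int l \<in> indices t k" "- int l \<in> indices t k"
      using j' l False by (cases t; auto simp: indices_def)+
    have "x j - x l \<in> \<real>" "x j + x l \<in> \<real>"
      using re'[OF I(1,2)] re'[OF I(1,3)] j' l False by (simp_all add: diag_entry_def)
    then have "((x j - x l) + (x j + x l)) / 2 \<in> \<real>"
      by (rule Reals_divide[OF Reals_add]) simp
    then show ?thesis by simp
  qed
  with xc show "x \<in> {x \<in> cartan t k. \<forall>j. x j \<in> \<real>}"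
    unfolding cartan_def mem_Collect_eq by (metis Reals_0)
qed

lemma pfaffian_square:
  assumes "x \<in> cartan_real Type_D n" "4 \<le> n"
  shows "complex_of_real ((pfaffian n x)\<^sup>2) = (- 1) ^ n * (\<Prod>i\<in>indices Type_D n. diag_matrix Type_D x i i)"
proof -
  have re: "complex_of_real (Re (x j)) = x j" for j
    using assms cartan_real_eq[of Type_D n] by (auto simp: admissible_def)
  have ind: "indices Type_D n = int ` {1..n} \<union> (\<lambda>j. - int j) ` {1..n}"
  proof (intro equalityI subsetI)
    fix i assume "i \<in> indices Type_D n"
    then have "i = int (nat \<bar>i\<bar>) \<or> i = - int (nat \<bar>i\<bar>)" "nat \<bar>i\<bar> \<in> {1..n}" by (auto simp: indices_def)
    then show "i \<in> int ` {1..n} \<union> (\<lambda>j. - int j) ` {1..n}" by blast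
  qed (auto simp: indices_def)
  have "(\<Prod>i\<in>indices Type_D n. diag_matrix Type_D x i i) =
      (\<Prod>i\<in>int ` {1..n}. diag_entry Type_D x i) * (\<Prod>i\<in>(\<lambda>j. - int j) ` {1..n}. diag_entry Type_D x i)"
    unfolding ind diag_matrix_def by (subst prod.union_disjoint) auto
  also have "\<dots> = (\<Prod>j=1..n. x j) * (\<Prod>j=1..n. - x j)"
    by (simp add: prod.reindex inj_on_def diag_entry_def sgn_minus)
  also have "\<dots> = (- 1) ^ n * (\<Prod>j=1..n. x j)\<^sup>2"
    by (simp add: prod_uminus power2_eq_square)
  finally show ?thesis
    using assms by (simp add: pfaffian_def re flip: power_mult_distrib)
qed

end

theory Submission
  imports Defs
begin

text \<open>
  All groups here are groups of signed permutations of the coordinates.  The root reflections are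
  transpositions, sign changes of one coordinate and transpositions combined with two sign changes;
  hence \<open>weyl_group_eq\<close>: the Weyl group consists of the permutations in type A, of all signed
  permutations in types B and C, and of those with sign product 1 in type D.  In particular the
  extended Weyl group of type D is the Weyl group of type B (\<open>ext_weyl_group_eq\<close>), which is generated
  by the reflections in the roots of type B.

  A signed permutation that maps \<open>h\<^sub>n\<close> onto itself permutes the coordinates of \<open>h\<^sub>n\<close> among themselves,
  because each of these coordinates is nonzero somewhere on \<open>h\<^sub>n\<close> and all others vanish there.
  So its restriction is a signed permutation of the coordinates of \<open>h\<^sub>n\<close>.  Conversely a signed
  permutation of these extends by the identity; in type D with \<open>n < k\<close> the sign product can be
  corrected at coordinate \<open>k\<close>, which is invisible on \<open>h\<^sub>n\<close>.  So every signed permutation arises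
  (\<open>restrictions_stabilizer\<close>): in type D the stabilizer restricts to the Weyl group of type B.

  Surjectivity of the restriction of invariants rests on power sums.  For \<open>e > 0\<close> the power sum
  \<open>\<Sum>\<^sub>j x\<^sub>j\<^sup>e\<close> on \<open>h\<^sub>k\<close> restricts to the one on \<open>h\<^sub>n\<close>, so the image of the restriction map is an algebra
  that contains all power sums, where in types B and C only even \<open>e\<close> occur.  A polynomial function is a
  combination of monomials, an invariant one is the average of its permuted copies, and the
  symmetrization of a monomial is a polynomial in power sums (\<open>distinct_sum_Cons\<close>,
  \<open>symmetrization_in_subalgebra\<close>).  In types B and C the monomials can be taken with even exponents.
  This also works in type A, where the functions live on the sum-zero hyperplane: the monomials need
  not be independent there.

  Type D then follows from type B by squeezing: invariants of type B are invariants of type D, and an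
  invariant of type D on \<open>h\<^sub>k\<close> restricts to an invariant of the restricted stabilizer, that is, of type B
  on \<open>h\<^sub>n\<close>.  The Pfaffian changes sign under one sign change, so it is not in the image.
\<close>

section \<open>Signed permutations acting on the Cartan subalgebras\<close>

text \<open>The coordinates are indexed by \<open>{1..m}\<close>; rewriting \<open>1\<close> to \<open>Suc 0\<close> would hide this form.\<close>

declare One_nat_def [simp del]

abbreviation perm_inv :: "(nat \<Rightarrow> nat) \<Rightarrow> nat \<Rightarrow> nat" where
  "perm_inv \<equiv> inv_into UNIV"

definition signed_action :: "lie_type \<Rightarrow> nat \<Rightarrow> (nat \<Rightarrow> nat) \<Rightarrow> (nat \<Rightarrow> int) \<Rightarrow> (vec \<Rightarrow> vec)" where
  "signed_action t k \<pi> \<epsilon> = (\<lambda>x\<in>cartan t k. \<lambda>j. of_int (\<epsilon> j) * x (\<pi> j))"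

text \<open>In type A sign changes do not preserve the sum-zero hyperplane, so only trivial signs are
  admitted there.\<close>

definition signed_perms :: "lie_type \<Rightarrow> nat \<Rightarrow> ((nat \<Rightarrow> nat) \<times> (nat \<Rightarrow> int)) set" where
  "signed_perms t k = {(\<pi>, \<epsilon>). \<pi> permutes {1..num_coords t k} \<and> \<epsilon> \<in> sign_vectors (num_coords t k) \<and>
     (t = Type_A \<longrightarrow> \<epsilon> = (\<lambda>_. 1))}"

text \<open>The pairs that describe the elements of the Weyl group; the proof that they do is
  \<open>weyl_group_eq\<close> below.\<close>

definition weyl_pairs :: "lie_type \<Rightarrow> nat \<Rightarrow> ((nat \<Rightarrow> nat) \<times> (nat \<Rightarrow> int)) set" where
  "weyl_pairs t k = {(\<pi>, \<epsilon>) \<in> signed_perms t k. t = Type_D \<longrightarrow> (\<Prod>j=1..k. \<epsilon> j) = 1}"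

definition signed_actions :: "lie_type \<Rightarrow> nat \<Rightarrow> ((nat \<Rightarrow> nat) \<times> (nat \<Rightarrow> int)) set \<Rightarrow> (vec \<Rightarrow> vec) set" where
  "signed_actions t k P = (\<lambda>(\<pi>, \<epsilon>). signed_action t k \<pi> \<epsilon>) ` P"

lemma signed_actionsI: "(\<pi>, \<epsilon>) \<in> P \<Longrightarrow> signed_action t k \<pi> \<epsilon> \<in> signed_actions t k P"
  by (auto simp: signed_actions_def)

definition flip :: "nat set \<Rightarrow> nat \<Rightarrow> int" where
  "flip N = (\<lambda>j. if j \<in> N then -1 else 1)"

lemma signed_permutation_eq: "signed_permutation n \<pi> \<epsilon> = signed_action Type_D n \<pi> \<epsilon>"
  by (simp add: signed_permutation_def signed_action_def)

lemma sign_vectors_square: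
  assumes "\<epsilon> \<in> sign_vectors m" shows "\<epsilon> j * \<epsilon> j = 1"
proof -
  have "\<epsilon> j = 1 \<or> \<epsilon> j = -1"
    using assms by (cases "j \<in> {1..m}") (simp_all add: sign_vectors_def)
  then show ?thesis by auto
qed

lemma sign_vectors_one: "(\<lambda>_. 1) \<in> sign_vectors m"
  by (simp add: sign_vectors_def)

lemma sign_vectors_permute:
  assumes "\<epsilon> \<in> sign_vectors m" "\<pi> permutes {1..m}" shows "(\<lambda>j. \<epsilon> (\<pi> j)) \<in> sign_vectors m"
  using assms permutes_in_image[OF assms(2)] unfolding sign_vectors_def mem_Collect_eq by metis

lemma sign_vectors_mult:
  assumes "\<epsilon> \<in> sign_vectors m" "\<delta> \<in> sign_vectors m" shows "(\<lambda>j. \<epsilon> j * \<delta> j) \<in> sign_vectors m"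
  using assms unfolding sign_vectors_def by fastforce

lemma flip_in_sign_vectors: "N \<subseteq> {1..m} \<Longrightarrow> flip N \<in> sign_vectors m"
  by (auto simp: flip_def sign_vectors_def)

text \<open>Sign vectors correspond to the sets of coordinates whose sign they change; the generation
  argument for the Weyl groups is an induction on this set.\<close>

lemma sign_vectors_flip:
  assumes "\<epsilon> \<in> sign_vectors m" shows "\<epsilon> = flip {j \<in> {1..m}. \<epsilon> j = -1}"
proof
  fix j show "\<epsilon> j = flip {j \<in> {1..m}. \<epsilon> j = -1} j"
    using assms by (cases "j \<in> {1..m}") (auto simp: sign_vectors_def flip_def)
qed

lemma prod_flip:
  assumes "N \<subseteq> {1..m}" shows "(\<Prod>j=1..m. flip N j) = (-1) ^ card N"
proof -
  have "(\<Prod>j=1..m. flip N j) = (\<Prod>j\<in>N. -1)"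
    using assms by (subst prod.mono_neutral_right[of "{1..m}" N]) (auto simp: flip_def)
  then show ?thesis by simp
qed

lemma prod_sign_permute:
  fixes \<epsilon> :: "nat \<Rightarrow> int"
  assumes "\<pi> permutes {1..m}" shows "(\<Prod>j=1..m. \<epsilon> (\<pi> j)) = (\<Prod>j=1..m. \<epsilon> j)"
  using prod.permute[OF assms, of \<epsilon>] by (simp add: o_def)

lemma num_coords_D [simp]: "num_coords Type_D k = k"
  and num_coords_B [simp]: "num_coords Type_B k = k"
  and num_coords_C [simp]: "num_coords Type_C k = k"
  and num_coords_A [simp]: "num_coords Type_A k = Suc k"
  by (simp_all add: num_coords_def)

lemma signed_action_closed:
  assumes "(\<pi>, \<epsilon>) \<in> signed_perms t k" "x \<in> cartan t k"
  shows "(\<lambda>j. of_int (\<epsilon> j) * x (\<pi> j)) \<in> cartan t k"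
proof -
  have p: "\<pi> permutes {1..num_coords t k}" using assms by (simp add: signed_perms_def)
  have "(\<Sum>j=1..num_coords t k. x (\<pi> j)) = (\<Sum>j=1..num_coords t k. x j)"
    using sum.permute[OF p, of x] by (simp add: o_def)
  moreover have "x (\<pi> j) = 0" if "j \<notin> {1..num_coords t k}" for j
    using that p assms(2) permutes_not_in[OF p that] by (simp add: cartan_def)
  ultimately show ?thesis using assms unfolding cartan_def signed_perms_def by auto
qed

lemma signed_perms_comp:
  assumes "(\<pi>, \<epsilon>) \<in> signed_perms t k" "(\<rho>, \<delta>) \<in> signed_perms t k"
  shows "(\<rho> \<circ> \<pi>, \<lambda>j. \<epsilon> j * \<delta> (\<pi> j)) \<in> signed_perms t k"
  using assms unfolding signed_perms_def
  by (auto intro: permutes_compose sign_vectors_mult sign_vectors_permute)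

lemma signed_perms_inv:
  assumes "(\<pi>, \<epsilon>) \<in> signed_perms t k"
  shows "(perm_inv \<pi>, \<lambda>j. \<epsilon> (perm_inv \<pi> j)) \<in> signed_perms t k"
  using assms unfolding signed_perms_def
  by (auto intro: permutes_inv sign_vectors_permute)

lemma weyl_pairs_subset: "weyl_pairs t k \<subseteq> signed_perms t k"
  by (auto simp: weyl_pairs_def)

lemma weyl_pairs_comp:
  assumes "(\<pi>, \<epsilon>) \<in> weyl_pairs t k" "(\<rho>, \<delta>) \<in> weyl_pairs t k"
  shows "(\<rho> \<circ> \<pi>, \<lambda>j. \<epsilon> j * \<delta> (\<pi> j)) \<in> weyl_pairs t k"
proof -
  have "t = Type_D \<Longrightarrow> \<pi> permutes {1..k}" using assms by (simp add: weyl_pairs_def signed_perms_def)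
  then show ?thesis
    using assms signed_perms_comp[of \<pi> \<epsilon> t k \<rho> \<delta>] prod_sign_permute[of \<pi> k \<delta>]
    unfolding weyl_pairs_def by (auto simp: prod.distrib)
qed

lemma weyl_pairs_inv:
  assumes "(\<pi>, \<epsilon>) \<in> weyl_pairs t k"
  shows "(perm_inv \<pi>, \<lambda>j. \<epsilon> (perm_inv \<pi> j)) \<in> weyl_pairs t k"
proof -
  have "t = Type_D \<Longrightarrow> perm_inv \<pi> permutes {1..k}"
    using assms by (auto simp: weyl_pairs_def signed_perms_def intro: permutes_inv)
  then show ?thesis
    using assms signed_perms_inv[of \<pi> \<epsilon> t k] prod_sign_permute[of "perm_inv \<pi>" k \<epsilon>]
    unfolding weyl_pairs_def by auto
qed

text \<open>Coordinates are pulled back along the permutation, so the permutations compose in reverse order.\<close>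

lemma compose_signed_action:
  assumes "(\<rho>, \<delta>) \<in> signed_perms t k"
  shows "compose (cartan t k) (signed_action t k \<pi> \<epsilon>) (signed_action t k \<rho> \<delta>) =
    signed_action t k (\<rho> \<circ> \<pi>) (\<lambda>j. \<epsilon> j * \<delta> (\<pi> j))"
  using signed_action_closed[OF assms]
  by (auto simp: compose_def signed_action_def restrict_def fun_eq_iff)

lemma signed_action_id: "signed_action t k id (\<lambda>_. 1) = (\<lambda>x\<in>cartan t k. x)"
  by (simp add: signed_action_def)

lemma signed_action_inverse:
  assumes "(\<pi>, \<epsilon>) \<in> signed_perms t k"
  shows "compose (cartan t k) (signed_action t k \<pi> \<epsilon>) (signed_action t k (perm_inv \<pi>) (\<lambda>j. \<epsilon> (perm_inv \<pi> j))) =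
      (\<lambda>x\<in>cartan t k. x)"
    and "compose (cartan t k) (signed_action t k (perm_inv \<pi>) (\<lambda>j. \<epsilon> (perm_inv \<pi> j))) (signed_action t k \<pi> \<epsilon>) =
      (\<lambda>x\<in>cartan t k. x)"
proof -
  have p: "\<pi> permutes {1..num_coords t k}" and e: "\<epsilon> \<in> sign_vectors (num_coords t k)"
    using assms by (auto simp: signed_perms_def)
  have *: "perm_inv \<pi> (\<pi> j) = j" "\<pi> (perm_inv \<pi> j) = j" "\<epsilon> j * \<epsilon> j = 1" for j
    using permutes_inverses[OF p] sign_vectors_square[OF e] by auto
  show "compose (cartan t k) (signed_action t k \<pi> \<epsilon>) (signed_action t k (perm_inv \<pi>) (\<lambda>j. \<epsilon> (perm_inv \<pi> j))) =
      (\<lambda>x\<in>cartan t k. x)"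
    unfolding compose_signed_action[OF signed_perms_inv[OF assms]]
    by (simp add: * o_def flip: signed_action_id) (simp add: id_def)
  show "compose (cartan t k) (signed_action t k (perm_inv \<pi>) (\<lambda>j. \<epsilon> (perm_inv \<pi> j))) (signed_action t k \<pi> \<epsilon>) =
      (\<lambda>x\<in>cartan t k. x)"
    unfolding compose_signed_action[OF assms]
    by (simp add: * o_def flip: signed_action_id) (simp add: id_def)
qed

lemma signed_action_Bij:
  assumes "(\<pi>, \<epsilon>) \<in> signed_perms t k"
  shows "signed_action t k \<pi> \<epsilon> \<in> carrier (BijGroup (cartan t k))"
proof -
  let ?V = "cartan t k" and ?f = "signed_action t k \<pi> \<epsilon>"
    and ?g = "signed_action t k (perm_inv \<pi>) (\<lambda>j. \<epsilon> (perm_inv \<pi> j))"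
  have "?f x \<in> ?V" "?g x \<in> ?V" if "x \<in> ?V" for x
    using signed_action_closed[OF assms that] signed_action_closed[OF signed_perms_inv[OF assms] that] that
    by (simp_all add: signed_action_def)
  moreover have "?f (?g x) = x" "?g (?f x) = x" if "x \<in> ?V" for x
    using fun_cong[OF signed_action_inverse(1)[OF assms], of x]
      fun_cong[OF signed_action_inverse(2)[OF assms], of x] that by (simp_all add: compose_eq)
  ultimately have "bij_betw ?f ?V ?V" by (intro bij_betw_byWitness[where f' = ?g]) auto
  then show ?thesis by (simp add: BijGroup_def Bij_def signed_action_def)
qed

lemma signed_action_mult:
  assumes "(\<pi>, \<epsilon>) \<in> signed_perms t k" "(\<rho>, \<delta>) \<in> signed_perms t k"
  shows "signed_action t k \<pi> \<epsilon> \<otimes>\<^bsub>BijGroup (cartan t k)\<^esub> signed_action t k \<rho> \<delta> =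
    signed_action t k (\<rho> \<circ> \<pi>) (\<lambda>j. \<epsilon> j * \<delta> (\<pi> j))"
  using signed_action_Bij[OF assms(1)] signed_action_Bij[OF assms(2)]
  by (simp add: BijGroup_def compose_signed_action[OF assms(2)])

lemma one_BijGroup_cartan: "\<one>\<^bsub>BijGroup (cartan t k)\<^esub> = signed_action t k id (\<lambda>_. 1)"
  unfolding signed_action_id by (simp add: BijGroup_def)

lemma signed_action_inv:
  assumes "(\<pi>, \<epsilon>) \<in> signed_perms t k"
  shows "inv\<^bsub>BijGroup (cartan t k)\<^esub> signed_action t k \<pi> \<epsilon> =
    signed_action t k (perm_inv \<pi>) (\<lambda>j. \<epsilon> (perm_inv \<pi> j))"
proof (rule group.inv_equality[OF group_BijGroup])
  note I = signed_action_Bij[OF assms] signed_action_Bij[OF signed_perms_inv[OF assms]]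
  then show "signed_action t k \<pi> \<epsilon> \<in> carrier (BijGroup (cartan t k))"
    "signed_action t k (perm_inv \<pi>) (\<lambda>j. \<epsilon> (perm_inv \<pi> j)) \<in> carrier (BijGroup (cartan t k))" .
  show "signed_action t k (perm_inv \<pi>) (\<lambda>j. \<epsilon> (perm_inv \<pi> j)) \<otimes>\<^bsub>BijGroup (cartan t k)\<^esub> signed_action t k \<pi> \<epsilon> =
      \<one>\<^bsub>BijGroup (cartan t k)\<^esub>"
    using I signed_action_inverse(2)[OF assms] by (simp add: BijGroup_def)
qed

lemma subgroup_signed_actions:
  assumes P: "P \<subseteq> signed_perms t k" and one: "(id, \<lambda>_. 1) \<in> P"
    and comp: "\<And>\<pi> \<epsilon> \<rho> \<delta>. (\<pi>, \<epsilon>) \<in> P \<Longrightarrow> (\<rho>, \<delta>) \<in> P \<Longrightarrow> (\<rho> \<circ> \<pi>, \<lambda>j. \<epsilon> j * \<delta> (\<pi> j)) \<in> P"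
    and inv: "\<And>\<pi> \<epsilon>. (\<pi>, \<epsilon>) \<in> P \<Longrightarrow> (perm_inv \<pi>, \<lambda>j. \<epsilon> (perm_inv \<pi> j)) \<in> P"
  shows "subgroup (signed_actions t k P) (BijGroup (cartan t k))"
proof (rule group.subgroupI[OF group_BijGroup])
  show "signed_actions t k P \<subseteq> carrier (BijGroup (cartan t k))"
    using P signed_action_Bij by (auto simp: signed_actions_def)
  show "signed_actions t k P \<noteq> {}" using one by (auto simp: signed_actions_def)
next
  fix a assume "a \<in> signed_actions t k P"
  then obtain \<pi> \<epsilon> where a: "a = signed_action t k \<pi> \<epsilon>" "(\<pi>, \<epsilon>) \<in> P" by (auto simp: signed_actions_def)
  then have "(\<pi>, \<epsilon>) \<in> signed_perms t k" using P by auto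
  then show "inv\<^bsub>BijGroup (cartan t k)\<^esub> a \<in> signed_actions t k P"
    using inv[OF a(2)] by (auto simp: a(1) signed_action_inv signed_actions_def)
next
  fix a b assume "a \<in> signed_actions t k P" "b \<in> signed_actions t k P"
  then obtain \<pi> \<epsilon> \<rho> \<delta> where a: "a = signed_action t k \<pi> \<epsilon>" "(\<pi>, \<epsilon>) \<in> P"
    and b: "b = signed_action t k \<rho> \<delta>" "(\<rho>, \<delta>) \<in> P" by (auto simp: signed_actions_def)
  then have "(\<pi>, \<epsilon>) \<in> signed_perms t k" "(\<rho>, \<delta>) \<in> signed_perms t k" using P by auto
  then show "a \<otimes>\<^bsub>BijGroup (cartan t k)\<^esub> b \<in> signed_actions t k P"
    using comp[OF a(2) b(2)] by (auto simp: a(1) b(1) signed_action_mult signed_actions_def)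
qed

lemma id_in_signed_perms: "(id, \<lambda>_. 1) \<in> signed_perms t k"
  by (simp add: signed_perms_def sign_vectors_one permutes_id)

lemma id_in_weyl_pairs: "(id, \<lambda>_. 1) \<in> weyl_pairs t k"
  by (simp add: weyl_pairs_def id_in_signed_perms)

lemma subgroup_weyl_pairs: "subgroup (signed_actions t k (weyl_pairs t k)) (BijGroup (cartan t k))"
  by (intro subgroup_signed_actions weyl_pairs_subset id_in_weyl_pairs weyl_pairs_comp weyl_pairs_inv)

lemma weyl_pairs_permutation:
  "\<pi> permutes {1..num_coords t k} \<Longrightarrow> (\<pi>, \<lambda>_. 1) \<in> weyl_pairs t k"
  by (simp add: weyl_pairs_def signed_perms_def sign_vectors_one)

lemma weyl_pairs_flip:
  assumes "t \<noteq> Type_A" "N \<subseteq> {1..k}" "t = Type_D \<longrightarrow> even (card N)" "\<pi> permutes {1..k}"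
  shows "(\<pi>, flip N) \<in> weyl_pairs t k"
proof -
  have "num_coords t k = k" using assms(1) by (simp add: num_coords_def)
  then show ?thesis using assms
    by (auto simp: weyl_pairs_def signed_perms_def flip_in_sign_vectors prod_flip)
qed

section \<open>The Weyl groups as groups of signed permutations\<close>

lemma reflection_coord:
  assumes i: "i \<in> {1..num_coords t k}" and c: "c \<noteq> 0"
  shows "reflection (cartan t k) (\<lambda>l. c * coord i l) = signed_action t k id (flip {i})"
proof -
  have p: "pairing (\<lambda>l. c * coord i l) x = c * x i" for x
  proof -
    have "{l. c * coord i l \<noteq> 0} = {i}" using c by (auto simp: coord_def)
    then show ?thesis by (simp add: pairing_def coord_def)
  qed
  show ?thesis
    using c unfolding reflection_def signed_action_def p
    by (intro restrict_ext ext) (auto simp: coord_def flip_def)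
qed

text \<open>With \<open>a = s e\<^sub>i + s' e\<^sub>j\<close> one has \<open>(a, a) = 2\<close>, and the reflected vector has \<open>i\<close>-th coordinate
  \<open>x\<^sub>i - (s x\<^sub>i + s' x\<^sub>j) s = - s s' x\<^sub>j\<close>: a transposition, with two sign changes exactly if \<open>s = s'\<close>.\<close>

lemma reflection_coord_pair:
  assumes ij: "i \<noteq> j" and s: "s \<in> {1, -1}" "s' \<in> {1, -1}"
  shows "reflection (cartan t k) (\<lambda>l. s * coord i l + s' * coord j l) =
    signed_action t k (transpose i j) (flip (if s = s' then {i, j} else {}))"
proof -
  have p: "pairing (\<lambda>l. s * coord i l + s' * coord j l) x = s * x i + s' * x j" for x
  proof -
    have "{l. s * coord i l + s' * coord j l \<noteq> 0} = {i, j}" using s ij by (auto simp: coord_def)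
    then show ?thesis using ij by (simp add: pairing_def coord_def)
  qed
  have "(\<lambda>l. x l - 2 * pairing (\<lambda>l. s * coord i l + s' * coord j l) x /
        pairing (\<lambda>l. s * coord i l + s' * coord j l) (\<lambda>l. s * coord i l + s' * coord j l) *
        (s * coord i l + s' * coord j l)) =
      (\<lambda>l. of_int (flip (if s = s' then {i, j} else {}) l) * x (transpose i j l))" for x
  proof
    fix l
    consider "l = i" | "l = j" | "l \<noteq> i" "l \<noteq> j" by blast
    then show "x l - 2 * pairing (\<lambda>l. s * coord i l + s' * coord j l) x /
        pairing (\<lambda>l. s * coord i l + s' * coord j l) (\<lambda>l. s * coord i l + s' * coord j l) *
        (s * coord i l + s' * coord j l) =
      of_int (flip (if s = s' then {i, j} else {}) l) * x (transpose i j l)"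
      using s ij unfolding p by cases (auto simp: coord_def flip_def field_simps)
  qed
  then show ?thesis unfolding reflection_def signed_action_def by (intro restrict_ext)
qed

lemma roots_short:
  assumes "i \<in> {1..k}"
  shows "(\<lambda>l. coord i l) \<in> roots Type_B k" "(\<lambda>l. 2 * coord i l) \<in> roots Type_C k"
proof -
  have "(\<lambda>l. coord i l) = (\<lambda>l. 1 * coord i l)" "(\<lambda>l. 2 * coord i l) = (\<lambda>l. 1 * (2 * coord i l))"
    by simp_all
  then show "(\<lambda>l. coord i l) \<in> roots Type_B k" "(\<lambda>l. 2 * coord i l) \<in> roots Type_C k"
    unfolding roots_B roots_C using assms by blast+
qed

lemma reflections_in_weyl_pairs:
  "reflection (cartan t k) ` roots t k \<subseteq> signed_actions t k (weyl_pairs t k)"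
proof
  fix w assume "w \<in> reflection (cartan t k) ` roots t k"
  then obtain a where a: "a \<in> roots t k" and w: "w = reflection (cartan t k) a" by blast
  have pair: "w \<in> signed_actions t k (weyl_pairs t k)"
    if aa: "a = (\<lambda>l. s * coord i l + s' * coord j l)" and s: "s \<in> {1, -1}" "s' \<in> {1, -1}"
      and ij: "i \<in> {1..num_coords t k}" "j \<in> {1..num_coords t k}" "i \<noteq> j"
      and A: "t = Type_A \<Longrightarrow> s \<noteq> s'" for s s' i j
  proof -
    have tr: "transpose i j permutes {1..num_coords t k}" by (rule permutes_swap_id[OF ij(1,2)])
    have "(transpose i j, flip (if s = s' then {i, j} else {})) \<in> weyl_pairs t k"
    proof (cases "s = s'")
      case True
      with A have t: "t \<noteq> Type_A" by blast
      then show ?thesis using True ij tr by (auto simp: num_coords_def intro!: weyl_pairs_flip)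
    next
      case False
      then show ?thesis using weyl_pairs_permutation[OF tr] by (simp add: flip_def)
    qed
    then show ?thesis
      unfolding w aa reflection_coord_pair[OF ij(3) s] by (rule signed_actionsI)
  qed
  have pm: "w \<in> signed_actions t k (weyl_pairs t k)" if a: "a \<in> pm_roots k" and t: "t \<noteq> Type_A"
  proof -
    from a obtain s s' i j where *: "a = (\<lambda>l. s * coord i l + s' * coord j l)"
      "s \<in> {1, -1}" "s' \<in> {1, -1}" "i \<in> {1..k}" "j \<in> {1..k}" "i \<noteq> j" by blast
    have "num_coords t k = k" using t by (simp add: num_coords_def)
    then show ?thesis using t *(4-6) by (intro pair[OF *(1-3)]) simp_all
  qed
  have single: "w \<in> signed_actions t k (weyl_pairs t k)"
    if "a = (\<lambda>l. c * coord i l)" "c \<noteq> 0" "i \<in> {1..k}" "t = Type_B \<or> t = Type_C" for c i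
  proof -
    have "(id, flip {i}) \<in> weyl_pairs t k"
      using that by (auto intro!: weyl_pairs_flip permutes_id)
    moreover have "i \<in> {1..num_coords t k}" using that by auto
    ultimately show ?thesis
      unfolding w that(1) by (simp only: reflection_coord[OF _ that(2)] signed_actionsI)
  qed
  show "w \<in> signed_actions t k (weyl_pairs t k)"
  proof (cases t)
    case Type_A
    then obtain i j where "a = (\<lambda>l. 1 * coord i l + (-1) * coord j l)" "i \<in> {1..k+1}" "j \<in> {1..k+1}" "i \<noteq> j"
      using a unfolding Type_A roots_A by auto
    then show ?thesis using Type_A by (intro pair[of 1 i "-1" j]) simp_all
  next
    case Type_B
    with a consider "a \<in> pm_roots k" | s i where "a = (\<lambda>l. s * coord i l)" "s \<in> {1, -1}" "i \<in> {1..k}"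
      unfolding Type_B roots_B by blast
    then show ?thesis
    proof cases
      case 1 then show ?thesis using Type_B by (intro pm) simp_all
    next
      case 2 then show ?thesis using Type_B by (intro single[of s i]) auto
    qed
  next
    case Type_C
    with a consider "a \<in> pm_roots k" | s i where "a = (\<lambda>l. s * (2 * coord i l))" "s \<in> {1, -1}" "i \<in> {1..k}"
      unfolding Type_C roots_C by blast
    then show ?thesis
    proof cases
      case 1 then show ?thesis using Type_C by (intro pm) simp_all
    next
      case 2
      then have "a = (\<lambda>l. (s * 2) * coord i l)" by (simp add: mult.assoc)
      then show ?thesis using 2 Type_C by (intro single[of "s * 2" i]) auto
    qed
  next
    case Type_D
    with a have "a \<in> pm_roots k" by (simp only: roots_D)
    then show ?thesis using Type_D by (intro pm) simp_all
  qed
qed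

lemma weyl_group_mult:
  assumes "(\<pi>, \<epsilon>) \<in> weyl_pairs t k" "(\<rho>, \<delta>) \<in> weyl_pairs t k"
    "signed_action t k \<pi> \<epsilon> \<in> weyl_group t k" "signed_action t k \<rho> \<delta> \<in> weyl_group t k"
  shows "signed_action t k (\<rho> \<circ> \<pi>) (\<lambda>j. \<epsilon> j * \<delta> (\<pi> j)) \<in> weyl_group t k"
proof -
  have "(\<pi>, \<epsilon>) \<in> signed_perms t k" "(\<rho>, \<delta>) \<in> signed_perms t k" using assms weyl_pairs_subset by auto
  from signed_action_mult[OF this] show ?thesis
    using assms(3,4) generate.eng unfolding weyl_group_def by metis
qed

lemma root_reflection_in_weyl_group:
  "a \<in> roots t k \<Longrightarrow> reflection (cartan t k) a \<in> weyl_group t k"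
  unfolding weyl_group_def by (rule generate.incl) blast

lemma permutations_in_weyl_group:
  assumes "\<pi> permutes {1..num_coords t k}"
  shows "signed_action t k \<pi> (\<lambda>_. 1) \<in> weyl_group t k"
  using assms finite_atLeastAtMost
proof (induction rule: permutes_induct)
  case id
  show ?case unfolding weyl_group_def one_BijGroup_cartan[symmetric] by (rule generate.one)
next
  case (swap a b p)
  have r: "(\<lambda>l. 1 * coord a l + (-1) * coord b l) \<in> roots t k"
  proof (cases "t = Type_A")
    case True
    then have "(\<lambda>l. coord a l - coord b l) \<in> roots t k"
      using swap(1-3) unfolding roots_A True num_coords_A Suc_eq_plus1 mem_Collect_eq
      by (intro exI[of _ a] exI[of _ b] conjI refl)
    then show ?thesis by simp
  next
    case False
    then have m: "num_coords t k = k" by (simp add: num_coords_def)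
    have "(\<lambda>l. 1 * coord a l + (-1) * coord b l) \<in> pm_roots k"
      using swap(1-3) unfolding m by blast
    then show ?thesis using pm_roots_subset[OF False] by blast
  qed
  have "signed_action t k (transpose a b) (\<lambda>_. 1) \<in> weyl_group t k"
    using root_reflection_in_weyl_group[OF r] reflection_coord_pair[OF swap(3), of 1 "-1" t k]
    by (simp add: flip_def)
  from weyl_group_mult[OF weyl_pairs_permutation[OF swap(4)]
      weyl_pairs_permutation[OF permutes_swap_id[OF swap(1,2)]] swap(5) this]
  show ?case by (simp add: o_def)
qed

text \<open>The reflections in \<open>e\<^sub>i + e\<^sub>j\<close> and in \<open>e\<^sub>i - e\<^sub>j\<close> involve the same transposition, which cancels in
  their product; only the two sign changes remain.\<close>

lemma flip_pair_in_weyl_group: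
  assumes t: "t \<noteq> Type_A" and ij: "i \<in> {1..k}" "j \<in> {1..k}" "i \<noteq> j"
  shows "signed_action t k id (flip {i, j}) \<in> weyl_group t k"
proof -
  have tr: "transpose i j permutes {1..k}" by (rule permutes_swap_id[OF ij(1,2)])
  have m: "num_coords t k = k" using t by (simp add: num_coords_def)
  have r: "(\<lambda>l. 1 * coord i l + 1 * coord j l) \<in> roots t k"
  proof -
    have "(\<lambda>l. 1 * coord i l + 1 * coord j l) \<in> pm_roots k" using ij by blast
    then show ?thesis using pm_roots_subset[OF t] by blast
  qed
  have "signed_action t k (transpose i j) (flip {i, j}) \<in> weyl_group t k"
    using root_reflection_in_weyl_group[OF r] reflection_coord_pair[OF ij(3), of 1 1 t k] by simp
  moreover have "(transpose i j, flip {i, j}) \<in> weyl_pairs t k"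
    using t ij tr by (intro weyl_pairs_flip) auto
  moreover have "(transpose i j, \<lambda>_. 1) \<in> weyl_pairs t k"
    "signed_action t k (transpose i j) (\<lambda>_. 1) \<in> weyl_group t k"
    using tr m by (simp_all add: weyl_pairs_permutation permutations_in_weyl_group)
  ultimately have "signed_action t k (transpose i j \<circ> transpose i j) (\<lambda>l. flip {i, j} l * 1) \<in> weyl_group t k"
    by (intro weyl_group_mult)
  then show ?thesis by (simp add: transpose_comp_involutory)
qed

text \<open>Induction on the number of sign changes: one sign is split off in types B and C (a short or
  long root), two signs in type D.\<close>

lemma flip_in_weyl_group:
  assumes t: "t \<noteq> Type_A" and N: "N \<subseteq> {1..k}" and D: "t = Type_D \<longrightarrow> even (card N)"
  shows "signed_action t k id (flip N) \<in> weyl_group t k"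
  using N D
proof (induction "card N" arbitrary: N rule: less_induct)
  case less
  note N = less.prems
  have fin: "finite N" using N finite_subset by blast
  have step: ?case
    if M: "M \<subseteq> N" "M \<noteq> {}" "t = Type_D \<longrightarrow> even (card M)"
      "signed_action t k id (flip M) \<in> weyl_group t k" for M
  proof -
    have "card (N - M) = card N - card M" "card M \<le> card N" "card M > 0"
      using M fin card_mono by (auto simp: card_Diff_subset finite_subset card_gt_0_iff)
    then have IH: "signed_action t k id (flip (N - M)) \<in> weyl_group t k"
      and D': "t = Type_D \<longrightarrow> even (card (N - M))"
      using N M(3) by (auto intro!: less.hyps)
    have "signed_action t k (id \<circ> id) (\<lambda>j. flip M j * flip (N - M) (id j)) \<in> weyl_group t k"
    proof (rule weyl_group_mult)
      show "(id, flip M) \<in> weyl_pairs t k" "(id, flip (N - M)) \<in> weyl_pairs t k"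
        using M(1) N t by (intro weyl_pairs_flip permutes_id M(3) D'; blast)+
    qed (fact M(4), fact IH)
    moreover have "(\<lambda>j. flip M j * flip (N - M) (id j)) = flip N"
      using M(1) by (auto simp: flip_def fun_eq_iff)
    ultimately show ?thesis by simp
  qed
  consider "N = {}" | i where "i \<in> N" "t \<noteq> Type_D" | "N \<noteq> {}" "t = Type_D" by blast
  then show ?case
  proof cases
    case 1
    then show ?thesis using permutations_in_weyl_group[OF permutes_id, of t k] by (simp add: flip_def)
  next
    case 2
    have i: "i \<in> {1..k}" "i \<in> {1..num_coords t k}" using 2 N t by (auto simp: num_coords_def)
    have "signed_action t k id (flip {i}) \<in> weyl_group t k"
      using root_reflection_in_weyl_group[of "\<lambda>l. coord i l" t k]
        root_reflection_in_weyl_group[of "\<lambda>l. 2 * coord i l" t k]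
        roots_short[OF i(1)] reflection_coord[OF i(2), of 1] reflection_coord[OF i(2), of 2] 2 t
      by (cases t) auto
    then show ?thesis using 2 by (intro step[of "{i}"]) auto
  next
    case 3
    then have "even (card N)" "card N \<noteq> 0" using N fin by auto
    then have "2 \<le> card N" by presburger
    then obtain M where "M \<subseteq> N" "card M = 2" by (meson obtain_subset_with_card_n)
    then obtain i j where ij: "{i, j} \<subseteq> N" "i \<noteq> j" by (auto simp: card_2_iff)
    then show ?thesis using N t
      by (intro step[of "{i, j}"] flip_pair_in_weyl_group) auto
  qed
qed

text \<open>The signed permutations form a group that contains the root reflections, which gives one
  inclusion.  For the other one, a signed permutation is a product of a permutation and a sign change,
  and both were obtained from reflections.\<close>

theorem weyl_group_eq: "weyl_group t k = signed_actions t k (weyl_pairs t k)"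
proof
  show "weyl_group t k \<subseteq> signed_actions t k (weyl_pairs t k)"
    unfolding weyl_group_def
    by (rule group.generate_subgroup_incl[OF group_BijGroup reflections_in_weyl_pairs subgroup_weyl_pairs])
  show "signed_actions t k (weyl_pairs t k) \<subseteq> weyl_group t k"
  proof
    fix w assume "w \<in> signed_actions t k (weyl_pairs t k)"
    then obtain \<pi> \<epsilon> where w: "w = signed_action t k \<pi> \<epsilon>" and P: "(\<pi>, \<epsilon>) \<in> weyl_pairs t k"
      by (auto simp: signed_actions_def)
    have p: "\<pi> permutes {1..num_coords t k}" using P by (simp add: weyl_pairs_def signed_perms_def)
    note pw = permutations_in_weyl_group[OF p]
    show "w \<in> weyl_group t k"
    proof (cases "t = Type_A")
      case True
      then have "\<epsilon> = (\<lambda>_. 1)" using P by (simp add: weyl_pairs_def signed_perms_def)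
      then show ?thesis using pw w by simp
    next
      case False
      then have m: "num_coords t k = k" by (simp add: num_coords_def)
      define N where "N = {j \<in> {1..k}. \<epsilon> j = -1}"
      have N: "N \<subseteq> {1..k}" by (auto simp: N_def)
      have e: "\<epsilon> = flip N"
        using P m sign_vectors_flip[of \<epsilon> k] by (simp add: weyl_pairs_def signed_perms_def N_def)
      have D: "t = Type_D \<longrightarrow> even (card N)"
        using P prod_flip[OF N] by (auto simp: weyl_pairs_def e minus_one_power_iff split: if_splits)
      have "signed_action t k (\<pi> \<circ> id) (\<lambda>j. flip N j * 1) \<in> weyl_group t k"
        using False N D p m pw
        by (intro weyl_group_mult flip_in_weyl_group weyl_pairs_flip weyl_pairs_permutation permutes_id) auto
      then show ?thesis by (simp add: w e)
    qed
  qed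
qed

section \<open>Stabilizers of the smaller Cartan subalgebra\<close>

lemma cartan_mono:
  assumes "n \<le> k" shows "cartan t n \<subseteq> cartan t k"
proof
  fix x assume x: "x \<in> cartan t n"
  have le: "num_coords t n \<le> num_coords t k" using assms by (simp add: num_coords_def)
  have "(\<Sum>j=1..num_coords t k. x j) = (\<Sum>j=1..num_coords t n. x j)"
    using x le by (intro sum.mono_neutral_right) (auto simp: cartan_def)
  then show "x \<in> cartan t k" using x le by (auto simp: cartan_def)
qed

lemma cartan_nonzero:
  assumes "1 \<le> n" "i \<in> {1..num_coords t n}"
  obtains x where "x \<in> cartan t n" "x i \<noteq> 0"
proof (cases "t = Type_A")
  case True
  define i' where "i' = (if i = 1 then 2 else 1 :: nat)"
  have i': "i' \<in> {1..num_coords t n}" "i' \<noteq> i" using assms True by (auto simp: i'_def)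
  have "(\<Sum>j=1..num_coords t n. coord i j - coord i' j) = 0"
    using sum_coord[of i "\<lambda>_. 1" "num_coords t n"] sum_coord[of i' "\<lambda>_. 1" "num_coords t n"] i' assms(2)
    by (simp add: sum_subtractf)
  then have "(\<lambda>j. coord i j - coord i' j) \<in> cartan t n"
    using assms(2) i' by (auto simp: cartan_def coord_def)
  then show ?thesis by (rule that) (use i' in \<open>simp add: coord_def\<close>)
next
  case False
  then have "coord i \<in> cartan t n" using assms(2) by (auto simp: cartan_def coord_def)
  then show ?thesis by (rule that) (simp add: coord_def)
qed

lemma sign_nonzero: "\<epsilon> \<in> sign_vectors m \<Longrightarrow> \<epsilon> j \<noteq> 0"
  using sign_vectors_square[of \<epsilon> m j] by auto

text \<open>A coordinate of \<open>h\<^sub>n\<close> cannot be moved to a position outside, since it is nonzero at some vector of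
  \<open>h\<^sub>n\<close>.  Hence the inverse permutation maps the finite set of positions of \<open>h\<^sub>n\<close> into itself, so both
  permutations preserve this set.  In type A, \<open>n \<ge> 1\<close> guarantees that \<open>h\<^sub>n\<close> is not zero.\<close>

lemma stabilizer_permutes:
  assumes n: "1 \<le> n" "n \<le> k" and P: "(\<pi>, \<epsilon>) \<in> signed_perms t k"
    and st: "signed_action t k \<pi> \<epsilon> ` cartan t n = cartan t n"
  shows "\<pi> j \<in> {1..num_coords t n} \<longleftrightarrow> j \<in> {1..num_coords t n}"
proof -
  let ?I = "{1..num_coords t n}"
  have p: "\<pi> permutes {1..num_coords t k}" and e: "\<epsilon> \<in> sign_vectors (num_coords t k)"
    using P by (auto simp: signed_perms_def)
  have *: "j \<in> ?I" if i: "\<pi> j \<in> ?I" for j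
  proof (rule ccontr)
    assume j: "j \<notin> ?I"
    obtain x where x: "x \<in> cartan t n" "x (\<pi> j) \<noteq> 0" by (rule cartan_nonzero[OF n(1) i])
    then have "signed_action t k \<pi> \<epsilon> x \<in> cartan t n" using st by blast
    then have "signed_action t k \<pi> \<epsilon> x j = 0" using j unfolding cartan_def by blast
    moreover have "signed_action t k \<pi> \<epsilon> x j = of_int (\<epsilon> j) * x (\<pi> j)"
      using x(1) cartan_mono[OF n(2)] by (auto simp: signed_action_def)
    ultimately show False using x(2) sign_nonzero[OF e] by simp
  qed
  have "perm_inv \<pi> ` ?I \<subseteq> ?I"
    using * permutes_inverses(1)[OF p] by (metis image_subsetI)
  moreover have "inj_on (perm_inv \<pi>) ?I"
    by (rule inj_on_subset[OF permutes_inj[OF permutes_inv[OF p]]]) simp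
  ultimately have "perm_inv \<pi> ` ?I = ?I" by (intro endo_inj_surj) simp_all
  then have "\<pi> j \<in> ?I" if "j \<in> ?I" using that permutes_inverses(1)[OF p] by (metis imageE)
  with * show ?thesis by blast
qed

text \<open>On \<open>h\<^sub>n\<close> the outer coordinates vanish, so the permutation and the signs may be replaced there by
  trivial ones.\<close>

lemma restrict_signed_action:
  assumes n: "n \<le> k" and P: "(\<pi>, \<epsilon>) \<in> signed_perms t k"
    and pres: "\<And>j. \<pi> j \<in> {1..num_coords t n} \<longleftrightarrow> j \<in> {1..num_coords t n}"
  defines "\<pi>' \<equiv> \<lambda>j. if j \<in> {1..num_coords t n} then \<pi> j else j"
    and "\<epsilon>' \<equiv> \<lambda>j. if j \<in> {1..num_coords t n} then \<epsilon> j else 1"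
  shows "(\<pi>', \<epsilon>') \<in> signed_perms t n"
    and "restrict (signed_action t k \<pi> \<epsilon>) (cartan t n) = signed_action t n \<pi>' \<epsilon>'"
proof -
  let ?I = "{1..num_coords t n}"
  have p: "\<pi> permutes {1..num_coords t k}" and e: "\<epsilon> \<in> sign_vectors (num_coords t k)"
    using P by (auto simp: signed_perms_def)
  have "inj_on \<pi>' ?I" using permutes_inj[OF p] by (auto simp: \<pi>'_def inj_on_def inj_def)
  moreover have "\<pi>' ` ?I \<subseteq> ?I" using pres by (auto simp: \<pi>'_def)
  ultimately have "bij_betw \<pi>' ?I ?I" unfolding bij_betw_def using endo_inj_surj by blast
  then have p': "\<pi>' permutes ?I" by (rule bij_imp_permutes) (simp only: \<pi>'_def if_False)
  have "num_coords t n \<le> num_coords t k" using n by (simp add: num_coords_def)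
  then have "\<epsilon>' \<in> sign_vectors (num_coords t n)" using e by (auto simp: sign_vectors_def \<epsilon>'_def)
  with p' P show "(\<pi>', \<epsilon>') \<in> signed_perms t n"
    by (auto simp: signed_perms_def \<epsilon>'_def)
  have "(\<lambda>j. of_int (\<epsilon> j) * x (\<pi> j)) = (\<lambda>j. of_int (\<epsilon>' j) * x (\<pi>' j))" if x: "x \<in> cartan t n" for x
  proof
    fix j
    have "x i = 0" if "i \<notin> ?I" for i using x that unfolding cartan_def by blast
    then have "x (\<pi> j) = 0 \<and> x j = 0" if "j \<notin> ?I" using that pres[of j] by blast
    then show "of_int (\<epsilon> j) * x (\<pi> j) = of_int (\<epsilon>' j) * x (\<pi>' j)"
      by (cases "j \<in> ?I") (simp_all only: \<epsilon>'_def \<pi>'_def if_True if_False mult_zero_right simp_thms)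
  qed
  then show "restrict (signed_action t k \<pi> \<epsilon>) (cartan t n) = signed_action t n \<pi>' \<epsilon>'"
    using cartan_mono[OF n, of t] by (auto simp: signed_action_def restrict_def fun_eq_iff)
qed

lemma signed_action_extends:
  assumes n: "n \<le> k" and P: "(\<pi>, \<epsilon>) \<in> signed_perms t n" and Q: "(\<pi>, \<delta>) \<in> signed_perms t k"
    and eq: "\<And>j. j \<in> {1..num_coords t n} \<Longrightarrow> \<delta> j = \<epsilon> j"
  shows "restrict (signed_action t k \<pi> \<delta>) (cartan t n) = signed_action t n \<pi> \<epsilon>"
    and "signed_action t k \<pi> \<delta> ` cartan t n = cartan t n"
proof -
  let ?I = "{1..num_coords t n}"
  have p: "\<pi> permutes ?I" and e: "\<epsilon> \<in> sign_vectors (num_coords t n)" using P by (auto simp: signed_perms_def)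
  have "(if j \<in> ?I then \<pi> j else j) = \<pi> j" for j using permutes_not_in[OF p, of j] by presburger
  then have "(\<lambda>j. if j \<in> ?I then \<pi> j else j) = \<pi>" by (rule ext)
  moreover have "(\<lambda>j. if j \<in> ?I then \<delta> j else 1) = \<epsilon>"
    using e eq by (fastforce simp: sign_vectors_def)
  ultimately show r: "restrict (signed_action t k \<pi> \<delta>) (cartan t n) = signed_action t n \<pi> \<epsilon>"
    using restrict_signed_action(2)[OF n Q permutes_in_image[OF p]] by simp
  have "signed_action t k \<pi> \<delta> ` cartan t n = signed_action t n \<pi> \<epsilon> ` cartan t n"
    unfolding r[symmetric] by simp
  also have "\<dots> = cartan t n"
    using signed_action_Bij[OF P] by (simp add: BijGroup_def Bij_def bij_betw_def)
  finally show "signed_action t k \<pi> \<delta> ` cartan t n = cartan t n" .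
qed

text \<open>The sign of coordinate \<open>k\<close> is free when \<open>n < k\<close>; in type D it is used to make the number of sign
  changes even.\<close>

lemma signed_perms_extend:
  assumes n: "n \<le> k" and P: "(\<pi>, \<epsilon>) \<in> signed_perms t n" and D: "t = Type_D \<Longrightarrow> n < k"
  obtains \<delta> where "(\<pi>, \<delta>) \<in> weyl_pairs t k" "\<And>j. j \<in> {1..num_coords t n} \<Longrightarrow> \<delta> j = \<epsilon> j"
proof (cases "t = Type_A")
  case True
  have "\<pi> permutes {1..num_coords t k}"
    by (rule permutes_subset[of _ "{1..num_coords t n}"]) (use P n True in \<open>auto simp: signed_perms_def\<close>)
  with that weyl_pairs_permutation[OF this] True P show ?thesis by (auto simp: signed_perms_def)
next
  case False
  then have m: "num_coords t n = n" "num_coords t k = k" by (simp_all add: num_coords_def)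
  define N where "N = {j \<in> {1..n}. \<epsilon> j = -1}"
  have N: "N \<subseteq> {1..n}" "finite N" by (auto simp: N_def)
  have e: "\<epsilon> = flip N" using P m sign_vectors_flip[of \<epsilon> n] by (simp add: signed_perms_def N_def)
  define M where "M = (if t = Type_D \<and> odd (card N) then insert k N else N)"
  have pk: "\<pi> permutes {1..k}"
    by (rule permutes_subset[of _ "{1..n}"]) (use P n m in \<open>auto simp: signed_perms_def\<close>)
  have "t = Type_D \<longrightarrow> even (card M)"
  proof -
    have "t = Type_D \<Longrightarrow> k \<notin> N" using N D by auto
    then show ?thesis using N by (simp add: M_def)
  qed
  moreover have "M \<subseteq> {1..k}" using N n D by (auto simp: M_def)
  ultimately have "(\<pi>, flip M) \<in> weyl_pairs t k" using False pk by (intro weyl_pairs_flip)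
  moreover have "flip M j = \<epsilon> j" if "j \<in> {1..n}" for j
    using that D by (auto simp: M_def e flip_def)
  ultimately show ?thesis using m by (intro that[of "flip M"]) auto
qed

theorem restrictions_stabilizer:
  assumes n: "1 \<le> n" "n \<le> k" and D: "t = Type_D \<Longrightarrow> n < k"
  shows "restrictions (stabilizer_of (cartan t n) (weyl_group t k)) (cartan t n) =
    signed_actions t n (signed_perms t n)" (is "?S = ?R")
proof
  show "?S \<subseteq> ?R"
  proof
    fix v assume "v \<in> ?S"
    then obtain \<pi> \<epsilon> where P: "(\<pi>, \<epsilon>) \<in> signed_perms t k"
      and st: "signed_action t k \<pi> \<epsilon> ` cartan t n = cartan t n"
      and v: "v = restrict (signed_action t k \<pi> \<epsilon>) (cartan t n)"
      unfolding restrictions_def stabilizer_of_def weyl_group_eq signed_actions_def weyl_pairs_def by auto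
    show "v \<in> ?R"
      unfolding v restrict_signed_action(2)[OF n(2) P stabilizer_permutes[OF n P st]]
      by (rule signed_actionsI, rule restrict_signed_action(1)[OF n(2) P stabilizer_permutes[OF n P st]])
  qed
  show "?R \<subseteq> ?S"
  proof
    fix v assume "v \<in> ?R"
    then obtain \<pi> \<epsilon> where P: "(\<pi>, \<epsilon>) \<in> signed_perms t n" and v: "v = signed_action t n \<pi> \<epsilon>"
      by (auto simp: signed_actions_def)
    obtain \<delta> where Q: "(\<pi>, \<delta>) \<in> weyl_pairs t k" and eq: "\<And>j. j \<in> {1..num_coords t n} \<Longrightarrow> \<delta> j = \<epsilon> j"
      using signed_perms_extend[OF n(2) P D] by blast
    have Q': "(\<pi>, \<delta>) \<in> signed_perms t k" using Q weyl_pairs_subset by blast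
    have "signed_action t k \<pi> \<delta> \<in> stabilizer_of (cartan t n) (weyl_group t k)"
      using signed_action_extends(2)[OF n(2) P Q' eq] Q
      by (simp add: stabilizer_of_def weyl_group_eq signed_actionsI)
    then show "v \<in> ?S"
      unfolding restrictions_def v
      by (rule rev_image_eqI) (rule signed_action_extends(1)[OF n(2) P Q' eq, symmetric])
  qed
qed

corollary restrictions_stabilizer_weyl_group:
  assumes "1 \<le> n" "n \<le> k" "t \<noteq> Type_D"
  shows "restrictions (stabilizer_of (cartan t n) (weyl_group t k)) (cartan t n) = weyl_group t n"
proof -
  have "signed_perms t n = weyl_pairs t n" using assms(3) by (auto simp: weyl_pairs_def)
  then show ?thesis using restrictions_stabilizer[of n k t] assms by (simp add: weyl_group_eq)
qed

section \<open>The extended Weyl group of type D\<close>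

lemma cartan_B_eq_D: "cartan Type_B k = cartan Type_D k"
  by (simp add: cartan_def)

text \<open>Types B and D have the same Cartan subalgebra, so the Weyl group of type B can be described with
  the actions on the Cartan subalgebra of type D.\<close>

lemma weyl_group_B: "weyl_group Type_B k = signed_actions Type_D k (signed_perms Type_D k)"
proof -
  have "weyl_pairs Type_B k = signed_perms Type_D k" by (auto simp: weyl_pairs_def signed_perms_def)
  moreover have "signed_action Type_B k = signed_action Type_D k"
    by (simp add: signed_action_def cartan_B_eq_D fun_eq_iff)
  ultimately show ?thesis by (simp add: weyl_group_eq signed_actions_def)
qed

lemma weyl_group_D_subset_B: "weyl_group Type_D k \<subseteq> weyl_group Type_B k"
  unfolding weyl_group_B weyl_group_eq[of Type_D] signed_actions_def
  by (intro image_mono weyl_pairs_subset)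

lemma sigma_eq: "sigma k = signed_action Type_D k id (flip {1})"
  unfolding sigma_def signed_action_def by (intro restrict_ext ext) (simp add: flip_def)

lemma sigma_signed_perm: "1 \<le> k \<Longrightarrow> (id, flip {1}) \<in> signed_perms Type_D k"
  by (simp add: signed_perms_def permutes_id flip_in_sign_vectors)

lemma sigma_group_eq: "sigma_group k = signed_actions Type_D k {(id, \<lambda>_. 1), (id, flip {1})}"
  by (auto simp: sigma_group_def signed_actions_def one_BijGroup_cartan sigma_eq)

text \<open>The image of the all-ones vector is the vector of signs.  So the sign vector can be read off
  from the map, which makes its product a well-defined invariant.\<close>

lemma signed_action_sign_unique:
  assumes "signed_action Type_D k \<pi> \<epsilon> = signed_action Type_D k \<rho> \<delta>"
    and "(\<pi>, \<epsilon>) \<in> signed_perms Type_D k" "(\<rho>, \<delta>) \<in> signed_perms Type_D k"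
  shows "\<epsilon> = \<delta>"
proof
  fix j
  have p: "\<pi> permutes {1..k}" "\<rho> permutes {1..k}" and e: "\<epsilon> \<in> sign_vectors k" "\<delta> \<in> sign_vectors k"
    using assms(2,3) by (auto simp: signed_perms_def)
  define u :: vec where "u = (\<lambda>j. if j \<in> {1..k} then 1 else 0)"
  have "u \<in> cartan Type_D k" by (auto simp: cartan_def u_def)
  then have *: "of_int (\<epsilon> j) * u (\<pi> j) = of_int (\<delta> j) * u (\<rho> j)"
    using fun_cong[OF fun_cong[OF assms(1), of u], of j] by (simp add: signed_action_def)
  show "\<epsilon> j = \<delta> j"
  proof (cases "j \<in> {1..k}")
    case True
    then have "u (\<pi> j) = 1" "u (\<rho> j) = 1"
      using permutes_in_image[OF p(1), of j] permutes_in_image[OF p(2), of j] by (simp_all add: u_def)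
    with * show ?thesis by simp
  next
    case False
    then show ?thesis using e by (simp add: sign_vectors_def)
  qed
qed

lemma sigma_notin_weyl_group:
  assumes "1 \<le> k" shows "sigma k \<notin> weyl_group Type_D k"
proof
  assume "sigma k \<in> weyl_group Type_D k"
  then obtain \<pi> \<epsilon> where P: "(\<pi>, \<epsilon>) \<in> weyl_pairs Type_D k"
    and eq: "signed_action Type_D k id (flip {1}) = signed_action Type_D k \<pi> \<epsilon>"
    by (auto simp: weyl_group_eq sigma_eq signed_actions_def)
  have "(\<pi>, \<epsilon>) \<in> signed_perms Type_D k" using P weyl_pairs_subset by blast
  from signed_action_sign_unique[OF eq sigma_signed_perm[OF assms] this]
  have "(\<Prod>j=1..k. flip {1} j) = 1" using P by (simp add: weyl_pairs_def)
  then show False using prod_flip[of "{1}" k] assms by simp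
qed

text \<open>A signed permutation with sign product \<open>-1\<close> is an element of the Weyl group of type D times
  \<open>\<sigma>\<^sub>k\<close>.\<close>

theorem ext_weyl_group_eq:
  assumes k: "1 \<le> k" shows "ext_weyl_group k = weyl_group Type_B k"
proof
  have sub: "subgroup (weyl_group Type_B k) (BijGroup (cartan Type_D k))"
    using subgroup_weyl_pairs[of Type_B k] by (simp add: weyl_group_eq cartan_B_eq_D)
  have sg: "sigma_group k \<subseteq> weyl_group Type_B k"
    unfolding sigma_group_eq weyl_group_B signed_actions_def
    using sigma_signed_perm[OF k] id_in_signed_perms[of Type_D k] by (intro image_mono) auto
  show "ext_weyl_group k \<subseteq> weyl_group Type_B k"
    unfolding ext_weyl_group_def set_mult_def
    using subgroup.m_closed[OF sub] weyl_group_D_subset_B sg by blast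
  show "weyl_group Type_B k \<subseteq> ext_weyl_group k"
  proof
    fix w assume "w \<in> weyl_group Type_B k"
    then obtain \<pi> \<epsilon> where w: "w = signed_action Type_D k \<pi> \<epsilon>" and P: "(\<pi>, \<epsilon>) \<in> signed_perms Type_D k"
      by (auto simp: weyl_group_B signed_actions_def)
    have p: "\<pi> permutes {1..k}" and e: "\<epsilon> \<in> sign_vectors k" using P by (auto simp: signed_perms_def)
    define N where "N = {j \<in> {1..k}. \<epsilon> j = -1}"
    have N: "N \<subseteq> {1..k}" "\<epsilon> = flip N" using sign_vectors_flip[OF e] by (auto simp: N_def)
    show "w \<in> ext_weyl_group k"
    proof (cases "even (card N)")
      case True
      then have "w \<in> weyl_group Type_D k"
        unfolding w weyl_group_eq using N p by (auto intro!: signed_actionsI weyl_pairs_flip)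
      moreover have "w = w \<otimes>\<^bsub>BijGroup (cartan Type_D k)\<^esub> signed_action Type_D k id (\<lambda>_. 1)"
        unfolding w signed_action_mult[OF P id_in_signed_perms] by simp
      ultimately show ?thesis
        unfolding ext_weyl_group_def set_mult_def sigma_group_def one_BijGroup_cartan by blast
    next
      case False
      \<comment> \<open>\<open>\<sigma>\<close> acts before the permutation, so it changes the sign at the position that receives \<open>x\<^sub>1\<close>.\<close>
      define \<delta> where "\<delta> = (\<lambda>j. \<epsilon> j * flip {1} (\<pi> j))"
      have f: "flip {1} \<in> sign_vectors k" using k by (simp add: flip_in_sign_vectors)
      have Q: "(\<pi>, \<delta>) \<in> weyl_pairs Type_D k"
        using p e f False prod_flip[OF N(1)] prod_flip[of "{1}" k] k
        by (auto simp: weyl_pairs_def signed_perms_def \<delta>_def prod.distrib prod_sign_permute N(2)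
            intro: sign_vectors_mult sign_vectors_permute)
      then have "signed_action Type_D k \<pi> \<delta> \<in> weyl_group Type_D k"
        by (simp add: weyl_group_eq signed_actionsI)
      moreover have "\<delta> j * flip {1} (\<pi> j) = \<epsilon> j" for j by (simp add: \<delta>_def flip_def)
      then have "w = signed_action Type_D k \<pi> \<delta> \<otimes>\<^bsub>BijGroup (cartan Type_D k)\<^esub> sigma k"
        unfolding w sigma_eq using Q weyl_pairs_subset
        by (subst signed_action_mult[OF _ sigma_signed_perm[OF k]]) auto
      ultimately show ?thesis
        unfolding ext_weyl_group_def set_mult_def sigma_group_def by blast
    qed
  qed
qed

text \<open>Both semidirect products below need normality of a group of signed permutations in a larger one;
  the hypothesis on conjugates is formulated for the pairs, where it is a computation.\<close>

lemma normal_signed_actions: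
  assumes PU: "PU \<subseteq> signed_perms t k" and PN: "PN \<subseteq> PU"
    and U: "subgroup (signed_actions t k PU) (BijGroup (cartan t k))"
    and N: "subgroup (signed_actions t k PN) (BijGroup (cartan t k))"
    and conj: "\<And>\<pi> \<epsilon> \<rho> \<delta>. (\<pi>, \<epsilon>) \<in> PU \<Longrightarrow> (\<rho>, \<delta>) \<in> PN \<Longrightarrow>
      (perm_inv \<pi> \<circ> (\<rho> \<circ> \<pi>), \<lambda>j. \<epsilon> j * \<delta> (\<pi> j) * \<epsilon> (perm_inv \<pi> (\<rho> (\<pi> j)))) \<in> PN"
  shows "signed_actions t k PN \<lhd> BijGroup (cartan t k)\<lparr>carrier := signed_actions t k PU\<rparr>"
proof (rule group.normal_invI)
  let ?G = "BijGroup (cartan t k)"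
  note G = group_BijGroup[of "cartan t k"]
  show "group (?G\<lparr>carrier := signed_actions t k PU\<rparr>)"
    by (rule subgroup.subgroup_is_group[OF U G])
  show "subgroup (signed_actions t k PN) (?G\<lparr>carrier := signed_actions t k PU\<rparr>)"
    by (rule group.subgroup_incl[OF G N U]) (use PN in \<open>auto simp: signed_actions_def\<close>)
  fix a h assume "a \<in> carrier (?G\<lparr>carrier := signed_actions t k PU\<rparr>)" "h \<in> signed_actions t k PN"
  then obtain \<pi> \<epsilon> \<rho> \<delta> where a: "a = signed_action t k \<pi> \<epsilon>" "(\<pi>, \<epsilon>) \<in> PU"
    and h: "h = signed_action t k \<rho> \<delta>" "(\<rho>, \<delta>) \<in> PN" by (auto simp: signed_actions_def)
  have P: "(\<pi>, \<epsilon>) \<in> signed_perms t k" "(\<rho>, \<delta>) \<in> signed_perms t k" using a h PU PN by auto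
  have aU: "a \<in> signed_actions t k PU" using a by (simp add: signed_actionsI)
  have "a \<otimes>\<^bsub>?G\<^esub> h \<otimes>\<^bsub>?G\<^esub> inv\<^bsub>?G\<^esub> a =
      signed_action t k (perm_inv \<pi> \<circ> (\<rho> \<circ> \<pi>)) (\<lambda>j. \<epsilon> j * \<delta> (\<pi> j) * \<epsilon> (perm_inv \<pi> (\<rho> (\<pi> j))))"
    using P unfolding a(1) h(1)
    by (simp add: signed_action_inv signed_action_mult signed_perms_comp signed_perms_inv)
  also have "\<dots> \<in> signed_actions t k PN" using conj[OF a(2) h(2)] by (rule signed_actionsI)
  finally show "a \<otimes>\<^bsub>?G\<lparr>carrier := signed_actions t k PU\<rparr>\<^esub> h \<otimes>\<^bsub>?G\<lparr>carrier := signed_actions t k PU\<rparr>\<^esub>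
      inv\<^bsub>?G\<lparr>carrier := signed_actions t k PU\<rparr>\<^esub> a \<in> signed_actions t k PN"
    using group.m_inv_consistent[OF G U aU] by simp
qed

lemma subgroup_signed_perms: "subgroup (signed_actions t k (signed_perms t k)) (BijGroup (cartan t k))"
  by (intro subgroup_signed_actions subset_refl id_in_signed_perms signed_perms_comp signed_perms_inv)

text \<open>Conjugation does not change the sign product, since each sign of the conjugating element enters
  twice.\<close>

theorem ext_weyl_group_semidirect:
  assumes k: "1 \<le> k"
  shows "is_semidirect_product (BijGroup (cartan Type_D k)) (ext_weyl_group k) (weyl_group Type_D k) (sigma_group k)"
  unfolding is_semidirect_product_def
proof (intro conjI)
  have ext: "ext_weyl_group k = signed_actions Type_D k (signed_perms Type_D k)"
    using ext_weyl_group_eq[OF k] weyl_group_B by simp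
  show "subgroup (ext_weyl_group k) (BijGroup (cartan Type_D k))"
    unfolding ext by (rule subgroup_signed_perms)
  show "weyl_group Type_D k \<lhd> BijGroup (cartan Type_D k)\<lparr>carrier := ext_weyl_group k\<rparr>"
    unfolding ext weyl_group_eq
  proof (intro normal_signed_actions subset_refl weyl_pairs_subset subgroup_weyl_pairs subgroup_signed_perms)
    fix \<pi> \<epsilon> \<rho> \<delta> assume P: "(\<pi>, \<epsilon>) \<in> signed_perms Type_D k" and Q: "(\<rho>, \<delta>) \<in> weyl_pairs Type_D k"
    have Q': "(\<rho>, \<delta>) \<in> signed_perms Type_D k" using Q weyl_pairs_subset by blast
    have R: "(perm_inv \<pi> \<circ> (\<rho> \<circ> \<pi>), \<lambda>j. \<epsilon> j * \<delta> (\<pi> j) * \<epsilon> (perm_inv \<pi> (\<rho> (\<pi> j)))) \<in> signed_perms Type_D k"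
      using signed_perms_comp[OF signed_perms_comp[OF P Q'] signed_perms_inv[OF P]] by simp
    then have c: "(perm_inv \<pi> \<circ> (\<rho> \<circ> \<pi>)) permutes {1..k}" by (simp add: signed_perms_def)
    have p: "\<pi> permutes {1..k}" using P by (simp add: signed_perms_def)
    have "(\<Prod>j=1..k. \<epsilon> j * \<delta> (\<pi> j) * \<epsilon> (perm_inv \<pi> (\<rho> (\<pi> j)))) =
        (\<Prod>j=1..k. \<epsilon> j) * (\<Prod>j=1..k. \<delta> j) * (\<Prod>j=1..k. \<epsilon> j)"
      using prod_sign_permute[OF p, of \<delta>] prod_sign_permute[OF c, of \<epsilon>] by (simp add: prod.distrib)
    also have "\<dots> = (\<Prod>j=1..k. \<epsilon> j * \<epsilon> j)" using Q by (simp add: prod.distrib weyl_pairs_def)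
    also have "\<dots> = 1" using P sign_vectors_square[of \<epsilon> k] by (simp add: signed_perms_def)
    finally show "(perm_inv \<pi> \<circ> (\<rho> \<circ> \<pi>), \<lambda>j. \<epsilon> j * \<delta> (\<pi> j) * \<epsilon> (perm_inv \<pi> (\<rho> (\<pi> j)))) \<in> weyl_pairs Type_D k"
      using R by (simp add: weyl_pairs_def)
  qed
  have sq: "flip {1} j * flip {1} j = 1" for j by (simp add: flip_def)
  show "subgroup (sigma_group k) (BijGroup (cartan Type_D k))"
    unfolding sigma_group_eq
    by (rule subgroup_signed_actions)
      (use id_in_signed_perms[of Type_D k] sigma_signed_perm[OF k] sq in \<open>auto simp: inv_id\<close>)
  have "\<one>\<^bsub>BijGroup (cartan Type_D k)\<^esub> \<in> weyl_group Type_D k"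
    unfolding weyl_group_def by (rule generate.one)
  then show "weyl_group Type_D k \<inter> sigma_group k = {\<one>\<^bsub>BijGroup (cartan Type_D k)\<^esub>}"
    using sigma_notin_weyl_group[OF k] by (auto simp: sigma_group_def)
qed (simp add: ext_weyl_group_def)

theorem signed_actions_semidirect:
  "is_semidirect_product (BijGroup (cartan Type_D n)) (signed_actions Type_D n (signed_perms Type_D n))
     (sign_changes n) (coordinate_permutations n)"
  unfolding is_semidirect_product_def
proof (intro conjI)
  let ?G = "BijGroup (cartan Type_D n)"
  define PN where "PN = {(\<pi>, \<epsilon>) \<in> signed_perms Type_D n. \<pi> = id}"
  define PQ where "PQ = {(\<pi>, \<epsilon>) \<in> signed_perms Type_D n. \<epsilon> = (\<lambda>_. 1)}"
  have N: "sign_changes n = signed_actions Type_D n PN"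
    by (auto simp: sign_changes_def signed_actions_def signed_permutation_eq PN_def signed_perms_def permutes_id image_iff)
  have Q: "coordinate_permutations n = signed_actions Type_D n PQ"
    by (auto simp: coordinate_permutations_def signed_actions_def signed_permutation_eq PQ_def signed_perms_def
        sign_vectors_one image_iff)
  show U: "subgroup (signed_actions Type_D n (signed_perms Type_D n)) ?G" by (rule subgroup_signed_perms)
  have sN: "subgroup (signed_actions Type_D n PN) ?G"
  proof (rule subgroup_signed_actions)
    show "(\<rho> \<circ> \<pi>, \<lambda>j. \<epsilon> j * \<delta> (\<pi> j)) \<in> PN" if "(\<pi>, \<epsilon>) \<in> PN" "(\<rho>, \<delta>) \<in> PN" for \<pi> \<epsilon> \<rho> \<delta>
      using that signed_perms_comp[of \<pi> \<epsilon> Type_D n \<rho> \<delta>] by (auto simp: PN_def)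
    show "(perm_inv \<pi>, \<lambda>j. \<epsilon> (perm_inv \<pi> j)) \<in> PN" if "(\<pi>, \<epsilon>) \<in> PN" for \<pi> \<epsilon>
      using that signed_perms_inv[of \<pi> \<epsilon> Type_D n] by (auto simp: PN_def inv_id)
  qed (auto simp: PN_def id_in_signed_perms)
  show "subgroup (coordinate_permutations n) ?G"
    unfolding Q
  proof (rule subgroup_signed_actions)
    show "(\<rho> \<circ> \<pi>, \<lambda>j. \<epsilon> j * \<delta> (\<pi> j)) \<in> PQ" if "(\<pi>, \<epsilon>) \<in> PQ" "(\<rho>, \<delta>) \<in> PQ" for \<pi> \<epsilon> \<rho> \<delta>
      using that signed_perms_comp[of \<pi> \<epsilon> Type_D n \<rho> \<delta>] by (auto simp: PQ_def)
    show "(perm_inv \<pi>, \<lambda>j. \<epsilon> (perm_inv \<pi> j)) \<in> PQ" if "(\<pi>, \<epsilon>) \<in> PQ" for \<pi> \<epsilon>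
      using that signed_perms_inv[of \<pi> \<epsilon> Type_D n] by (auto simp: PQ_def)
  qed (auto simp: PQ_def id_in_signed_perms)
  show "sign_changes n \<lhd> ?G\<lparr>carrier := signed_actions Type_D n (signed_perms Type_D n)\<rparr>"
    unfolding N
  proof (rule normal_signed_actions[OF subset_refl _ U sN])
    show "PN \<subseteq> signed_perms Type_D n" by (auto simp: PN_def)
    fix \<pi> \<epsilon> \<rho> \<delta> assume P: "(\<pi>, \<epsilon>) \<in> signed_perms Type_D n" and R: "(\<rho>, \<delta>) \<in> PN"
    have R': "(\<rho>, \<delta>) \<in> signed_perms Type_D n" and rid: "\<rho> = id" using R by (auto simp: PN_def)
    have "\<pi> permutes {1..n}" using P by (simp add: signed_perms_def)
    then have "perm_inv \<pi> \<circ> (\<rho> \<circ> \<pi>) = id" by (simp add: rid permutes_inv_o)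
    then show "(perm_inv \<pi> \<circ> (\<rho> \<circ> \<pi>), \<lambda>j. \<epsilon> j * \<delta> (\<pi> j) * \<epsilon> (perm_inv \<pi> (\<rho> (\<pi> j)))) \<in> PN"
      using signed_perms_comp[OF signed_perms_comp[OF P R'] signed_perms_inv[OF P]] by (simp add: PN_def)
  qed
  show "sign_changes n \<inter> coordinate_permutations n = {\<one>\<^bsub>?G\<^esub>}"
  proof (intro equalityI subsetI)
    fix w assume "w \<in> sign_changes n \<inter> coordinate_permutations n"
    then have "w \<in> signed_actions Type_D n PN" "w \<in> signed_actions Type_D n PQ" by (simp_all add: N Q)
    then obtain \<epsilon> \<pi> where w: "w = signed_action Type_D n id \<epsilon>" "w = signed_action Type_D n \<pi> (\<lambda>_. 1)"
      and "(id, \<epsilon>) \<in> PN" "(\<pi>, \<lambda>_. 1) \<in> PQ"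
      unfolding signed_actions_def PN_def PQ_def by fast
    then have P: "(id, \<epsilon>) \<in> signed_perms Type_D n" "(\<pi>, \<lambda>_. 1) \<in> signed_perms Type_D n"
      by (simp_all add: PN_def PQ_def)
    have "\<epsilon> = (\<lambda>_. 1)" using signed_action_sign_unique[of n id \<epsilon> \<pi> "\<lambda>_. 1"] w P by simp
    then show "w \<in> {\<one>\<^bsub>?G\<^esub>}" by (simp add: w(1) one_BijGroup_cartan)
  next
    fix w assume "w \<in> {\<one>\<^bsub>?G\<^esub>}"
    then show "w \<in> sign_changes n \<inter> coordinate_permutations n"
      by (auto simp: N Q one_BijGroup_cartan PN_def PQ_def id_in_signed_perms intro!: signed_actionsI)
  qed
  show "signed_actions Type_D n (signed_perms Type_D n) = sign_changes n <#>\<^bsub>?G\<^esub> coordinate_permutations n"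
  proof
    show "signed_actions Type_D n (signed_perms Type_D n) \<subseteq> sign_changes n <#>\<^bsub>?G\<^esub> coordinate_permutations n"
    proof
      fix w assume "w \<in> signed_actions Type_D n (signed_perms Type_D n)"
      then obtain \<pi> \<epsilon> where w: "w = signed_action Type_D n \<pi> \<epsilon>" and P: "(\<pi>, \<epsilon>) \<in> signed_perms Type_D n"
        by (auto simp: signed_actions_def)
      have "(id, \<epsilon>) \<in> PN" "(\<pi>, \<lambda>_. 1) \<in> PQ"
        using P by (auto simp: PN_def PQ_def signed_perms_def permutes_id sign_vectors_one)
      moreover have "w = signed_action Type_D n id \<epsilon> \<otimes>\<^bsub>?G\<^esub> signed_action Type_D n \<pi> (\<lambda>_. 1)"
        using calculation by (subst signed_action_mult) (auto simp: w PN_def PQ_def)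
      ultimately show "w \<in> sign_changes n <#>\<^bsub>?G\<^esub> coordinate_permutations n"
        unfolding N Q set_mult_def using signed_actionsI by blast
    qed
    have "sign_changes n \<subseteq> signed_actions Type_D n (signed_perms Type_D n)"
      "coordinate_permutations n \<subseteq> signed_actions Type_D n (signed_perms Type_D n)"
      unfolding N Q signed_actions_def PN_def PQ_def by auto
    then show "sign_changes n <#>\<^bsub>?G\<^esub> coordinate_permutations n \<subseteq> signed_actions Type_D n (signed_perms Type_D n)"
      using subgroup.m_closed[OF U] unfolding set_mult_def by blast
  qed
qed

section \<open>Polynomial functions as combinations of monomials\<close>

lemma cartan_real_add:
  assumes "admissible t n" "x \<in> cartan_real t n" "y \<in> cartan_real t n"
  shows "(\<lambda>j. x j + y j) \<in> cartan_real t n"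
  using assms by (auto simp: cartan_real_eq cartan_def sum.distrib simp del: sum.cl_ivl_Suc)

lemma cartan_real_scale:
  assumes "admissible t n" "x \<in> cartan_real t n"
  shows "(\<lambda>j. of_real c * x j) \<in> cartan_real t n"
  using assms by (auto simp: cartan_real_eq cartan_def simp del: sum.cl_ivl_Suc simp flip: sum_distrib_left)

lemma cartan_real_zero: "admissible t n \<Longrightarrow> (\<lambda>_. 0) \<in> cartan_real t n"
  by (simp add: cartan_real_eq cartan_def)

lemma cartan_real_subset: "cartan_real t n \<subseteq> cartan t n"
  by (auto simp: cartan_real_def)

lemma cartan_real_Re: "admissible t n \<Longrightarrow> x \<in> cartan_real t n \<Longrightarrow> of_real (Re (x j)) = x j"
  by (simp add: cartan_real_eq)

lemma cartan_real_mono: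
  "admissible t n \<Longrightarrow> admissible t k \<Longrightarrow> n \<le> k \<Longrightarrow> cartan_real t n \<subseteq> cartan_real t k"
  using cartan_mono[of n k t] by (auto simp: cartan_real_eq)

lemma cartan_real_signed:
  assumes "admissible t n" "(\<pi>, \<epsilon>) \<in> signed_perms t n" "x \<in> cartan_real t n"
  shows "(\<lambda>j. of_int (\<epsilon> j) * x (\<pi> j)) \<in> cartan_real t n"
  using assms signed_action_closed[OF assms(2), of x] by (auto simp: cartan_real_eq)

lemma signed_action_apply_real:
  assumes "x \<in> cartan_real t n" shows "signed_action t n \<pi> \<epsilon> x = (\<lambda>j. of_int (\<epsilon> j) * x (\<pi> j))"
  using assms cartan_real_subset by (auto simp: signed_action_def)

lemma weyl_group_cartan_real:
  assumes "admissible t n" "w \<in> weyl_group t n" "x \<in> cartan_real t n" shows "w x \<in> cartan_real t n"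
proof -
  obtain \<pi> \<epsilon> where "w = signed_action t n \<pi> \<epsilon>" "(\<pi>, \<epsilon>) \<in> signed_perms t n"
    using assms(2) unfolding weyl_group_eq signed_actions_def weyl_pairs_def by auto
  then show ?thesis using cartan_real_signed[OF assms(1)] assms(3) by (simp add: signed_action_apply_real)
qed

lemma poly_functions_undefined: "p \<in> poly_functions V \<Longrightarrow> x \<notin> V \<Longrightarrow> p x = undefined"
  by (induction rule: poly_functions.induct) auto

lemma poly_functions_restrict:
  assumes "p \<in> poly_functions V" "U \<subseteq> V" shows "restrict p U \<in> poly_functions U"
  using assms(1)
proof (induction rule: poly_functions.induct)
  case (const c)
  have "restrict (\<lambda>x\<in>V. c) U = (\<lambda>x\<in>U. c)" using assms(2) by (auto simp: restrict_def fun_eq_iff)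
  then show ?case by (simp only: poly_functions.const)
next
  case (linear l)
  then have "real_linear_functional U l" using assms(2) unfolding real_linear_functional_def by blast
  then have "restrict l U \<in> poly_functions U" by (rule poly_functions.linear)
  moreover have "restrict (restrict l V) U = restrict l U" using assms(2) by (auto simp: restrict_def fun_eq_iff)
  ultimately show ?case by (simp only:)
next
  case (add p q)
  have "restrict (\<lambda>x\<in>V. p x + q x) U = (\<lambda>x\<in>U. restrict p U x + restrict q U x)"
    using assms(2) by (auto simp: restrict_def fun_eq_iff)
  then show ?case using poly_functions.add[OF add.IH] by (simp only:)
next
  case (mult p q)
  have "restrict (\<lambda>x\<in>V. p x * q x) U = (\<lambda>x\<in>U. restrict p U x * restrict q U x)"
    using assms(2) by (auto simp: restrict_def fun_eq_iff)
  then show ?case using poly_functions.mult[OF mult.IH] by (simp only:)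
qed

lemma poly_functions_coordinate: "(\<lambda>x\<in>V. Re (x j)) \<in> poly_functions V"
  by (rule poly_functions.linear) (simp add: real_linear_functional_def)

lemma poly_functions_add:
  "(\<lambda>x\<in>V. f x) \<in> poly_functions V \<Longrightarrow> (\<lambda>x\<in>V. g x) \<in> poly_functions V \<Longrightarrow>
   (\<lambda>x\<in>V. f x + g x) \<in> poly_functions V"
  using poly_functions.add[of "\<lambda>x\<in>V. f x" V "\<lambda>x\<in>V. g x"] by (simp cong: restrict_cong)

lemma poly_functions_mult:
  "(\<lambda>x\<in>V. f x) \<in> poly_functions V \<Longrightarrow> (\<lambda>x\<in>V. g x) \<in> poly_functions V \<Longrightarrow>
   (\<lambda>x\<in>V. f x * g x) \<in> poly_functions V"
  using poly_functions.mult[of "\<lambda>x\<in>V. f x" V "\<lambda>x\<in>V. g x"] by (simp cong: restrict_cong)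

lemma poly_functions_power:
  "(\<lambda>x\<in>V. f x) \<in> poly_functions V \<Longrightarrow> (\<lambda>x\<in>V. f x ^ e) \<in> poly_functions V"
  by (induction e) (simp_all add: poly_functions.const poly_functions_mult)

lemma poly_functions_sum:
  assumes "\<And>j. j \<in> S \<Longrightarrow> (\<lambda>x\<in>V. f j x) \<in> poly_functions V"
  shows "(\<lambda>x\<in>V. \<Sum>j\<in>S. f j x) \<in> poly_functions V"
  using assms
  by (induction S rule: infinite_finite_induct) (simp_all add: poly_functions.const poly_functions_add)

lemma poly_functions_prod:
  assumes "\<And>j. j \<in> S \<Longrightarrow> (\<lambda>x\<in>V. f j x) \<in> poly_functions V"
  shows "(\<lambda>x\<in>V. \<Prod>j\<in>S. f j x) \<in> poly_functions V"
  using assms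
  by (induction S rule: infinite_finite_induct) (simp_all add: poly_functions.const poly_functions_mult)

text \<open>The span of the monomials in the coordinates from \<open>J\<close> with exponents in \<open>E\<close>.  The inductive form
  lets linear operators, such as averages over a group, be treated one monomial at a time.\<close>

inductive_set monomial_span :: "nat set \<Rightarrow> (nat \<Rightarrow> nat) set \<Rightarrow> (vec \<Rightarrow> real) set" for J E where
  zero: "(\<lambda>_. 0) \<in> monomial_span J E"
| monomial: "f \<in> monomial_span J E \<Longrightarrow> a \<in> E \<Longrightarrow>
    (\<lambda>x. c * (\<Prod>j\<in>J. Re (x j) ^ a j) + f x) \<in> monomial_span J E"

lemma monomial_span_add:
  assumes "f \<in> monomial_span J E" "g \<in> monomial_span J E"
  shows "(\<lambda>x. f x + g x) \<in> monomial_span J E"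
  using assms(1)
proof (induction rule: monomial_span.induct)
  case zero
  show ?case using assms(2) by simp
next
  case (monomial f a c)
  from monomial_span.monomial[OF monomial.IH monomial.hyps(2), of c] show ?case by (simp add: add.assoc)
qed

lemma monomial_span_scale:
  assumes "f \<in> monomial_span J E" shows "(\<lambda>x. d * f x) \<in> monomial_span J E"
  using assms
proof (induction rule: monomial_span.induct)
  case zero
  show ?case using monomial_span.zero by simp
next
  case (monomial f a c)
  from monomial_span.monomial[OF monomial.IH monomial.hyps(2), of "d * c"] show ?case
    by (simp add: algebra_simps)
qed

lemma monomial_span_mult_monomial:
  assumes "g \<in> monomial_span J UNIV"
  shows "(\<lambda>x. (\<Prod>j\<in>J. Re (x j) ^ a j) * g x) \<in> monomial_span J UNIV"
  using assms
proof (induction rule: monomial_span.induct)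
  case zero
  show ?case using monomial_span.zero by simp
next
  case (monomial f b c)
  from monomial_span.monomial[OF monomial.IH, of "\<lambda>j. a j + b j" c] show ?case
    by (simp add: algebra_simps power_add prod.distrib)
qed

lemma monomial_span_mult:
  assumes "f \<in> monomial_span J UNIV" "g \<in> monomial_span J UNIV"
  shows "(\<lambda>x. f x * g x) \<in> monomial_span J UNIV"
  using assms(1)
proof (induction rule: monomial_span.induct)
  case zero
  show ?case using monomial_span.zero by simp
next
  case (monomial f a c)
  have "(\<lambda>x. c * ((\<Prod>j\<in>J. Re (x j) ^ a j) * g x) + f x * g x) \<in> monomial_span J UNIV"
    by (intro monomial_span_add monomial_span_scale monomial_span_mult_monomial assms(2) monomial.IH)
  then show ?case by (simp add: algebra_simps)
qed

lemma monomial_span_single: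
  assumes "a \<in> E" shows "(\<lambda>x. c * (\<Prod>j\<in>J. Re (x j) ^ a j)) \<in> monomial_span J E"
  using monomial_span.monomial[where c = c, OF monomial_span.zero assms] by simp

lemma monomial_span_const: "(\<lambda>_. c) \<in> monomial_span J UNIV"
  using monomial_span_single[of "\<lambda>_. 0" UNIV c J] by simp

lemma monomial_span_coordinate:
  assumes "finite J" "i \<in> J" shows "(\<lambda>x. Re (x i)) \<in> monomial_span J UNIV"
proof -
  have "(\<Prod>j\<in>J. Re (x j) ^ (if j = i then 1 else 0)) = Re (x i)" for x :: vec
    using assms by (simp add: if_distrib[of "\<lambda>e. _ ^ e"] prod.delta cong: if_cong)
  then show ?thesis
    using monomial_span_single[of "\<lambda>j. if j = i then 1 else 0" UNIV 1 J] by simp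
qed

lemma monomial_span_sum:
  assumes "\<And>i. i \<in> S \<Longrightarrow> f i \<in> monomial_span J E"
  shows "(\<lambda>x. \<Sum>i\<in>S. f i x) \<in> monomial_span J E"
  using assms
  by (induction S rule: infinite_finite_induct) (simp_all add: monomial_span.zero monomial_span_add)

lemma real_linear_functional_sum:
  assumes adm: "admissible t n" and l: "real_linear_functional (cartan_real t n) l"
    and u: "\<And>i. i \<in> S \<Longrightarrow> u i \<in> cartan_real t n"
  shows "(\<lambda>j. \<Sum>i\<in>S. of_real (c i) * u i j) \<in> cartan_real t n \<and>
    l (\<lambda>j. \<Sum>i\<in>S. of_real (c i) * u i j) = (\<Sum>i\<in>S. c i * l (u i))"
proof -
  have l_add: "l (\<lambda>j. x j + y j) = l x + l y" if "x \<in> cartan_real t n" "y \<in> cartan_real t n" for x y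
    using l that unfolding real_linear_functional_def by blast
  have l_scale: "l (\<lambda>j. of_real c * x j) = c * l x" if "x \<in> cartan_real t n" for x c
    using l that unfolding real_linear_functional_def by blast
  have z: "l (\<lambda>_. 0) = 0" using l_scale[OF cartan_real_zero[OF adm], of 0] by simp
  from u show ?thesis
  proof (induction S rule: infinite_finite_induct)
    case (insert i S)
    then have I: "(\<lambda>j. \<Sum>i\<in>S. of_real (c i) * u i j) \<in> cartan_real t n"
      "l (\<lambda>j. \<Sum>i\<in>S. of_real (c i) * u i j) = (\<Sum>i\<in>S. c i * l (u i))"
      and ui: "u i \<in> cartan_real t n" by auto
    note ci = cartan_real_scale[OF adm ui, of "c i"]
    show ?case
      using insert.hyps cartan_real_add[OF adm ci I(1)] l_add[OF ci I(1)] l_scale[OF ui, of "c i"] I(2)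
      by simp
  qed (simp_all add: z cartan_real_zero[OF adm])
qed

text \<open>Every linear functional is a combination of the coordinates.  In types B, C, D the coefficients
  are its values on the unit vectors.  In type A the unit vectors do not have sum zero and are
  projected to the hyperplane by subtracting their mean; the coordinates of \<open>x\<close> have sum zero,
  so \<open>x\<close> is still the combination of the projected vectors with coefficients \<open>x\<^sub>i\<close>.\<close>

lemma linear_functional_coordinates:
  assumes adm: "admissible t n" and l: "real_linear_functional (cartan_real t n) l"
  obtains b where "\<And>x. x \<in> cartan_real t n \<Longrightarrow> l x = (\<Sum>i=1..num_coords t n. b i * Re (x i))"
proof -
  let ?m = "num_coords t n"
  define s :: complex where "s = (if t = Type_A then 1 / of_nat ?m else 0)"
  define u :: "nat \<Rightarrow> vec" where "u = (\<lambda>i j. coord i j - (if j \<in> {1..?m} then s else 0))"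
  have m: "?m > 0" using adm by (cases t) (auto simp: admissible_def num_coords_def)
  have u: "u i \<in> cartan_real t n" if i: "i \<in> {1..?m}" for i
  proof -
    have "(\<Sum>j=1..?m. u i j) = 0" if "t = Type_A"
    proof -
      have "(\<Sum>j=1..?m. u i j) = (\<Sum>j=1..?m. coord i j * 1) - (\<Sum>j=1..?m. s)"
        unfolding u_def by (simp add: sum_subtractf del: sum.cl_ivl_Suc sum_constant)
      also have "\<dots> = 1 - of_nat ?m * s" using i unfolding sum_coord by (simp add: num_coords_def)
      also have "\<dots> = 0" using m that by (simp add: s_def del: of_nat_Suc)
      finally show ?thesis .
    qed
    moreover have "u i j = 0" if "j \<notin> {1..?m}" for j
    proof -
      have "j \<noteq> i" using that i by blast
      with that show ?thesis by (simp only: u_def coord_def if_False diff_self)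
    qed
    moreover have "u i j \<in> \<real>" for j by (simp add: u_def s_def coord_def)
    ultimately show ?thesis unfolding cartan_real_eq[OF adm] cartan_def by blast
  qed
  show ?thesis
  proof (rule that[of "\<lambda>i. l (u i)"])
    fix x assume x: "x \<in> cartan_real t n"
    have "(\<Sum>i=1..?m. of_real (Re (x i)) * u i j) = x j" for j
    proof -
      have "(\<Sum>i=1..?m. of_real (Re (x i)) * u i j) =
          (\<Sum>i=1..?m. coord j i * x i) - (\<Sum>i=1..?m. x i) * (if j \<in> {1..?m} then s else 0)"
        unfolding cartan_real_Re[OF adm x] u_def
        by (simp add: right_diff_distrib sum_subtractf sum_distrib_right coord_def mult.commute
            eq_commute[of j] del: sum.cl_ivl_Suc cong: if_cong)
      also have "(\<Sum>i=1..?m. coord j i * x i) = x j"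
        unfolding sum_coord using x by (auto simp: cartan_real_eq[OF adm] cartan_def)
      also have "(\<Sum>i=1..?m. x i) * (if j \<in> {1..?m} then s else 0) = 0"
      proof (cases "t = Type_A")
        case True
        then have "(\<Sum>i=1..?m. x i) = 0" using x unfolding cartan_real_eq[OF adm] cartan_def by blast
        then show ?thesis by (simp only: mult_zero_left)
      qed (simp add: s_def)
      finally show ?thesis by simp
    qed
    then have "(\<lambda>j. \<Sum>i=1..?m. of_real (Re (x i)) * u i j) = x" by (rule ext)
    with real_linear_functional_sum[OF adm l u, of "{1..?m}" "\<lambda>i. i" "\<lambda>i. Re (x i)"]
    show "l x = (\<Sum>i=1..?m. l (u i) * Re (x i))" by (simp add: mult.commute)
  qed
qed

lemma poly_function_monomial_span:
  assumes adm: "admissible t n" and p: "p \<in> poly_functions (cartan_real t n)"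
  shows "\<exists>f\<in>monomial_span {1..num_coords t n} UNIV. \<forall>x\<in>cartan_real t n. p x = f x"
  using p
proof (induction rule: poly_functions.induct)
  case (const c)
  show ?case by (rule bexI[OF _ monomial_span_const[of c]]) simp
next
  case (linear l)
  obtain b where b: "\<And>x. x \<in> cartan_real t n \<Longrightarrow> l x = (\<Sum>i=1..num_coords t n. b i * Re (x i))"
    using linear_functional_coordinates[OF adm linear] by blast
  have "(\<lambda>x. \<Sum>i=1..num_coords t n. b i * Re (x i)) \<in> monomial_span {1..num_coords t n} UNIV"
    by (intro monomial_span_sum monomial_span_scale monomial_span_coordinate) simp_all
  then show ?case by (rule bexI[rotated]) (simp add: b)
next
  case (add p q)
  then obtain f g where "f \<in> monomial_span {1..num_coords t n} UNIV" "g \<in> monomial_span {1..num_coords t n} UNIV"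
    "\<forall>x\<in>cartan_real t n. p x = f x" "\<forall>x\<in>cartan_real t n. q x = g x" by blast
  then show ?case by (intro bexI[OF _ monomial_span_add[of f _ _ g]]) simp_all
next
  case (mult p q)
  then obtain f g where "f \<in> monomial_span {1..num_coords t n} UNIV" "g \<in> monomial_span {1..num_coords t n} UNIV"
    "\<forall>x\<in>cartan_real t n. p x = f x" "\<forall>x\<in>cartan_real t n. q x = g x" by blast
  then show ?case by (intro bexI[OF _ monomial_span_mult[of f _ g]]) simp_all
qed

definition even_exponents :: "nat set \<Rightarrow> (nat \<Rightarrow> nat) set" where
  "even_exponents S = {a. \<forall>j\<in>S. even (a j)}"

text \<open>Averaging over the sign change of \<open>x\<^sub>i\<close> keeps the monomials that are even in \<open>x\<^sub>i\<close> and cancels the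
  odd ones; conditions on the other exponents persist.\<close>

lemma monomial_span_symmetrize_sign:
  assumes f: "f \<in> monomial_span J (even_exponents S)" and J: "finite J" "i \<in> J"
  shows "(\<lambda>x. (f x + f (x(i := - x i))) / 2) \<in> monomial_span J (even_exponents (insert i S))"
  using f
proof (induction rule: monomial_span.induct)
  case zero
  show ?case using monomial_span.zero by simp
next
  case (monomial f a c)
  have m: "(\<Prod>j\<in>J. Re ((x(i := - x i)) j) ^ a j) = (-1) ^ a i * (\<Prod>j\<in>J. Re (x j) ^ a j)" for x :: vec
  proof -
    have "(\<Prod>j\<in>J - {i}. Re ((x(i := - x i)) j) ^ a j) = (\<Prod>j\<in>J - {i}. Re (x j) ^ a j)"
      by (intro prod.cong) auto
    then show ?thesis
      using J by (simp add: prod.remove[of J i] power_minus[of "Re (x i)"])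
  qed
  show ?case
  proof (cases "even (a i)")
    case True
    then have "a \<in> even_exponents (insert i S)" using monomial.hyps(2) by (simp add: even_exponents_def)
    from monomial_span.monomial[OF monomial.IH this, of c] show ?thesis
      unfolding m using True by (simp add: field_simps)
  next
    case False
    from monomial.IH show ?thesis unfolding m using False by (simp add: field_simps)
  qed
qed

text \<open>The odd exponents are removed from one coordinate after the other; averaging over the sign change
  of a coordinate does not change the values of the even function.\<close>

lemma even_function_monomial_span:
  assumes adm: "admissible t n" and p: "p \<in> poly_functions (cartan_real t n)" and t: "t \<noteq> Type_A"
    and even: "\<And>j x. j \<in> {1..n} \<Longrightarrow> x \<in> cartan_real t n \<Longrightarrow> p (x(j := - x j)) = p x"
  shows "\<exists>f\<in>monomial_span {1..n} (even_exponents {1..n}). \<forall>x\<in>cartan_real t n. p x = f x"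
proof -
  have m: "num_coords t n = n" using t by (simp add: num_coords_def)
  have "\<exists>f\<in>monomial_span {1..n} (even_exponents S). \<forall>x\<in>cartan_real t n. p x = f x" if "S \<subseteq> {1..n}" for S
    using finite_subset[OF that finite_atLeastAtMost] that
  proof (induction S)
    case empty
    show ?case using poly_function_monomial_span[OF adm p] by (simp add: even_exponents_def m)
  next
    case (insert i S)
    then obtain f where f: "f \<in> monomial_span {1..n} (even_exponents S)" "\<forall>x\<in>cartan_real t n. p x = f x"
      by auto
    have i: "i \<in> {1..n}" using insert.prems by simp
    show ?case
    proof (intro bexI[OF _ monomial_span_symmetrize_sign[OF f(1) _ i]] ballI)
      fix x assume x: "x \<in> cartan_real t n"
      have "x(i := - x i) \<in> cartan_real t n" using x t i by (auto simp: cartan_real_eq[OF adm] cartan_def m)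
      then have "f (x(i := - x i)) = f x" using f(2) even[OF i x] x by metis
      then show "p x = (f x + f (x(i := - x i))) / 2" using f(2) x by simp
    qed simp
  qed
  then show ?thesis by blast
qed

section \<open>Symmetric functions are generated by power sums\<close>

definition function_subalgebra :: "('a \<Rightarrow> real) set \<Rightarrow> bool" where
  "function_subalgebra A \<longleftrightarrow> (\<forall>c. (\<lambda>_. c) \<in> A) \<and>
     (\<forall>f\<in>A. \<forall>g\<in>A. (\<lambda>x. f x + g x) \<in> A) \<and> (\<forall>f\<in>A. \<forall>g\<in>A. (\<lambda>x. f x * g x) \<in> A)"

lemma function_subalgebraD:
  assumes "function_subalgebra A"
  shows "(\<lambda>_. c) \<in> A" "f \<in> A \<Longrightarrow> g \<in> A \<Longrightarrow> (\<lambda>x. f x + g x) \<in> A"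
    "f \<in> A \<Longrightarrow> g \<in> A \<Longrightarrow> (\<lambda>x. f x * g x) \<in> A"
  using assms unfolding function_subalgebra_def by blast+

lemma function_subalgebra_diff:
  assumes A: "function_subalgebra A" and "f \<in> A" "g \<in> A" shows "(\<lambda>x. f x - g x) \<in> A"
  using function_subalgebraD(2)[OF A assms(2) function_subalgebraD(3)[OF A function_subalgebraD(1)[OF A] assms(3), of "-1"]]
  by simp

lemma function_subalgebra_sum:
  assumes A: "function_subalgebra A" and "\<And>i. i \<in> S \<Longrightarrow> f i \<in> A" shows "(\<lambda>x. \<Sum>i\<in>S. f i x) \<in> A"
  using assms(2)
  by (induction S rule: infinite_finite_induct) (simp_all add: function_subalgebraD[OF A])

definition distinct_lists :: "nat set \<Rightarrow> nat \<Rightarrow> nat list set" where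
  "distinct_lists J r = {xs. length xs = r \<and> distinct xs \<and> set xs \<subseteq> J}"

text \<open>These are monomial symmetric functions up to a factor: the sum of \<open>x\<^sub>p\<^sup>d x\<^sub>q\<^sup>e \<cdots>\<close> over all choices of
  pairwise distinct indices \<open>p, q, \<dots>\<close>.  Lists of shorter length than the number of variables are
  included because the recursion on the number of factors passes through them.\<close>

definition distinct_sum :: "nat set \<Rightarrow> nat list \<Rightarrow> vec \<Rightarrow> real" where
  "distinct_sum J es x =
     (\<Sum>xs\<in>distinct_lists J (length es). \<Prod>i<length es. Re (x (xs ! i)) ^ (es ! i))"

lemma finite_distinct_lists: "finite J \<Longrightarrow> finite (distinct_lists J r)"
  by (rule finite_subset[OF _ finite_lists_length_eq[of J r]]) (auto simp: distinct_lists_def)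

text \<open>In the product of a power sum and the sum over distinct indices, the new index is either different
  from all others or equal to exactly one of them, in which case the exponents add up.\<close>

lemma distinct_sum_Cons:
  assumes J: "finite J"
  shows "distinct_sum J (e # es) x = (\<Sum>j\<in>J. Re (x j) ^ e) * distinct_sum J es x -
    (\<Sum>i<length es. distinct_sum J (es[i := es ! i + e]) x)"
proof -
  let ?r = "length es"
  define M where "M = (\<lambda>xs. \<Prod>i<?r. Re (x (xs ! i)) ^ (es ! i))"
  have lists: "distinct_lists J (Suc ?r) = (\<lambda>(xs, j). j # xs) ` (SIGMA xs:distinct_lists J ?r. J - set xs)"
    by (auto simp: distinct_lists_def image_iff length_Suc_conv)
  have inj: "inj_on (\<lambda>(xs, j). j # xs) A" for A :: "(nat list \<times> nat) set" by (auto simp: inj_on_def)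
  have upd: "(\<Prod>l<?r. Re (x (xs ! l)) ^ (es[i := es ! i + e] ! l)) = M xs * Re (x (xs ! i)) ^ e"
    if "i < ?r" for i xs
  proof -
    have "(\<Prod>l<?r. Re (x (xs ! l)) ^ (es[i := es ! i + e] ! l)) =
        (\<Prod>l<?r. Re (x (xs ! l)) ^ (es ! l) * (if l = i then Re (x (xs ! i)) ^ e else 1))"
      by (intro prod.cong refl) (auto simp: nth_list_update power_add)
    then show ?thesis using that by (simp add: prod.distrib M_def)
  qed
  have nth: "(\<Sum>j\<in>set xs. Re (x j) ^ e) = (\<Sum>i<?r. Re (x (xs ! i)) ^ e)" if "xs \<in> distinct_lists J ?r" for xs
    using that sum.reindex_bij_betw[OF bij_betw_nth[of xs "{..<?r}" "set xs"], of "\<lambda>j. Re (x j) ^ e"]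
    by (simp add: distinct_lists_def)
  have "distinct_sum J (e # es) x = (\<Sum>xs\<in>distinct_lists J ?r. \<Sum>j\<in>J - set xs. Re (x j) ^ e * M xs)"
    unfolding distinct_sum_def length_Cons lists sum.reindex[OF inj]
    using J finite_distinct_lists[OF J]
    by (subst sum.Sigma) (auto simp: prod.lessThan_Suc_shift M_def case_prod_unfold simp del: prod.lessThan_Suc)
  also have "\<dots> = (\<Sum>xs\<in>distinct_lists J ?r. (\<Sum>j\<in>J. Re (x j) ^ e) * M xs - (\<Sum>i<?r. M xs * Re (x (xs ! i)) ^ e))"
  proof (intro sum.cong refl)
    fix xs assume xs: "xs \<in> distinct_lists J ?r"
    then have "(\<Sum>j\<in>J - set xs. Re (x j) ^ e) = (\<Sum>j\<in>J. Re (x j) ^ e) - (\<Sum>i<?r. Re (x (xs ! i)) ^ e)"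
      unfolding nth[OF xs, symmetric] using J by (intro sum_diff) (auto simp: distinct_lists_def)
    then show "(\<Sum>j\<in>J - set xs. Re (x j) ^ e * M xs) =
        (\<Sum>j\<in>J. Re (x j) ^ e) * M xs - (\<Sum>i<?r. M xs * Re (x (xs ! i)) ^ e)"
      by (simp add: left_diff_distrib mult.commute[of "M xs"] flip: sum_distrib_right)
  qed
  also have "\<dots> = (\<Sum>j\<in>J. Re (x j) ^ e) * distinct_sum J es x -
      (\<Sum>i<?r. \<Sum>xs\<in>distinct_lists J ?r. M xs * Re (x (xs ! i)) ^ e)"
    by (simp add: sum_subtractf sum_distrib_left distinct_sum_def M_def sum.swap[of _ "{..<?r}"])
  also have "(\<Sum>i<?r. \<Sum>xs\<in>distinct_lists J ?r. M xs * Re (x (xs ! i)) ^ e) =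
      (\<Sum>i<?r. distinct_sum J (es[i := es ! i + e]) x)"
    unfolding distinct_sum_def by (intro sum.cong refl) (simp_all only: length_list_update lessThan_iff upd)
  finally show ?thesis .
qed

text \<open>By the recursion, sums over distinct indices lie in every algebra that contains the power sums.
  The set \<open>E\<close> of exponents only has to be closed under addition, so that the even exponents are covered
  as well.\<close>

lemma distinct_sum_in_subalgebra:
  assumes A: "function_subalgebra A" and J: "finite J"
    and E: "\<And>d e. d \<in> E \<Longrightarrow> e \<in> E \<Longrightarrow> d + e \<in> E"
    and power_sum: "\<And>e. e \<in> E \<Longrightarrow> (\<lambda>x. \<Sum>j\<in>J. Re (x j) ^ e) \<in> A"
    and es: "set es \<subseteq> E"
  shows "distinct_sum J es \<in> A"
  using es
proof (induction "length es" arbitrary: es)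
  case 0
  then have "distinct_sum J es = (\<lambda>_. \<Sum>xs\<in>distinct_lists J 0. 1)" by (auto simp: distinct_sum_def)
  then show ?case by (simp only: function_subalgebraD(1)[OF A])
next
  case (Suc r)
  then obtain e es' where es: "es = e # es'" "length es' = r" by (metis length_Suc_conv)
  have e: "e \<in> E" "set es' \<subseteq> E" using Suc.prems es by auto
  have upd: "distinct_sum J (es'[i := es' ! i + e]) \<in> A" if "i \<in> {..<length es'}" for i
  proof (rule Suc.hyps(1))
    show "set (es'[i := es' ! i + e]) \<subseteq> E"
    proof -
      have "es' ! i \<in> E" using that nth_mem[of i es'] e(2) by blast
      then show ?thesis
        using set_update_subset_insert[of es' i "es' ! i + e"] e E[of "es' ! i" e] by blast
    qed
  qed (simp add: es)
  have "distinct_sum J es' \<in> A" using Suc.hyps(1) es e by simp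
  then have "(\<lambda>x. (\<Sum>j\<in>J. Re (x j) ^ e) * distinct_sum J es' x -
      (\<Sum>i<length es'. distinct_sum J (es'[i := es' ! i + e]) x)) \<in> A"
    by (intro function_subalgebra_diff[OF A] function_subalgebraD(3)[OF A] function_subalgebra_sum[OF A]
        power_sum e upd)
  moreover have "distinct_sum J (e # es') = (\<lambda>x. (\<Sum>j\<in>J. Re (x j) ^ e) * distinct_sum J es' x -
      (\<Sum>i<length es'. distinct_sum J (es'[i := es' ! i + e]) x))"
    by (rule ext) (rule distinct_sum_Cons[OF J])
  ultimately show ?case unfolding es by (simp only:)
qed

text \<open>Permutations of \<open>{1..m}\<close> are the lists of length \<open>m\<close> of distinct elements.\<close>

lemma permutation_sum_eq_distinct_sum:
  "(\<Sum>\<pi> | \<pi> permutes {1..m}. \<Prod>j=1..m. Re (x (\<pi> j)) ^ a j) = distinct_sum {1..m} (map a [1..<Suc m]) x"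
  unfolding distinct_sum_def
proof (rule sum.reindex_bij_witness[where
      i = "\<lambda>xs j. if j \<in> {1..m} then xs ! (j - 1) else j" and j = "\<lambda>\<pi>. map \<pi> [1..<Suc m]"])
  have len: "length (map a [1..<Suc m]) = m" by simp
  have shift: "(\<Prod>j=1..m. g j) = (\<Prod>i<m. g (Suc i))" for g :: "nat \<Rightarrow> real"
    using prod.atLeast1_atMost_eq[of g m] by (simp add: One_nat_def)
  have nth: "[1..<Suc m] ! i = Suc i" if "i < m" for i
    using that nth_upt[of 1 i "Suc m"] by (simp del: upt_Suc)
  {
    fix \<pi> assume "\<pi> \<in> {\<pi>. \<pi> permutes {1..m}}"
    then have p: "\<pi> permutes {1..m}" by simp
    show "(\<lambda>j. if j \<in> {1..m} then map \<pi> [1..<Suc m] ! (j - 1) else j) = \<pi>"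
    proof
      fix j show "(if j \<in> {1..m} then map \<pi> [1..<Suc m] ! (j - 1) else j) = \<pi> j"
      proof (cases "j \<in> {1..m}")
        case True
        then have "j - 1 < m" by auto
        then show ?thesis using True nth by (simp del: upt_Suc)
      next
        case False
        show ?thesis unfolding if_not_P[OF False] permutes_not_in[OF p False] ..
      qed
    qed
    have "set [1..<Suc m] = {1..m}" by auto
    then show "map \<pi> [1..<Suc m] \<in> distinct_lists {1..m} (length (map a [1..<Suc m]))"
      using permutes_inj[OF p] permutes_image[OF p]
      by (simp add: distinct_lists_def distinct_map inj_on_subset[OF permutes_inj[OF p]] del: upt_Suc)
    show "(\<Prod>i<length (map a [1..<Suc m]). Re (x (map \<pi> [1..<Suc m] ! i)) ^ (map a [1..<Suc m] ! i)) =
        (\<Prod>j=1..m. Re (x (\<pi> j)) ^ a j)"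
      unfolding len shift
    proof (intro prod.cong refl)
      fix i assume "i \<in> {..<m}"
      then have "i < length [1..<Suc m]" "[1..<Suc m] ! i = Suc i" using nth by simp_all
      then show "Re (x (map \<pi> [1..<Suc m] ! i)) ^ (map a [1..<Suc m] ! i) = Re (x (\<pi> (Suc i))) ^ a (Suc i)"
        by (simp only: nth_map)
    qed
  next
    fix xs assume "xs \<in> distinct_lists {1..m} (length (map a [1..<Suc m]))"
    then have xs: "length xs = m" "distinct xs" "set xs \<subseteq> {1..m}" by (auto simp: distinct_lists_def)
    let ?\<pi> = "\<lambda>j. if j \<in> {1..m} then xs ! (j - 1) else j"
    show "map ?\<pi> [1..<Suc m] = xs"
      using nth xs by (intro nth_equalityI) (simp_all del: upt_Suc)
    have lt: "j - 1 < length xs" if "j \<in> {1..m}" for j using that xs by auto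
    have inj: "inj_on ?\<pi> {1..m}"
    proof (rule inj_onI)
      fix i j assume ij: "i \<in> {1..m}" "j \<in> {1..m}" "?\<pi> i = ?\<pi> j"
      then have "xs ! (i - 1) = xs ! (j - 1)" by (simp only: if_True)
      then have "i - 1 = j - 1" using nth_eq_iff_index_eq[OF xs(2) lt[OF ij(1)] lt[OF ij(2)]] by simp
      then show "i = j" using ij(1,2) by auto
    qed
    have "?\<pi> ` {1..m} \<subseteq> {1..m}"
    proof (rule image_subsetI)
      fix j assume "j \<in> {1..m}"
      then show "?\<pi> j \<in> {1..m}" using nth_mem[OF lt] xs(3) by (simp only: if_True) blast
    qed
    from endo_inj_surj[OF finite_atLeastAtMost this inj] inj
    have "bij_betw ?\<pi> {1..m} {1..m}" by (simp only: bij_betw_def simp_thms)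
    then have "?\<pi> permutes {1..m}" by (rule bij_imp_permutes) (simp only: if_False)
    then show "?\<pi> \<in> {\<pi>. \<pi> permutes {1..m}}" unfolding mem_Collect_eq .
  }
qed

lemma symmetrization_in_subalgebra:
  assumes A: "function_subalgebra A"
    and E: "\<And>d e. d \<in> E \<Longrightarrow> e \<in> E \<Longrightarrow> d + e \<in> E"
    and power_sum: "\<And>e. e \<in> E \<Longrightarrow> (\<lambda>x. \<Sum>j=1..m. Re (x j) ^ e) \<in> A"
    and f: "f \<in> monomial_span {1..m} {a. \<forall>j\<in>{1..m}. a j \<in> E}"
  shows "(\<lambda>x. \<Sum>\<pi> | \<pi> permutes {1..m}. f (\<lambda>j. x (\<pi> j))) \<in> A"
  using f
proof (induction rule: monomial_span.induct)
  case zero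
  show ?case using function_subalgebraD(1)[OF A, of 0] by simp
next
  case (monomial f a c)
  have "distinct_sum {1..m} (map a [1..<Suc m]) \<in> A"
    by (rule distinct_sum_in_subalgebra[OF A _ E power_sum]) (use monomial.hyps(2) in auto)
  then have "(\<lambda>x. c * distinct_sum {1..m} (map a [1..<Suc m]) x + (\<Sum>\<pi> | \<pi> permutes {1..m}. f (\<lambda>j. x (\<pi> j)))) \<in> A"
    by (intro function_subalgebraD[OF A] monomial.IH)
  then show ?case
    by (simp add: sum.distrib permutation_sum_eq_distinct_sum del: upt_Suc flip: sum_distrib_left)
qed

section \<open>Restricting invariants\<close>

lemma invariants_iff:
  assumes "admissible t k"
  shows "p \<in> invariants (weyl_group t k) (cartan_real t k) \<longleftrightarrow> p \<in> poly_functions (cartan_real t k) \<and>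
    (\<forall>\<pi> \<epsilon>. (\<pi>, \<epsilon>) \<in> weyl_pairs t k \<longrightarrow> (\<forall>x\<in>cartan_real t k. p (\<lambda>j. of_int (\<epsilon> j) * x (\<pi> j)) = p x))"
  unfolding invariants_def weyl_group_eq signed_actions_def
  by (auto simp: signed_action_apply_real)

lemma weyl_pairs_cartan_real:
  "admissible t k \<Longrightarrow> (\<pi>, \<epsilon>) \<in> weyl_pairs t k \<Longrightarrow> x \<in> cartan_real t k \<Longrightarrow>
    (\<lambda>j. of_int (\<epsilon> j) * x (\<pi> j)) \<in> cartan_real t k"
  using cartan_real_signed weyl_pairs_subset by blast

lemma invariants_const:
  assumes "admissible t k"
  shows "(\<lambda>x\<in>cartan_real t k. c) \<in> invariants (weyl_group t k) (cartan_real t k)"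
  using weyl_pairs_cartan_real[OF assms] by (auto simp: invariants_iff[OF assms] poly_functions.const)

lemma invariants_add:
  assumes adm: "admissible t k" and "p \<in> invariants (weyl_group t k) (cartan_real t k)"
    "q \<in> invariants (weyl_group t k) (cartan_real t k)"
  shows "(\<lambda>x\<in>cartan_real t k. p x + q x) \<in> invariants (weyl_group t k) (cartan_real t k)"
  using assms weyl_pairs_cartan_real[OF adm] by (auto simp: invariants_iff[OF adm] poly_functions.add)

lemma invariants_mult:
  assumes adm: "admissible t k" and "p \<in> invariants (weyl_group t k) (cartan_real t k)"
    "q \<in> invariants (weyl_group t k) (cartan_real t k)"
  shows "(\<lambda>x\<in>cartan_real t k. p x * q x) \<in> invariants (weyl_group t k) (cartan_real t k)"
  using assms weyl_pairs_cartan_real[OF adm] by (auto simp: invariants_iff[OF adm] poly_functions.mult)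

text \<open>A sign \<open>\<plusminus>1\<close> disappears in an even power, and in type A there are no signs.\<close>

lemma power_sum_invariant:
  assumes adm: "admissible t k" and e: "t \<noteq> Type_A \<Longrightarrow> even e"
  shows "(\<lambda>x\<in>cartan_real t k. \<Sum>j=1..num_coords t k. Re (x j) ^ e) \<in> invariants (weyl_group t k) (cartan_real t k)"
proof -
  have "(\<Sum>j=1..num_coords t k. Re (of_int (\<epsilon> j) * x (\<pi> j)) ^ e) = (\<Sum>j=1..num_coords t k. Re (x j) ^ e)"
    if P: "(\<pi>, \<epsilon>) \<in> weyl_pairs t k" for \<pi> \<epsilon> and x :: vec
  proof -
    have p: "\<pi> permutes {1..num_coords t k}" and s: "\<epsilon> \<in> sign_vectors (num_coords t k)"
      and A: "t = Type_A \<Longrightarrow> \<epsilon> = (\<lambda>_. 1)"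
      using P by (auto simp: weyl_pairs_def signed_perms_def)
    have "Re (of_int (\<epsilon> j) * x (\<pi> j)) ^ e = Re (x (\<pi> j)) ^ e" for j
    proof -
      have "of_int (\<epsilon> j) ^ e = (1::real)"
      proof (cases "t = Type_A")
        case False
        then obtain d where "e = 2 * d" using e by blast
        moreover have "\<epsilon> j ^ 2 = 1" using sign_vectors_square[OF s, of j] by (simp add: power2_eq_square)
        ultimately show ?thesis by (simp add: power_mult flip: of_int_power)
      qed (simp add: A)
      then show ?thesis by (simp add: power_mult_distrib)
    qed
    then show ?thesis using sum.permute[OF p, of "\<lambda>j. Re (x j) ^ e"] by (simp add: o_def)
  qed
  moreover have "(\<lambda>x\<in>cartan_real t k. \<Sum>j=1..num_coords t k. Re (x j) ^ e) \<in> poly_functions (cartan_real t k)"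
    by (intro poly_functions_sum poly_functions_power poly_functions_coordinate)
  ultimately show ?thesis
    using weyl_pairs_cartan_real[OF adm] by (auto simp: invariants_iff[OF adm])
qed

lemma invariant_even:
  assumes adm: "admissible t n" and t: "t = Type_B \<or> t = Type_C"
    and p: "p \<in> invariants (weyl_group t n) (cartan_real t n)"
    and j: "j \<in> {1..n}" and x: "x \<in> cartan_real t n"
  shows "p (x(j := - x j)) = p x"
proof -
  have "(id, flip {j}) \<in> weyl_pairs t n"
    using t j by (intro weyl_pairs_flip) (auto simp: permutes_id)
  then have "p (\<lambda>i. of_int (flip {j} i) * x (id i)) = p x"
    using p x unfolding invariants_iff[OF adm] by blast
  moreover have "(\<lambda>i. of_int (flip {j} i) * x (id i)) = x(j := - x j)" by (auto simp: flip_def fun_eq_iff)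
  ultimately show ?thesis by simp
qed

text \<open>Let \<open>A\<close> be the algebra of functions that agree on \<open>h\<^sub>n\<close> with an invariant on \<open>h\<^sub>k\<close>.  It contains the
  power sums, hence the symmetrizations of all relevant combinations of monomials, hence \<open>p\<close>, which
  is the average of its own permuted copies.\<close>

theorem invariants_extend:
  assumes adm: "admissible t n" "admissible t k" and nk: "n \<le> k" and t: "t \<noteq> Type_D"
    and p: "p \<in> invariants (weyl_group t n) (cartan_real t n)"
  shows "\<exists>F\<in>invariants (weyl_group t k) (cartan_real t k). restrict F (cartan_real t n) = p"
proof -
  let ?m = "num_coords t n" and ?U = "cartan_real t n" and ?V = "cartan_real t k"
  have UV: "?U \<subseteq> ?V" by (rule cartan_real_mono[OF adm nk])
  define A where "A = {f. \<exists>F\<in>invariants (weyl_group t k) ?V. \<forall>x\<in>?U. f x = F x}"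
  define E where "E = (if t = Type_A then UNIV else {e :: nat. even e})"
  have A: "function_subalgebra A"
    unfolding function_subalgebra_def
  proof (intro conjI allI ballI)
    show "(\<lambda>_. c) \<in> A" for c
      unfolding A_def using invariants_const[OF adm(2), of c] UV
      by (intro CollectI bexI[where x = "\<lambda>x\<in>?V. c"]) auto
    fix f g assume "f \<in> A" "g \<in> A"
    then obtain F G where F: "F \<in> invariants (weyl_group t k) ?V" "\<forall>x\<in>?U. f x = F x"
      and G: "G \<in> invariants (weyl_group t k) ?V" "\<forall>x\<in>?U. g x = G x" unfolding A_def by blast
    show "(\<lambda>x. f x + g x) \<in> A"
      unfolding A_def using invariants_add[OF adm(2) F(1) G(1)] F(2) G(2) UV
      by (intro CollectI bexI[where x = "\<lambda>x\<in>?V. F x + G x"]) auto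
    show "(\<lambda>x. f x * g x) \<in> A"
      unfolding A_def using invariants_mult[OF adm(2) F(1) G(1)] F(2) G(2) UV
      by (intro CollectI bexI[where x = "\<lambda>x\<in>?V. F x * G x"]) auto
  qed
  have power_sum: "(\<lambda>x. \<Sum>j=1..?m. Re (x j) ^ e) \<in> A" if e: "e \<in> E" for e
  proof (cases "e = 0")
    \<comment> \<open>The power sum with exponent 0 counts the coordinates and does not restrict to its analogue, but
      it is a constant.\<close>
    case True
    have "(\<lambda>_. \<Sum>j=1..?m. 1) \<in> A" by (rule function_subalgebraD(1)[OF A])
    with True show ?thesis by simp
  next
    case False
    have inv: "(\<lambda>x\<in>?V. \<Sum>j=1..num_coords t k. Re (x j) ^ e) \<in> invariants (weyl_group t k) ?V"
      by (rule power_sum_invariant[OF adm(2)]) (use e in \<open>simp add: E_def\<close>)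
    have "(\<Sum>j=1..?m. Re (x j) ^ e) = (\<Sum>j=1..num_coords t k. Re (x j) ^ e)" if x: "x \<in> ?U" for x
    proof (rule sum.mono_neutral_left)
      show "{1..?m} \<subseteq> {1..num_coords t k}" using nk by (auto simp: num_coords_def)
      have "x j = 0" if "j \<notin> {1..?m}" for j
        using x that unfolding cartan_real_eq[OF adm(1)] cartan_def by blast
      then show "\<forall>j\<in>{1..num_coords t k} - {1..?m}. Re (x j) ^ e = 0" using False by fastforce
    qed simp
    then show ?thesis
      unfolding A_def using inv UV
      by (intro CollectI bexI[where x = "\<lambda>x\<in>?V. \<Sum>j=1..num_coords t k. Re (x j) ^ e"]) auto
  qed
  have poly: "p \<in> poly_functions ?U" using p by (simp add: invariants_def)
  obtain f where f: "f \<in> monomial_span {1..?m} {a. \<forall>j\<in>{1..?m}. a j \<in> E}" "\<forall>x\<in>?U. p x = f x"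
  proof (cases "t = Type_A")
    case True
    then show ?thesis using poly_function_monomial_span[OF adm(1) poly] that by (auto simp: E_def)
  next
    case False
    then have "t = Type_B \<or> t = Type_C" using t by (cases t) auto
    from invariant_even[OF adm(1) this p]
    have "\<exists>f\<in>monomial_span {1..n} (even_exponents {1..n}). \<forall>x\<in>?U. p x = f x"
      by (intro even_function_monomial_span[OF adm(1) poly False])
    then show ?thesis using that False by (auto simp: E_def even_exponents_def num_coords_def)
  qed
  have "(\<lambda>x. \<Sum>\<pi> | \<pi> permutes {1..?m}. f (\<lambda>j. x (\<pi> j))) \<in> A"
    by (rule symmetrization_in_subalgebra[OF A _ power_sum f(1)]) (auto simp: E_def split: if_splits)
  then have "(\<lambda>x. (1 / fact ?m) * (\<Sum>\<pi> | \<pi> permutes {1..?m}. f (\<lambda>j. x (\<pi> j)))) \<in> A"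
    by (rule function_subalgebraD(3)[OF A function_subalgebraD(1)[OF A]])
  then obtain F where F: "F \<in> invariants (weyl_group t k) ?V"
    and FU: "\<And>x. x \<in> ?U \<Longrightarrow> (1 / fact ?m) * (\<Sum>\<pi> | \<pi> permutes {1..?m}. f (\<lambda>j. x (\<pi> j))) = F x"
    unfolding A_def by blast
  have "F x = p x" if x: "x \<in> ?U" for x
  proof -
    have "f (\<lambda>j. x (\<pi> j)) = p x" if "\<pi> permutes {1..?m}" for \<pi>
    proof -
      note P = weyl_pairs_permutation[OF that]
      have "(\<lambda>j. x (\<pi> j)) \<in> ?U" using weyl_pairs_cartan_real[OF adm(1) P x] by simp
      moreover have "p (\<lambda>j. x (\<pi> j)) = p x" using p P x unfolding invariants_iff[OF adm(1)] by fastforce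
      ultimately show ?thesis using f(2) by metis
    qed
    then have "(\<Sum>\<pi> | \<pi> permutes {1..?m}. f (\<lambda>j. x (\<pi> j))) = (\<Sum>\<pi> | \<pi> permutes {1..?m}. p x)"
      by (intro sum.cong) auto
    also have "\<dots> = fact ?m * p x" using card_permutations[of "{1..?m}" ?m] by simp
    finally show ?thesis using FU[OF x] by simp
  qed
  then have "restrict F ?U = p"
    using poly_functions_undefined[OF poly] by (auto simp: restrict_def fun_eq_iff)
  with F show ?thesis by blast
qed

text \<open>A restricted invariant is invariant under whatever the stabilizer induces on \<open>h\<^sub>n\<close>, which in type D
  is more than the Weyl group of \<open>g\<^sub>n\<close>.\<close>

lemma restrictions_invariants_subset:
  assumes adm: "admissible t n" "admissible t k" and nk: "n \<le> k"
    and W: "W \<subseteq> restrictions (stabilizer_of (cartan t n) (weyl_group t k)) (cartan t n)"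
  shows "restrictions (invariants (weyl_group t k) (cartan_real t k)) (cartan_real t n) \<subseteq>
    invariants W (cartan_real t n)"
proof
  let ?U = "cartan_real t n" and ?V = "cartan_real t k"
  have UV: "?U \<subseteq> ?V" by (rule cartan_real_mono[OF adm nk])
  fix p assume "p \<in> restrictions (invariants (weyl_group t k) ?V) ?U"
  then obtain F where F: "F \<in> invariants (weyl_group t k) ?V" and p: "p = restrict F ?U"
    by (auto simp: restrictions_def)
  have "p \<in> poly_functions ?U"
    unfolding p using F UV by (intro poly_functions_restrict) (auto simp: invariants_def)
  moreover have "p (v x) = p x" if v: "v \<in> W" and x: "x \<in> ?U" for v x
  proof -
    obtain w where w: "w \<in> weyl_group t k" "w ` cartan t n = cartan t n" "v = restrict w (cartan t n)"
      using v W by (auto simp: restrictions_def stabilizer_of_def)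
    have xn: "x \<in> cartan t n" using x cartan_real_subset by blast
    have vx: "v x = w x" using w(3) xn by simp
    have "w x \<in> ?V" using weyl_group_cartan_real[OF adm(2) w(1)] x UV by blast
    moreover have "w x \<in> cartan t n" using w(2) xn by blast
    ultimately have "w x \<in> ?U" by (auto simp: cartan_real_eq[OF adm(1)] cartan_real_eq[OF adm(2)])
    then show ?thesis using F w(1) x UV unfolding p vx invariants_def by auto
  qed
  ultimately show "p \<in> invariants W ?U" by (simp add: invariants_def)
qed

theorem restriction_of_invariants_surjective:
  assumes adm: "admissible t n" "admissible t k" and nk: "n \<le> k" and t: "t \<noteq> Type_D"
  shows "restrictions (invariants (weyl_group t k) (cartan_real t k)) (cartan_real t n) =
    invariants (weyl_group t n) (cartan_real t n)"
proof
  have n: "1 \<le> n" using adm(1) by (cases t) (auto simp: admissible_def)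
  show "restrictions (invariants (weyl_group t k) (cartan_real t k)) (cartan_real t n) \<subseteq>
    invariants (weyl_group t n) (cartan_real t n)"
    by (rule restrictions_invariants_subset[OF adm nk]) (simp add: restrictions_stabilizer_weyl_group[OF n nk t])
  show "invariants (weyl_group t n) (cartan_real t n) \<subseteq>
    restrictions (invariants (weyl_group t k) (cartan_real t k)) (cartan_real t n)"
    using invariants_extend[OF adm nk t] unfolding restrictions_def by blast
qed

section \<open>Invariants in type D\<close>

lemma admissible_D: "admissible Type_D n \<longleftrightarrow> 4 \<le> n"
  by (simp add: admissible_def)

lemma cartan_real_B_eq_D:
  assumes "4 \<le> n" shows "cartan_real Type_B n = cartan_real Type_D n"
proof -
  have "admissible Type_B n" "admissible Type_D n" using assms by (auto simp: admissible_def)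
  then show ?thesis by (simp add: cartan_real_eq cartan_B_eq_D)
qed

lemma invariants_antimono: "W \<subseteq> W' \<Longrightarrow> invariants W' V \<subseteq> invariants W V"
  by (auto simp: invariants_def)

text \<open>Both images lie between the restrictions of the type B invariants of \<open>h\<^sub>k\<close>, which are all type B
  invariants of \<open>h\<^sub>n\<close> by surjectivity in type B, and the type B invariants of \<open>h\<^sub>n\<close>, since the stabilizer
  restricts to the Weyl group of type B.\<close>

theorem restrictions_invariants_D:
  assumes n: "4 \<le> n" and nk: "n < k"
  shows "restrictions (invariants (weyl_group Type_D k) (cartan_real Type_D k)) (cartan_real Type_D n) =
      invariants (weyl_group Type_B n) (cartan_real Type_D n)"
    and "restrictions (invariants (weyl_group Type_B k) (cartan_real Type_D k)) (cartan_real Type_D n) =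
      invariants (weyl_group Type_B n) (cartan_real Type_D n)"
proof -
  have adm: "admissible Type_D n" "admissible Type_D k" "admissible Type_B n" "admissible Type_B k"
    using n nk by (auto simp: admissible_def)
  have k: "4 \<le> k" using n nk by simp
  show B: "restrictions (invariants (weyl_group Type_B k) (cartan_real Type_D k)) (cartan_real Type_D n) =
      invariants (weyl_group Type_B n) (cartan_real Type_D n)"
    using restriction_of_invariants_surjective[OF adm(3,4)] nk cartan_real_B_eq_D[OF n] cartan_real_B_eq_D[OF k]
    by simp
  have "restrictions (invariants (weyl_group Type_B k) (cartan_real Type_D k)) (cartan_real Type_D n) \<subseteq>
      restrictions (invariants (weyl_group Type_D k) (cartan_real Type_D k)) (cartan_real Type_D n)"
    unfolding restrictions_def by (intro image_mono invariants_antimono weyl_group_D_subset_B)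
  moreover have "restrictions (invariants (weyl_group Type_D k) (cartan_real Type_D k)) (cartan_real Type_D n) \<subseteq>
      invariants (weyl_group Type_B n) (cartan_real Type_D n)"
    using nk n by (intro restrictions_invariants_subset adm) (simp_all add: weyl_group_B restrictions_stabilizer)
  ultimately show "restrictions (invariants (weyl_group Type_D k) (cartan_real Type_D k)) (cartan_real Type_D n) =
      invariants (weyl_group Type_B n) (cartan_real Type_D n)"
    using B by blast
qed

lemma even_monomial_span_squares:
  assumes adm: "admissible Type_D n" and f: "f \<in> monomial_span {1..n} (even_exponents {1..n})"
  shows "\<exists>q\<in>poly_functions (cartan_real Type_D n). \<forall>x\<in>cartan_real Type_D n. f x = q (\<lambda>j. (x j)\<^sup>2)"
proof -
  have sq: "(\<lambda>j. (x j)\<^sup>2) \<in> cartan_real Type_D n" if "x \<in> cartan_real Type_D n" for x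
    using that by (auto simp: cartan_real_eq[OF adm] cartan_def)
  from f show ?thesis
  proof (induction rule: monomial_span.induct)
    case zero
    show ?case using sq by (intro bexI[OF _ poly_functions.const[of 0]]) simp
  next
    case (monomial f a c)
    then obtain q where q: "q \<in> poly_functions (cartan_real Type_D n)"
      "\<forall>x\<in>cartan_real Type_D n. f x = q (\<lambda>j. (x j)\<^sup>2)" by blast
    let ?r = "\<lambda>x\<in>cartan_real Type_D n. c * (\<Prod>j=1..n. Re (x j) ^ (a j div 2))"
    have "?r \<in> poly_functions (cartan_real Type_D n)"
      by (intro poly_functions_mult poly_functions.const poly_functions_prod poly_functions_power
          poly_functions_coordinate)
    from poly_functions.add[OF this q(1)] show ?case
    proof (rule bexI[rotated], intro ballI)
      fix x assume x: "x \<in> cartan_real Type_D n"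
      have "Re (x j) ^ a j = Re ((x j)\<^sup>2) ^ (a j div 2)" if j: "j \<in> {1..n}" for j
      proof -
        have "Re ((x j)\<^sup>2) = (Re (x j))\<^sup>2"
          using cartan_real_Re[OF adm x, of j] by (metis Re_complex_of_real of_real_power)
        moreover have "a j = 2 * (a j div 2)" using monomial.hyps(2) j by (auto simp: even_exponents_def)
        ultimately show ?thesis by (metis power_mult)
      qed
      then have "(\<Prod>j=1..n. Re (x j) ^ a j) = (\<Prod>j=1..n. Re ((x j)\<^sup>2) ^ (a j div 2))"
        by (intro prod.cong) auto
      then show "c * (\<Prod>j=1..n. Re (x j) ^ a j) + f x =
          (\<lambda>x\<in>cartan_real Type_D n. ?r x + q x) (\<lambda>j. (x j)\<^sup>2)"
        using q(2) x sq[OF x] by simp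
    qed
  qed
qed

theorem type_B_invariants_poly_in_squares:
  assumes n: "4 \<le> n" and p: "p \<in> invariants (weyl_group Type_B n) (cartan_real Type_D n)"
  shows "poly_in_squares n p"
proof -
  have adm: "admissible Type_D n" "admissible Type_B n" using n by (auto simp: admissible_def)
  have poly: "p \<in> poly_functions (cartan_real Type_D n)" using p by (simp add: invariants_def)
  have "p (x(j := - x j)) = p x" if "j \<in> {1..n}" "x \<in> cartan_real Type_D n" for j x
    using invariant_even[OF adm(2), of p j x] p that cartan_real_B_eq_D[OF n] by simp
  then obtain f where "f \<in> monomial_span {1..n} (even_exponents {1..n})" "\<forall>x\<in>cartan_real Type_D n. p x = f x"
    using even_function_monomial_span[OF adm(1) poly] by auto
  then show ?thesis
    unfolding poly_in_squares_def using even_monomial_span_squares[OF adm(1)] by metis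
qed

lemma pfaffian_invariant:
  assumes n: "4 \<le> n"
  shows "(\<lambda>x\<in>cartan_real Type_D n. c * pfaffian n x) \<in> invariants (weyl_group Type_D n) (cartan_real Type_D n)"
proof -
  let ?V = "cartan_real Type_D n"
  have adm: "admissible Type_D n" using n by (simp add: admissible_D)
  have eq: "(\<lambda>x\<in>?V. c * pfaffian n x) = (\<lambda>x\<in>?V. c * (\<Prod>j=1..n. Re (x j)))"
    by (auto simp: pfaffian_def)
  have "(\<lambda>x\<in>?V. c * (\<Prod>j=1..n. Re (x j))) \<in> poly_functions ?V"
    by (intro poly_functions_mult poly_functions.const poly_functions_prod poly_functions_coordinate)
  moreover have "(\<Prod>j=1..n. Re (of_int (\<epsilon> j) * x (\<pi> j))) = (\<Prod>j=1..n. Re (x j))"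
    if P: "(\<pi>, \<epsilon>) \<in> weyl_pairs Type_D n" for \<pi> \<epsilon> and x :: vec
  proof -
    have "\<pi> permutes {1..n}" and e: "(\<Prod>j=1..n. \<epsilon> j) = 1"
      using P by (auto simp: weyl_pairs_def signed_perms_def)
    then have "(\<Prod>j=1..n. Re (x (\<pi> j))) = (\<Prod>j=1..n. Re (x j))"
      using prod.permute[of \<pi> "{1..n}" "\<lambda>j. Re (x j)"] by (simp add: o_def)
    moreover have "(\<Prod>j=1..n. real_of_int (\<epsilon> j)) = 1" using e by (simp flip: of_int_prod)
    ultimately show ?thesis by (simp add: prod.distrib)
  qed
  ultimately show ?thesis
    unfolding eq using weyl_pairs_cartan_real[OF adm] by (auto simp: invariants_iff[OF adm])
qed

text \<open>At the all-ones vector the value is \<open>c\<close>, and it becomes \<open>- c\<close> when the sign of \<open>x\<^sub>1\<close> is changed.\<close>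

lemma pfaffian_not_type_B_invariant:
  assumes n: "4 \<le> n" and c: "c \<noteq> 0"
  shows "(\<lambda>x\<in>cartan_real Type_D n. c * pfaffian n x) \<notin> invariants (weyl_group Type_B n) (cartan_real Type_D n)"
proof
  let ?V = "cartan_real Type_D n" and ?p = "\<lambda>x\<in>cartan_real Type_D n. c * pfaffian n x"
  assume p: "?p \<in> invariants (weyl_group Type_B n) ?V"
  have adm: "admissible Type_B n" "admissible Type_D n" using n by (auto simp: admissible_def)
  define u :: vec where "u = (\<lambda>j. if j \<in> {1..n} then 1 else 0)"
  have u: "u \<in> ?V" "u(1 := - u 1) \<in> ?V"
    using n by (auto simp: cartan_real_eq[OF adm(2)] cartan_def u_def)
  have "?p (u(1 := - u 1)) = ?p u"
    using invariant_even[OF adm(1), of ?p 1 u] p u cartan_real_B_eq_D[OF n] n by simp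
  moreover have "(\<Prod>j=1..n. Re ((u(1 := - u 1)) j)) = - (\<Prod>j=1..n. Re (u j))"
  proof -
    have "(\<Prod>j\<in>{1..n} - {1}. Re ((u(1 := - u 1)) j)) = (\<Prod>j\<in>{1..n} - {1}. Re (u j))"
      by (intro prod.cong) auto
    then show ?thesis using n by (simp add: prod.remove[of "{1..n}" 1])
  qed
  moreover have "(\<Prod>j=1..n. Re (u j)) = 1" by (intro prod.neutral) (simp add: u_def)
  ultimately show False using u c by (simp add: pfaffian_def)
qed

text \<open>The Weyl group of type B is generated by that of type D and \<open>\<sigma>\<^sub>k\<close>, so evenness in the single
  coordinate \<open>x\<^sub>1\<close> is enough for one inclusion; the other one holds because every single sign change
  belongs to the Weyl group of type B.\<close>

theorem even_invariants_eq:
  assumes k: "4 \<le> k"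
  shows "even_invariants k = invariants (weyl_group Type_B k) (cartan_real Type_D k)"
proof
  let ?V = "cartan_real Type_D k"
  have adm: "admissible Type_B k" "admissible Type_D k" using k by (auto simp: admissible_def)
  show "invariants (weyl_group Type_B k) ?V \<subseteq> even_invariants k"
  proof
    fix p assume p: "p \<in> invariants (weyl_group Type_B k) ?V"
    then have "p \<in> invariants (weyl_group Type_D k) ?V"
      using invariants_antimono[OF weyl_group_D_subset_B] by blast
    then show "p \<in> even_invariants k"
      using invariant_even[OF adm(1), of p] p cartan_real_B_eq_D[OF k] by (simp add: even_invariants_def)
  qed
  show "even_invariants k \<subseteq> invariants (weyl_group Type_B k) ?V"
  proof
    fix p assume p: "p \<in> even_invariants k"
    then have inv: "p \<in> invariants (weyl_group Type_D k) ?V" by (simp add: even_invariants_def)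
    have "p (w x) = p x" if w: "w \<in> weyl_group Type_B k" and x: "x \<in> ?V" for w x
    proof -
      have "w \<in> ext_weyl_group k" using w k by (simp add: ext_weyl_group_eq)
      then obtain v s where v: "v \<in> weyl_group Type_D k" and s: "s \<in> sigma_group k"
        and w_eq: "w = v \<otimes>\<^bsub>BijGroup (cartan Type_D k)\<^esub> s"
        by (auto simp: ext_weyl_group_def set_mult_def)
      have "v \<in> carrier (BijGroup (cartan Type_D k))"
        using v subgroup.subset[OF subgroup_weyl_pairs[of Type_D k]] by (auto simp: weyl_group_eq)
      moreover have "s \<in> carrier (BijGroup (cartan Type_D k))"
        using s k sigma_signed_perm[of k] id_in_signed_perms[of Type_D k] signed_action_Bij
        by (auto simp: sigma_group_eq signed_actions_def)
      moreover have xc: "x \<in> cartan Type_D k" using x cartan_real_subset by blast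
      ultimately have wx: "w x = v (s x)" unfolding w_eq by (simp add: BijGroup_def compose_eq)
      have "s x = x \<or> s x = x(1 := - x 1)"
        using s xc by (auto simp: sigma_group_def BijGroup_def sigma_def)
      moreover have "x(1 := - x 1) \<in> ?V"
        using x k by (auto simp: cartan_real_eq[OF adm(2)] cartan_def)
      ultimately have "s x \<in> ?V" "p (s x) = p x"
        using x p k unfolding even_invariants_def by auto
      then show ?thesis using inv v unfolding wx invariants_def by auto
    qed
    then show "p \<in> invariants (weyl_group Type_B k) ?V" using inv by (simp add: invariants_def)
  qed
qed

theorem ext_weyl_group_reflection_group:
  assumes k: "4 \<le> k" shows "finite_reflection_group Type_D k (ext_weyl_group k)"
  unfolding finite_reflection_group_def
proof (intro conjI exI)
  have adm: "admissible Type_B k" using k by (simp add: admissible_def)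
  have ext: "ext_weyl_group k = weyl_group Type_B k" using k by (simp add: ext_weyl_group_eq)
  have "sign_vectors k \<subseteq> flip ` Pow {1..k}"
  proof
    fix \<epsilon> assume "\<epsilon> \<in> sign_vectors k"
    from sign_vectors_flip[OF this] show "\<epsilon> \<in> flip ` Pow {1..k}" by blast
  qed
  then have "finite (sign_vectors k)" by (rule finite_subset) simp
  then have "finite ({\<pi>. \<pi> permutes {1..k}} \<times> sign_vectors k)" by (simp add: finite_permutations)
  then have "finite (signed_perms Type_D k)"
    by (rule rev_finite_subset) (auto simp: signed_perms_def)
  then show "finite (ext_weyl_group k)" by (simp add: ext weyl_group_B signed_actions_def)
  show "ext_weyl_group k = generate (BijGroup (cartan Type_D k)) (reflection (cartan Type_D k) ` roots Type_B k)"
    unfolding ext weyl_group_def cartan_B_eq_D ..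
  show "roots Type_B k \<subseteq> cartan_real Type_D k - {\<lambda>_. 0}"
  proof
    fix a assume a: "a \<in> roots Type_B k"
    have "a j \<in> \<real>" for j using a unfolding roots_eq by (auto simp: entry_vec_def coord_def)
    then have "a \<in> cartan_real Type_B k" using a by (auto simp: cartan_real_eq[OF adm] roots_def)
    then show "a \<in> cartan_real Type_D k - {\<lambda>_. 0}"
      using a cartan_real_B_eq_D[OF k] by (auto simp: roots_def)
  qed
qed

lemma weyl_group_D_even_signs:
  assumes "w \<in> weyl_group Type_D n"
  shows "\<exists>\<pi> \<epsilon>. \<pi> permutes {1..n} \<and> \<epsilon> \<in> sign_vectors n \<and>
    w = signed_permutation n \<pi> \<epsilon> \<and> even (card {j \<in> {1..n}. \<epsilon> j = -1})"
proof -
  obtain \<pi> \<epsilon> where w: "w = signed_action Type_D n \<pi> \<epsilon>" and P: "(\<pi>, \<epsilon>) \<in> weyl_pairs Type_D n"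
    using assms by (auto simp: weyl_group_eq signed_actions_def)
  let ?N = "{j \<in> {1..n}. \<epsilon> j = -1}"
  have e: "\<epsilon> \<in> sign_vectors n" and p: "\<pi> permutes {1..n}" and prod: "(\<Prod>j=1..n. \<epsilon> j) = 1"
    using P by (auto simp: weyl_pairs_def signed_perms_def)
  have "(\<Prod>j=1..n. \<epsilon> j) = (\<Prod>j=1..n. flip ?N j)"
    using sign_vectors_flip[OF e] by (rule arg_cong[where f = "\<lambda>\<epsilon>. \<Prod>j=1..n. \<epsilon> j"])
  also have "\<dots> = (-1) ^ card ?N" by (rule prod_flip) auto
  finally have "(\<Prod>j=1..n. \<epsilon> j) = (-1) ^ card ?N" .
  then have "even (card ?N)" using prod by (simp add: minus_one_power_iff split: if_splits)
  with e p w show ?thesis unfolding signed_permutation_eq by blast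
qed

theorem theorem1p7:
  fixes t t' :: lie_type and n k :: nat
  assumes "propagates t n t' k"
  shows
    "(t \<noteq> Type_D \<and> t' \<noteq> Type_D \<longrightarrow>
        weyl_group t n =
          restrictions (stabilizer_of (cartan t n) (weyl_group t' k)) (cartan t n) \<and>
        restrictions (stabilizer_of (cartan t n) (weyl_group t' k)) (cartan t n) =
          {restrict w (cartan t n) | w. w \<in> weyl_group t' k \<and> w ` cartan t n = cartan t n} \<and>
        (\<lambda>p. restrict p (cartan_real t n)) ` invariants (weyl_group t' k) (cartan_real t' k) =
          invariants (weyl_group t n) (cartan_real t n))
     \<and>
     (t = Type_D \<and> t' = Type_D \<and> n < k \<longrightarrow>
        (let hn = cartan Type_D n; hk = cartan Type_D k;
             hnR = cartan_real Type_D n; hkR = cartan_real Type_D k;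
             Wn = weyl_group Type_D n; Wk = weyl_group Type_D k;
             Wn_ext = ext_weyl_group n; Wk_ext = ext_weyl_group k
         in
          restrictions (stabilizer_of hn Wk) hn = {restrict w hn | w. w \<in> Wk \<and> w ` hn = hn} \<and>
          is_semidirect_product (BijGroup hn) (restrictions (stabilizer_of hn Wk) hn)
            (sign_changes n) (coordinate_permutations n) \<and>
          sign_changes n \<subseteq> restrictions (stabilizer_of hn Wk) hn \<and>
          (\<forall>w\<in>Wn. \<exists>\<pi> \<epsilon>. \<pi> permutes {1..n} \<and> \<epsilon> \<in> sign_vectors n \<and>
             w = signed_permutation n \<pi> \<epsilon> \<and> even (card {j \<in> {1..n}. \<epsilon> j = -1})) \<and>
          Wn \<subset> restrictions (stabilizer_of hn Wk) hn \<and>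
          (\<forall>p\<in>restrictions (invariants Wk hkR) hnR. poly_in_squares n p) \<and>
          restrictions (invariants Wk hkR) hnR \<subseteq> invariants Wn hnR \<and>
          (\<forall>c. c \<noteq> 0 \<longrightarrow> (\<lambda>x\<in>hnR. c * pfaffian n x) \<in> invariants Wn hnR) \<and>
          (\<forall>c. c \<noteq> 0 \<longrightarrow> (\<lambda>x\<in>hnR. c * pfaffian n x) \<notin> restrictions (invariants Wk hkR) hnR) \<and>
          is_semidirect_product (BijGroup hk) Wk_ext Wk (sigma_group k) \<and>
          is_semidirect_product (BijGroup hn) Wn_ext Wn (sigma_group n) \<and>
          finite_reflection_group Type_D k Wk_ext \<and>
          Wn_ext = restrictions (stabilizer_of hn Wk) hn \<and>
          restrictions Wn_ext hnR = restrictions (stabilizer_of hn Wk) hnR \<and>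
          Wn_ext = restrictions (stabilizer_of hn Wk_ext) hn \<and>
          even_invariants k = invariants Wk_ext hkR \<and>
          restrictions (invariants Wk hkR) hnR = restrictions (invariants Wk_ext hkR) hnR \<and>
          restrictions (invariants Wk_ext hkR) hnR = invariants Wn_ext hnR))"
  unfolding Let_def
proof (intro conjI impI)
  have nk: "n \<le> k" and adm: "admissible t n" "admissible t k" and tt: "t' = t"
    using assms by (auto simp: propagates_iff)
  have n: "1 \<le> n" using adm(1) by (cases t) (auto simp: admissible_def)
  have stabilizer_eq: "restrictions (stabilizer_of U W) U = {restrict w U | w. w \<in> W \<and> w ` U = U}" for U W
    by (auto simp: restrictions_def stabilizer_of_def)
  {
    assume "t \<noteq> Type_D \<and> t' \<noteq> Type_D"
    then have t: "t \<noteq> Type_D" by simp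
    show "weyl_group t n = restrictions (stabilizer_of (cartan t n) (weyl_group t' k)) (cartan t n)"
      using restrictions_stabilizer_weyl_group[OF n nk t] by (simp add: tt)
    show "restrictions (stabilizer_of (cartan t n) (weyl_group t' k)) (cartan t n) =
        {restrict w (cartan t n) | w. w \<in> weyl_group t' k \<and> w ` cartan t n = cartan t n}"
      by (rule stabilizer_eq)
    show "(\<lambda>p. restrict p (cartan_real t n)) ` invariants (weyl_group t' k) (cartan_real t' k) =
        invariants (weyl_group t n) (cartan_real t n)"
      using restriction_of_invariants_surjective[OF adm nk t] unfolding tt restrictions_def .
  }
  assume D: "t = Type_D \<and> t' = Type_D \<and> n < k"
  then have n4: "4 \<le> n" and k4: "4 \<le> k" and less: "n < k" and k: "1 \<le> k"
    using adm by (auto simp: admissible_def)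
  let ?hn = "cartan Type_D n" and ?hnR = "cartan_real Type_D n" and ?hkR = "cartan_real Type_D k"
    and ?Wk = "weyl_group Type_D k" and ?Wn = "weyl_group Type_D n"
  have S: "restrictions (stabilizer_of ?hn ?Wk) ?hn = weyl_group Type_B n"
    unfolding weyl_group_B by (rule restrictions_stabilizer[OF n nk less])
  have ext: "ext_weyl_group n = weyl_group Type_B n" "ext_weyl_group k = weyl_group Type_B k"
    by (rule ext_weyl_group_eq[OF n], rule ext_weyl_group_eq[OF k])
  have S_ext: "restrictions (stabilizer_of ?hn (weyl_group Type_B k)) ?hn = weyl_group Type_B n"
    using restrictions_stabilizer_weyl_group[OF n nk, of Type_B] by (simp add: cartan_B_eq_D)
  have strict: "?Wn \<subset> weyl_group Type_B n"
  proof -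
    have "sigma n \<in> weyl_group Type_B n"
      unfolding sigma_eq weyl_group_B by (intro signed_actionsI sigma_signed_perm n)
    then show ?thesis using weyl_group_D_subset_B[of n] sigma_notin_weyl_group[OF n] by blast
  qed
  have sc: "sign_changes n \<subseteq> weyl_group Type_B n"
    unfolding weyl_group_B sign_changes_def signed_permutation_eq
    by (auto simp: signed_perms_def permutes_id intro!: signed_actionsI)
  have restr_real: "restrictions (weyl_group Type_B n) ?hnR = restrictions (stabilizer_of ?hn ?Wk) ?hnR"
  proof -
    have "restrict (restrict w ?hn) ?hnR = restrict w ?hnR" for w :: "vec \<Rightarrow> vec"
      using cartan_real_subset[of Type_D n] by (simp add: Int_absorb1)
    then show ?thesis unfolding S[symmetric] restrictions_def image_image by simp
  qed
  note inv = restrictions_invariants_D[OF n4 less]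
  show "restrictions (stabilizer_of ?hn ?Wk) ?hn = {restrict w ?hn | w. w \<in> ?Wk \<and> w ` ?hn = ?hn}"
    by (rule stabilizer_eq)
  show "is_semidirect_product (BijGroup ?hn) (restrictions (stabilizer_of ?hn ?Wk) ?hn)
      (sign_changes n) (coordinate_permutations n)"
    unfolding S weyl_group_B by (rule signed_actions_semidirect)
  show "\<forall>w\<in>?Wn. \<exists>\<pi> \<epsilon>. \<pi> permutes {1..n} \<and> \<epsilon> \<in> sign_vectors n \<and>
      w = signed_permutation n \<pi> \<epsilon> \<and> even (card {j \<in> {1..n}. \<epsilon> j = -1})"
    using weyl_group_D_even_signs by blast
  show "\<forall>p\<in>restrictions (invariants ?Wk ?hkR) ?hnR. poly_in_squares n p"
    unfolding inv using type_B_invariants_poly_in_squares[OF n4] by blast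
  show "restrictions (invariants ?Wk ?hkR) ?hnR \<subseteq> invariants ?Wn ?hnR"
    unfolding inv by (rule invariants_antimono[OF weyl_group_D_subset_B])
  show "\<forall>c. c \<noteq> 0 \<longrightarrow> (\<lambda>x\<in>?hnR. c * pfaffian n x) \<in> invariants ?Wn ?hnR"
    using pfaffian_invariant[OF n4] by blast
  show "\<forall>c. c \<noteq> 0 \<longrightarrow> (\<lambda>x\<in>?hnR. c * pfaffian n x) \<notin> restrictions (invariants ?Wk ?hkR) ?hnR"
    unfolding inv using pfaffian_not_type_B_invariant[OF n4] by blast
  show "is_semidirect_product (BijGroup (cartan Type_D k)) (ext_weyl_group k) ?Wk (sigma_group k)"
    "is_semidirect_product (BijGroup ?hn) (ext_weyl_group n) ?Wn (sigma_group n)"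
    by (rule ext_weyl_group_semidirect[OF k], rule ext_weyl_group_semidirect[OF n])
  show "finite_reflection_group Type_D k (ext_weyl_group k)"
    by (rule ext_weyl_group_reflection_group[OF k4])
  show "even_invariants k = invariants (ext_weyl_group k) ?hkR"
    unfolding ext by (rule even_invariants_eq[OF k4])
  show "sign_changes n \<subseteq> restrictions (stabilizer_of ?hn ?Wk) ?hn" using sc by (simp only: S)
  show "?Wn \<subset> restrictions (stabilizer_of ?hn ?Wk) ?hn" using strict by (simp only: S)
  show "ext_weyl_group n = restrictions (stabilizer_of ?hn ?Wk) ?hn" by (simp only: S ext)
  show "restrictions (ext_weyl_group n) ?hnR = restrictions (stabilizer_of ?hn ?Wk) ?hnR"
    by (simp only: ext restr_real)
  show "ext_weyl_group n = restrictions (stabilizer_of ?hn (ext_weyl_group k)) ?hn"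
    by (simp only: ext S_ext)
  show "restrictions (invariants ?Wk ?hkR) ?hnR = restrictions (invariants (ext_weyl_group k) ?hkR) ?hnR"
    "restrictions (invariants (ext_weyl_group k) ?hkR) ?hnR = invariants (ext_weyl_group n) ?hnR"
    by (simp_all only: ext inv)
qed

end
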